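(* Let $\mathcal{A}$ be a weakly idempotent complete exact category. Let $S_C$ be the class of hereditary complete cotorsion pairs $(\mathcal{X},\mathcal{Y})$ in $\mathcal{A}$ such that $\omega=\mathcal{X}\cap\mathcal{Y}$ is contravariantly finite in $\mathcal{A}$, and let $S_M$ be the class of weakly projective model structures on $\mathcal{A}$. Then the maps $$\Phi:(\mathcal{X},\mathcal{Y})\mapsto(\mathrm{CoFib}_\omega,\mathrm{Fib}_\omega,\mathrm{Weq}_\omega)\quad\text{and}\quad \Psi:(\mathrm{CoFib},\mathrm{Fib},\mathrm{Weq})\mapsto(\mathcal{C},\mathrm{T}\mathcal{F})$$ give a bijection between $S_C$ and $S_M$ (i.e. they are well-defined mutually inverse maps $S_C\to S_M$ and $S_M\to S_C$), where $\mathcal{C}$ is the class of cofibrant objects and $\mathrm{T}\mathcal{F}$ is the class of trivially fibrant objects of the model structure $(\mathrm{CoFib},\mathrm{Fib},\mathrm{Weq})$.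
   Context: Exact categories are in the sense of Quillen, with conflations $X\xrightarrow{i}Y\xrightarrow{d}Z$, inflations $i$, deflations $d$; $0\to X\to Y\to Z\to 0$ is then called an admissible exact sequence. $\mathcal{A}$ is weakly idempotent complete if every splitting epimorphism is a deflation. $\operatorname{Ext}^1_{\mathcal{A}}$ is the Yoneda Ext of the exact structure. For $(\mathcal{X},\mathcal{Y})$ with $\omega=\mathcal{X}\cap\mathcal{Y}$: $\mathrm{CoFib}_\omega$ is the class of inflations $f$ with $\operatorname{Coker} f\in\mathcal{X}$; $\mathrm{Fib}_\omega$ is the class of morphisms $f:A\to B$ such that $\operatorname{Hom}_{\mathcal{A}}(W,f)$ is surjective for every $W\in\omega$; $\mathrm{Weq}_\omega$ is the class of morphisms $f:A\to B$ for which there exist $W\in\omega$ and $t:W\to B$ such that $(f,t):A\oplus W\to B$ is a deflation with $\operatorname{Ker}(f,t)\in\mathcal{Y}$. A cotorsion pair is a pair $(\mathcal{C},\mathcal{F})$ of classes of objects with $\mathcal{C}=\{X\mid\operatorname{Ext}^1_{\mathcal{A}}(X,F)=0\ \forall F\in\mathcal{F}\}$ and $\mathcal{F}=\{Y\mid\operatorname{Ext}^1_{\mathcal{A}}(C,Y)=0\ \forall C\in\mathcal{C}\}$. It is complete if for every object $X$ there are admissible exact sequences $0\to F\to C\to X\to 0$ and $0\to X\to F'\to C'\to 0$ with $C,C'\in\mathcal{C}$, $F,F'\in\mathcal{F}$. It is hereditary if $\mathcal{C}$ is closed under kernels of deflations and $\mathcal{F}$ is closed under cokernels of inflations. A full subcategory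 $\omega$ is contravariantly finite in $\mathcal{A}$ if every object $B$ admits a morphism $t:W\to B$ with $W\in\omega$ through which every morphism $W'\to B$ with $W'\in\omega$ factors. A model structure on a category is a triple $(\mathrm{CoFib},\mathrm{Fib},\mathrm{Weq})$ of classes of morphisms (cofibrations, fibrations, weak equivalences) satisfying: (two out of three) if two of $f,g,gf$ are in $\mathrm{Weq}$ so is the third; (retract) each of the three classes is closed under retracts; (lifting) cofibrations have the left lifting property with respect to $\mathrm{Fib}\cap\mathrm{Weq}$, and fibrations have the right lifting property with respect to $\mathrm{CoFib}\cap\mathrm{Weq}$; (factorization) every morphism $f$ factors as $f=pi$ with $i\in\mathrm{CoFib}\cap\mathrm{Weq}$, $p\in\mathrm{Fib}$, and as $f=qj$ with $j\in\mathrm{CoFib}$, $q\in\mathrm{Fib}\cap\mathrm{Weq}$. No limits or colimits are required. Trivial fibrations are the morphisms in $\mathrm{Fib}\cap\mathrm{Weq}$. An object $X$ is cofibrant if $0\to X$ is a cofibration, fibrant if $X\to0$ is a fibration, trivial if $0\to X$ (equivalently $X\to 0$) is a weak equivalence, and trivially fibrant if it is both trivial and fibrant. A model structure on an exact category is weakly projective if cofibrations are precisely the inflations with cofibrant cokernel, each trivial fibration is a deflation, and each object is fibrant. *)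

theory Defs
  imports "HOL-Algebra.Group"
begin

section \<open>Categories with explicit carriers\<close>

text \<open>The category, its abelian group structure on hom-sets and its conflations are data of a record
  with explicit carriers \<open>Obj\<close> and \<open>Arr\<close>; "class of objects" and "class of morphisms" are rendered as
  subsets of these carriers.\<close>

record ('o, 'm) cat_data =
  Obj :: "'o set"
  Arr :: "'m set"
  Dom :: "'m \<Rightarrow> 'o"
  Cod :: "'m \<Rightarrow> 'o"
  Ident :: "'o \<Rightarrow> 'm"
  Comp :: "'m \<Rightarrow> 'm \<Rightarrow> 'm"  (infixr \<open>\<cdot>\<index>\<close> 75)

definition Hom :: "('o, 'm, 'z) cat_data_scheme \<Rightarrow> 'o \<Rightarrow> 'o \<Rightarrow> 'm set" where
  "Hom \<A> X Y = {f \<in> Arr \<A>. Dom \<A> f = X \<and> Cod \<A> f = Y}"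

locale category =
  fixes \<A> :: "('o, 'm, 'z) cat_data_scheme" (structure)
  assumes Dom_in_Obj: "f \<in> Arr \<A> \<Longrightarrow> Dom \<A> f \<in> Obj \<A>"
    and Cod_in_Obj: "f \<in> Arr \<A> \<Longrightarrow> Cod \<A> f \<in> Obj \<A>"
    and Ident_in_Hom: "X \<in> Obj \<A> \<Longrightarrow> Ident \<A> X \<in> Hom \<A> X X"
    and Comp_in_Hom: "f \<in> Hom \<A> X Y \<Longrightarrow> g \<in> Hom \<A> Y Z \<Longrightarrow> g \<cdot> f \<in> Hom \<A> X Z"
    and Comp_Ident: "f \<in> Hom \<A> X Y \<Longrightarrow> f \<cdot> Ident \<A> X = f"
    and Ident_Comp: "f \<in> Hom \<A> X Y \<Longrightarrow> Ident \<A> Y \<cdot> f = f"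
    and Comp_assoc: "f \<in> Hom \<A> W X \<Longrightarrow> g \<in> Hom \<A> X Y \<Longrightarrow> h \<in> Hom \<A> Y Z \<Longrightarrow>
      (h \<cdot> g) \<cdot> f = h \<cdot> (g \<cdot> f)"

definition is_iso :: "('o, 'm, 'z) cat_data_scheme \<Rightarrow> 'm \<Rightarrow> bool" where
  "is_iso \<A> f \<longleftrightarrow> f \<in> Arr \<A> \<and>
     (\<exists>g \<in> Hom \<A> (Cod \<A> f) (Dom \<A> f).
        g \<cdot>\<^bsub>\<A>\<^esub> f = Ident \<A> (Dom \<A> f) \<and> f \<cdot>\<^bsub>\<A>\<^esub> g = Ident \<A> (Cod \<A> f))"

definition is_split_epi :: "('o, 'm, 'z) cat_data_scheme \<Rightarrow> 'm \<Rightarrow> bool" where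
  "is_split_epi \<A> p \<longleftrightarrow> p \<in> Arr \<A> \<and>
     (\<exists>s \<in> Hom \<A> (Cod \<A> p) (Dom \<A> p). p \<cdot>\<^bsub>\<A>\<^esub> s = Ident \<A> (Cod \<A> p))"

definition is_zero_object :: "('o, 'm, 'z) cat_data_scheme \<Rightarrow> 'o \<Rightarrow> bool" where
  "is_zero_object \<A> Z \<longleftrightarrow> Z \<in> Obj \<A> \<and>
     (\<forall>X \<in> Obj \<A>. (\<exists>!f. f \<in> Hom \<A> Z X) \<and> (\<exists>!f. f \<in> Hom \<A> X Z))"

text \<open>\<open>j\<close> is the pushout of \<open>i\<close> along \<open>f\<close>, and \<open>f'\<close> the pushout of \<open>f\<close> along \<open>i\<close>:
  the square \<open>f' \<cdot> i = j \<cdot> f\<close>.\<close>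

definition is_pushout :: "('o, 'm, 'z) cat_data_scheme \<Rightarrow> 'm \<Rightarrow> 'm \<Rightarrow> 'm \<Rightarrow> 'm \<Rightarrow> bool" where
  "is_pushout \<A> i f j f' \<longleftrightarrow>
     i \<in> Arr \<A> \<and> f \<in> Arr \<A> \<and> j \<in> Arr \<A> \<and> f' \<in> Arr \<A> \<and>
     Dom \<A> i = Dom \<A> f \<and> Dom \<A> f' = Cod \<A> i \<and> Dom \<A> j = Cod \<A> f \<and> Cod \<A> f' = Cod \<A> j \<and>
     f' \<cdot>\<^bsub>\<A>\<^esub> i = j \<cdot>\<^bsub>\<A>\<^esub> f \<and>
     (\<forall>T \<in> Obj \<A>. \<forall>u \<in> Hom \<A> (Cod \<A> i) T. \<forall>v \<in> Hom \<A> (Cod \<A> f) T.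
        u \<cdot>\<^bsub>\<A>\<^esub> i = v \<cdot>\<^bsub>\<A>\<^esub> f \<longrightarrow>
        (\<exists>!h. h \<in> Hom \<A> (Cod \<A> j) T \<and> h \<cdot>\<^bsub>\<A>\<^esub> f' = u \<and> h \<cdot>\<^bsub>\<A>\<^esub> j = v))"

text \<open>\<open>e\<close> is the pullback of \<open>d\<close> along \<open>f\<close>: the square \<open>d \<cdot> f' = f \<cdot> e\<close>.\<close>

definition is_pullback :: "('o, 'm, 'z) cat_data_scheme \<Rightarrow> 'm \<Rightarrow> 'm \<Rightarrow> 'm \<Rightarrow> 'm \<Rightarrow> bool" where
  "is_pullback \<A> d f e f' \<longleftrightarrow>
     d \<in> Arr \<A> \<and> f \<in> Arr \<A> \<and> e \<in> Arr \<A> \<and> f' \<in> Arr \<A> \<and>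
     Cod \<A> d = Cod \<A> f \<and> Cod \<A> f' = Dom \<A> d \<and> Cod \<A> e = Dom \<A> f \<and> Dom \<A> f' = Dom \<A> e \<and>
     d \<cdot>\<^bsub>\<A>\<^esub> f' = f \<cdot>\<^bsub>\<A>\<^esub> e \<and>
     (\<forall>T \<in> Obj \<A>. \<forall>u \<in> Hom \<A> T (Dom \<A> d). \<forall>v \<in> Hom \<A> T (Dom \<A> f).
        d \<cdot>\<^bsub>\<A>\<^esub> u = f \<cdot>\<^bsub>\<A>\<^esub> v \<longrightarrow>
        (\<exists>!h. h \<in> Hom \<A> T (Dom \<A> e) \<and> f' \<cdot>\<^bsub>\<A>\<^esub> h = u \<and> e \<cdot>\<^bsub>\<A>\<^esub> h = v))"


section \<open>Additive categories\<close>

record ('o, 'm) add_cat_data = "('o, 'm) cat_data" +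
  Add_Arr :: "'m \<Rightarrow> 'm \<Rightarrow> 'm"  (infixl \<open>\<oplus>\<index>\<close> 65)
  Zero_Arr :: "'o \<Rightarrow> 'o \<Rightarrow> 'm"

definition is_biproduct ::
  "('o, 'm, 'z) add_cat_data_scheme \<Rightarrow> 'o \<Rightarrow> 'o \<Rightarrow> 'o \<Rightarrow> 'm \<Rightarrow> 'm \<Rightarrow> 'm \<Rightarrow> 'm \<Rightarrow> bool" where
  "is_biproduct \<A> X Y P iX iY pX pY \<longleftrightarrow>
     iX \<in> Hom \<A> X P \<and> iY \<in> Hom \<A> Y P \<and> pX \<in> Hom \<A> P X \<and> pY \<in> Hom \<A> P Y \<and>
     pX \<cdot>\<^bsub>\<A>\<^esub> iX = Ident \<A> X \<and> pY \<cdot>\<^bsub>\<A>\<^esub> iY = Ident \<A> Y \<and>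
     pX \<cdot>\<^bsub>\<A>\<^esub> iY = Zero_Arr \<A> Y X \<and> pY \<cdot>\<^bsub>\<A>\<^esub> iX = Zero_Arr \<A> X Y \<and>
     (iX \<cdot>\<^bsub>\<A>\<^esub> pX) \<oplus>\<^bsub>\<A>\<^esub> (iY \<cdot>\<^bsub>\<A>\<^esub> pY) = Ident \<A> P"

locale additive_category = category \<A>
  for \<A> :: "('o, 'm, 'z) add_cat_data_scheme" (structure) +
  assumes Hom_group: "X \<in> Obj \<A> \<Longrightarrow> Y \<in> Obj \<A> \<Longrightarrow>
      comm_group \<lparr>carrier = Hom \<A> X Y, mult = Add_Arr \<A>, one = Zero_Arr \<A> X Y\<rparr>"
    and Comp_Add: "f \<in> Hom \<A> X Y \<Longrightarrow> g \<in> Hom \<A> Y Z \<Longrightarrow> h \<in> Hom \<A> Y Z \<Longrightarrow>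
      (g \<oplus> h) \<cdot> f = (g \<cdot> f) \<oplus> (h \<cdot> f)"
    and Add_Comp: "f \<in> Hom \<A> X Y \<Longrightarrow> g \<in> Hom \<A> X Y \<Longrightarrow> h \<in> Hom \<A> Y Z \<Longrightarrow>
      h \<cdot> (f \<oplus> g) = (h \<cdot> f) \<oplus> (h \<cdot> g)"
    and zero_object_exists: "\<exists>Z. is_zero_object \<A> Z"
    and biproduct_exists: "X \<in> Obj \<A> \<Longrightarrow> Y \<in> Obj \<A> \<Longrightarrow>
      \<exists>P iX iY pX pY. is_biproduct \<A> X Y P iX iY pX pY"

definition is_kernel :: "('o, 'm, 'z) add_cat_data_scheme \<Rightarrow> 'm \<Rightarrow> 'm \<Rightarrow> bool" where
  "is_kernel \<A> k f \<longleftrightarrow>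
     k \<in> Arr \<A> \<and> f \<in> Arr \<A> \<and> Cod \<A> k = Dom \<A> f \<and>
     f \<cdot>\<^bsub>\<A>\<^esub> k = Zero_Arr \<A> (Dom \<A> k) (Cod \<A> f) \<and>
     (\<forall>T \<in> Obj \<A>. \<forall>g \<in> Hom \<A> T (Dom \<A> f). f \<cdot>\<^bsub>\<A>\<^esub> g = Zero_Arr \<A> T (Cod \<A> f) \<longrightarrow>
        (\<exists>!h. h \<in> Hom \<A> T (Dom \<A> k) \<and> k \<cdot>\<^bsub>\<A>\<^esub> h = g))"

definition is_cokernel :: "('o, 'm, 'z) add_cat_data_scheme \<Rightarrow> 'm \<Rightarrow> 'm \<Rightarrow> bool" where
  "is_cokernel \<A> c f \<longleftrightarrow>
     c \<in> Arr \<A> \<and> f \<in> Arr \<A> \<and> Dom \<A> c = Cod \<A> f \<and>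
     c \<cdot>\<^bsub>\<A>\<^esub> f = Zero_Arr \<A> (Dom \<A> f) (Cod \<A> c) \<and>
     (\<forall>T \<in> Obj \<A>. \<forall>g \<in> Hom \<A> (Cod \<A> f) T. g \<cdot>\<^bsub>\<A>\<^esub> f = Zero_Arr \<A> (Dom \<A> f) T \<longrightarrow>
        (\<exists>!h. h \<in> Hom \<A> (Cod \<A> c) T \<and> h \<cdot>\<^bsub>\<A>\<^esub> c = g))"

definition is_kernel_cokernel_pair :: "('o, 'm, 'z) add_cat_data_scheme \<Rightarrow> 'm \<Rightarrow> 'm \<Rightarrow> bool" where
  "is_kernel_cokernel_pair \<A> i d \<longleftrightarrow> is_kernel \<A> i d \<and> is_cokernel \<A> d i"

text \<open>Kernels and cokernels are only determined up to isomorphism; "\<open>Ker f\<close> (\<open>Coker f\<close>) exists and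
  lies in \<open>\<S>\<close>" means that some representative does, which is the same as all of them for the
  isomorphism-closed classes to which this is applied.\<close>

definition Ker_in :: "('o, 'm, 'z) add_cat_data_scheme \<Rightarrow> 'm \<Rightarrow> 'o set \<Rightarrow> bool" where
  "Ker_in \<A> f \<S> \<longleftrightarrow> (\<exists>k. is_kernel \<A> k f \<and> Dom \<A> k \<in> \<S>)"

definition Coker_in :: "('o, 'm, 'z) add_cat_data_scheme \<Rightarrow> 'm \<Rightarrow> 'o set \<Rightarrow> bool" where
  "Coker_in \<A> f \<S> \<longleftrightarrow> (\<exists>c. is_cokernel \<A> c f \<and> Cod \<A> c \<in> \<S>)"


section \<open>Exact categories\<close>

record ('o, 'm) exact_cat_data = "('o, 'm) add_cat_data" +
  Conf :: "('m \<times> 'm) set"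

definition inflations :: "('o, 'm, 'z) exact_cat_data_scheme \<Rightarrow> 'm set" where
  "inflations \<A> = {i. \<exists>d. (i, d) \<in> Conf \<A>}"

definition deflations :: "('o, 'm, 'z) exact_cat_data_scheme \<Rightarrow> 'm set" where
  "deflations \<A> = {d. \<exists>i. (i, d) \<in> Conf \<A>}"

text \<open>Quillen's axioms in the self-dual form of Buehler's survey.\<close>

locale exact_category = additive_category \<A>
  for \<A> :: "('o, 'm, 'z) exact_cat_data_scheme" (structure) +
  assumes Conf_kernel_cokernel: "(i, d) \<in> Conf \<A> \<Longrightarrow> is_kernel_cokernel_pair \<A> i d"
    and Conf_iso_closed:
      "(i, d) \<in> Conf \<A> \<Longrightarrow> is_kernel_cokernel_pair \<A> i' d' \<Longrightarrow>
       is_iso \<A> a \<Longrightarrow> is_iso \<A> b \<Longrightarrow> is_iso \<A> c \<Longrightarrow>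
       a \<in> Hom \<A> (Dom \<A> i) (Dom \<A> i') \<Longrightarrow> b \<in> Hom \<A> (Cod \<A> i) (Cod \<A> i') \<Longrightarrow>
       c \<in> Hom \<A> (Cod \<A> d) (Cod \<A> d') \<Longrightarrow>
       b \<cdot> i = i' \<cdot> a \<Longrightarrow> c \<cdot> d = d' \<cdot> b \<Longrightarrow> (i', d') \<in> Conf \<A>"
    and Ident_inflation: "X \<in> Obj \<A> \<Longrightarrow> Ident \<A> X \<in> inflations \<A>"
    and Ident_deflation: "X \<in> Obj \<A> \<Longrightarrow> Ident \<A> X \<in> deflations \<A>"
    and inflation_Comp: "i \<in> inflations \<A> \<Longrightarrow> j \<in> inflations \<A> \<Longrightarrow> Dom \<A> j = Cod \<A> i \<Longrightarrow>
      j \<cdot> i \<in> inflations \<A>"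
    and deflation_Comp: "d \<in> deflations \<A> \<Longrightarrow> e \<in> deflations \<A> \<Longrightarrow> Dom \<A> e = Cod \<A> d \<Longrightarrow>
      e \<cdot> d \<in> deflations \<A>"
    and inflation_pushout: "i \<in> inflations \<A> \<Longrightarrow> f \<in> Arr \<A> \<Longrightarrow> Dom \<A> f = Dom \<A> i \<Longrightarrow>
      \<exists>j f'. is_pushout \<A> i f j f' \<and> j \<in> inflations \<A>"
    and deflation_pullback: "d \<in> deflations \<A> \<Longrightarrow> f \<in> Arr \<A> \<Longrightarrow> Cod \<A> f = Cod \<A> d \<Longrightarrow>
      \<exists>e f'. is_pullback \<A> d f e f' \<and> e \<in> deflations \<A>"

locale wic_exact_category = exact_category \<A>
  for \<A> :: "('o, 'm, 'z) exact_cat_data_scheme" (structure) +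
  assumes split_epi_deflation: "is_split_epi \<A> p \<Longrightarrow> p \<in> deflations \<A>"


section \<open>Yoneda Ext and cotorsion pairs\<close>

definition adm_exact :: "('o, 'm, 'z) exact_cat_data_scheme \<Rightarrow> 'o \<Rightarrow> 'o \<Rightarrow> 'o \<Rightarrow> bool" where
  "adm_exact \<A> X Y Z \<longleftrightarrow> (\<exists>i \<in> Hom \<A> X Y. \<exists>d \<in> Hom \<A> Y Z. (i, d) \<in> Conf \<A>)"

definition extensions :: "('o, 'm, 'z) exact_cat_data_scheme \<Rightarrow> 'o \<Rightarrow> 'o \<Rightarrow> ('m \<times> 'm) set" where
  "extensions \<A> X F = {(i, d). (i, d) \<in> Conf \<A> \<and> Dom \<A> i = F \<and> Cod \<A> d = X}"

definition ext_equiv ::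
  "('o, 'm, 'z) exact_cat_data_scheme \<Rightarrow> 'o \<Rightarrow> 'o \<Rightarrow> (('m \<times> 'm) \<times> ('m \<times> 'm)) set" where
  "ext_equiv \<A> X F =
     {((i, d), (i', d')). (i, d) \<in> extensions \<A> X F \<and> (i', d') \<in> extensions \<A> X F \<and>
        (\<exists>\<phi> \<in> Hom \<A> (Cod \<A> i) (Cod \<A> i'). is_iso \<A> \<phi> \<and>
           \<phi> \<cdot>\<^bsub>\<A>\<^esub> i = i' \<and> d' \<cdot>\<^bsub>\<A>\<^esub> \<phi> = d)}"

text \<open>The underlying set of \<open>Ext\<^sup>1(X, F)\<close>.  The zero of the Baer sum is the class of
  \<open>F \<rightarrow> F \<oplus> X \<rightarrow> X\<close>, so the group vanishes iff this class is the only element.\<close>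

definition Ext1 :: "('o, 'm, 'z) exact_cat_data_scheme \<Rightarrow> 'o \<Rightarrow> 'o \<Rightarrow> ('m \<times> 'm) set set" where
  "Ext1 \<A> X F = extensions \<A> X F // ext_equiv \<A> X F"

definition Ext1_zero :: "('o, 'm, 'z) exact_cat_data_scheme \<Rightarrow> 'o \<Rightarrow> 'o \<Rightarrow> ('m \<times> 'm) set" where
  "Ext1_zero \<A> X F =
     ext_equiv \<A> X F `` {(iF, pX) | P iF iX pF pX. is_biproduct \<A> F X P iF iX pF pX}"

definition Ext1_vanishes :: "('o, 'm, 'z) exact_cat_data_scheme \<Rightarrow> 'o \<Rightarrow> 'o \<Rightarrow> bool" where
  "Ext1_vanishes \<A> X F \<longleftrightarrow> Ext1 \<A> X F = {Ext1_zero \<A> X F}"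

definition cotorsion_pair ::
  "('o, 'm, 'z) exact_cat_data_scheme \<Rightarrow> 'o set \<Rightarrow> 'o set \<Rightarrow> bool" where
  "cotorsion_pair \<A> \<C> \<F> \<longleftrightarrow> \<C> \<subseteq> Obj \<A> \<and> \<F> \<subseteq> Obj \<A> \<and>
     \<C> = {X \<in> Obj \<A>. \<forall>F \<in> \<F>. Ext1_vanishes \<A> X F} \<and>
     \<F> = {Y \<in> Obj \<A>. \<forall>C \<in> \<C>. Ext1_vanishes \<A> C Y}"

definition complete_pair ::
  "('o, 'm, 'z) exact_cat_data_scheme \<Rightarrow> 'o set \<Rightarrow> 'o set \<Rightarrow> bool" where
  "complete_pair \<A> \<C> \<F> \<longleftrightarrow>
     (\<forall>X \<in> Obj \<A>. (\<exists>F \<in> \<F>. \<exists>C \<in> \<C>. adm_exact \<A> F C X) \<and>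
                 (\<exists>F' \<in> \<F>. \<exists>C' \<in> \<C>. adm_exact \<A> X F' C'))"

definition hereditary_pair ::
  "('o, 'm, 'z) exact_cat_data_scheme \<Rightarrow> 'o set \<Rightarrow> 'o set \<Rightarrow> bool" where
  "hereditary_pair \<A> \<C> \<F> \<longleftrightarrow>
     (\<forall>X Y Z. adm_exact \<A> X Y Z \<and> Y \<in> \<C> \<and> Z \<in> \<C> \<longrightarrow> X \<in> \<C>) \<and>
     (\<forall>X Y Z. adm_exact \<A> X Y Z \<and> X \<in> \<F> \<and> Y \<in> \<F> \<longrightarrow> Z \<in> \<F>)"

definition contravariantly_finite :: "('o, 'm, 'z) cat_data_scheme \<Rightarrow> 'o set \<Rightarrow> bool" where
  "contravariantly_finite \<A> \<omega> \<longleftrightarrow>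
     (\<forall>B \<in> Obj \<A>. \<exists>W \<in> \<omega>. \<exists>t \<in> Hom \<A> W B.
        \<forall>W' \<in> \<omega>. \<forall>g \<in> Hom \<A> W' B. \<exists>h \<in> Hom \<A> W' W. t \<cdot>\<^bsub>\<A>\<^esub> h = g)"


section \<open>Model structures\<close>

text \<open>\<open>f\<close> is a retract of \<open>g\<close> in the category of arrows.\<close>

definition is_retract_of :: "('o, 'm, 'z) cat_data_scheme \<Rightarrow> 'm \<Rightarrow> 'm \<Rightarrow> bool" where
  "is_retract_of \<A> f g \<longleftrightarrow> f \<in> Arr \<A> \<and> g \<in> Arr \<A> \<and>
     (\<exists>s \<in> Hom \<A> (Dom \<A> f) (Dom \<A> g). \<exists>r \<in> Hom \<A> (Dom \<A> g) (Dom \<A> f).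
      \<exists>s' \<in> Hom \<A> (Cod \<A> f) (Cod \<A> g). \<exists>r' \<in> Hom \<A> (Cod \<A> g) (Cod \<A> f).
        r \<cdot>\<^bsub>\<A>\<^esub> s = Ident \<A> (Dom \<A> f) \<and> r' \<cdot>\<^bsub>\<A>\<^esub> s' = Ident \<A> (Cod \<A> f) \<and>
        g \<cdot>\<^bsub>\<A>\<^esub> s = s' \<cdot>\<^bsub>\<A>\<^esub> f \<and> f \<cdot>\<^bsub>\<A>\<^esub> r = r' \<cdot>\<^bsub>\<A>\<^esub> g)"

definition retract_closed :: "('o, 'm, 'z) cat_data_scheme \<Rightarrow> 'm set \<Rightarrow> bool" where
  "retract_closed \<A> \<S> \<longleftrightarrow> (\<forall>f g. g \<in> \<S> \<and> is_retract_of \<A> f g \<longrightarrow> f \<in> \<S>)"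

definition two_out_of_three :: "('o, 'm, 'z) cat_data_scheme \<Rightarrow> 'm set \<Rightarrow> bool" where
  "two_out_of_three \<A> \<S> \<longleftrightarrow>
     (\<forall>f \<in> Arr \<A>. \<forall>g \<in> Arr \<A>. Dom \<A> g = Cod \<A> f \<longrightarrow>
        (f \<in> \<S> \<and> g \<in> \<S> \<longrightarrow> g \<cdot>\<^bsub>\<A>\<^esub> f \<in> \<S>) \<and>
        (f \<in> \<S> \<and> g \<cdot>\<^bsub>\<A>\<^esub> f \<in> \<S> \<longrightarrow> g \<in> \<S>) \<and>
        (g \<in> \<S> \<and> g \<cdot>\<^bsub>\<A>\<^esub> f \<in> \<S> \<longrightarrow> f \<in> \<S>))"

text \<open>Every commutative square \<open>v \<cdot> i = p \<cdot> u\<close> has a diagonal filler: \<open>i\<close> has the left lifting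
  property with respect to \<open>p\<close>, and \<open>p\<close> the right lifting property with respect to \<open>i\<close>.\<close>

definition has_lifting :: "('o, 'm, 'z) cat_data_scheme \<Rightarrow> 'm \<Rightarrow> 'm \<Rightarrow> bool" where
  "has_lifting \<A> i p \<longleftrightarrow>
     (\<forall>u \<in> Hom \<A> (Dom \<A> i) (Dom \<A> p). \<forall>v \<in> Hom \<A> (Cod \<A> i) (Cod \<A> p).
        v \<cdot>\<^bsub>\<A>\<^esub> i = p \<cdot>\<^bsub>\<A>\<^esub> u \<longrightarrow>
        (\<exists>h \<in> Hom \<A> (Cod \<A> i) (Dom \<A> p). h \<cdot>\<^bsub>\<A>\<^esub> i = u \<and> p \<cdot>\<^bsub>\<A>\<^esub> h = v))"

definition has_factorizations ::
  "('o, 'm, 'z) cat_data_scheme \<Rightarrow> 'm set \<Rightarrow> 'm set \<Rightarrow> bool" where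
  "has_factorizations \<A> \<L> \<R> \<longleftrightarrow>
     (\<forall>f \<in> Arr \<A>. \<exists>i \<in> \<L>. \<exists>p \<in> \<R>. Dom \<A> p = Cod \<A> i \<and> f = p \<cdot>\<^bsub>\<A>\<^esub> i)"

locale model_structure = category \<A>
  for \<A> :: "('o, 'm, 'z) cat_data_scheme" (structure) +
  fixes CoFib Fib Weq :: "'m set"
  assumes CoFib_Arr: "CoFib \<subseteq> Arr \<A>"
    and Fib_Arr: "Fib \<subseteq> Arr \<A>"
    and Weq_Arr: "Weq \<subseteq> Arr \<A>"
    and Weq_two_out_of_three: "two_out_of_three \<A> Weq"
    and CoFib_retract: "retract_closed \<A> CoFib"
    and Fib_retract: "retract_closed \<A> Fib"
    and Weq_retract: "retract_closed \<A> Weq"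
    and CoFib_lifting: "i \<in> CoFib \<Longrightarrow> p \<in> Fib \<inter> Weq \<Longrightarrow> has_lifting \<A> i p"
    and Fib_lifting: "i \<in> CoFib \<inter> Weq \<Longrightarrow> p \<in> Fib \<Longrightarrow> has_lifting \<A> i p"
    and factorization_triv_CoFib: "has_factorizations \<A> (CoFib \<inter> Weq) Fib"
    and factorization_triv_Fib: "has_factorizations \<A> CoFib (Fib \<inter> Weq)"

text \<open>Zero objects are only determined up to isomorphism.  The classes of a model structure are
  closed under isomorphism of arrows (by retracts), so the choice of zero object is immaterial.\<close>

definition cofibrant_objects ::
  "('o, 'm, 'z) add_cat_data_scheme \<Rightarrow> 'm set \<Rightarrow> 'o set" where
  "cofibrant_objects \<A> CoFib =
     {X \<in> Obj \<A>. \<exists>Z. is_zero_object \<A> Z \<and> Zero_Arr \<A> Z X \<in> CoFib}"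

definition fibrant_objects ::
  "('o, 'm, 'z) add_cat_data_scheme \<Rightarrow> 'm set \<Rightarrow> 'o set" where
  "fibrant_objects \<A> Fib =
     {X \<in> Obj \<A>. \<exists>Z. is_zero_object \<A> Z \<and> Zero_Arr \<A> X Z \<in> Fib}"

definition trivial_objects ::
  "('o, 'm, 'z) add_cat_data_scheme \<Rightarrow> 'm set \<Rightarrow> 'o set" where
  "trivial_objects \<A> Weq =
     {X \<in> Obj \<A>. \<exists>Z. is_zero_object \<A> Z \<and> Zero_Arr \<A> Z X \<in> Weq}"

definition weakly_projective ::
  "('o, 'm, 'z) exact_cat_data_scheme \<Rightarrow> 'm set \<Rightarrow> 'm set \<Rightarrow> 'm set \<Rightarrow> bool" where
  "weakly_projective \<A> CoFib Fib Weq \<longleftrightarrow>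
     CoFib = {f \<in> inflations \<A>. Coker_in \<A> f (cofibrant_objects \<A> CoFib)} \<and>
     Fib \<inter> Weq \<subseteq> deflations \<A> \<and>
     fibrant_objects \<A> Fib = Obj \<A>"


section \<open>The two classes and the two maps\<close>

definition CoFib_\<omega> :: "('o, 'm, 'z) exact_cat_data_scheme \<Rightarrow> 'o set \<Rightarrow> 'm set" where
  "CoFib_\<omega> \<A> \<X> = {f \<in> inflations \<A>. Coker_in \<A> f \<X>}"

definition Fib_\<omega> :: "('o, 'm, 'z) exact_cat_data_scheme \<Rightarrow> 'o set \<Rightarrow> 'o set \<Rightarrow> 'm set" where
  "Fib_\<omega> \<A> \<X> \<Y> =
     {f \<in> Arr \<A>. \<forall>W \<in> \<X> \<inter> \<Y>. \<forall>g \<in> Hom \<A> W (Cod \<A> f).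
        \<exists>h \<in> Hom \<A> W (Dom \<A> f). f \<cdot>\<^bsub>\<A>\<^esub> h = g}"

text \<open>The morphism \<open>(f, t)\<close> out of the biproduct is \<open>f \<cdot> pA + t \<cdot> pW\<close>.\<close>

definition Weq_\<omega> :: "('o, 'm, 'z) exact_cat_data_scheme \<Rightarrow> 'o set \<Rightarrow> 'o set \<Rightarrow> 'm set" where
  "Weq_\<omega> \<A> \<X> \<Y> =
     {f \<in> Arr \<A>. \<exists>W \<in> \<X> \<inter> \<Y>. \<exists>t \<in> Hom \<A> W (Cod \<A> f).
        \<exists>P iA iW pA pW. is_biproduct \<A> (Dom \<A> f) W P iA iW pA pW \<and>
          (f \<cdot>\<^bsub>\<A>\<^esub> pA) \<oplus>\<^bsub>\<A>\<^esub> (t \<cdot>\<^bsub>\<A>\<^esub> pW) \<in> deflations \<A> \<and>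
          Ker_in \<A> ((f \<cdot>\<^bsub>\<A>\<^esub> pA) \<oplus>\<^bsub>\<A>\<^esub> (t \<cdot>\<^bsub>\<A>\<^esub> pW)) \<Y>}"

definition S_C :: "('o, 'm, 'z) exact_cat_data_scheme \<Rightarrow> ('o set \<times> 'o set) set" where
  "S_C \<A> = {(\<X>, \<Y>). cotorsion_pair \<A> \<X> \<Y> \<and> complete_pair \<A> \<X> \<Y> \<and> hereditary_pair \<A> \<X> \<Y> \<and>
     contravariantly_finite \<A> (\<X> \<inter> \<Y>)}"

definition S_M :: "('o, 'm, 'z) exact_cat_data_scheme \<Rightarrow> ('m set \<times> 'm set \<times> 'm set) set" where
  "S_M \<A> = {(CoFib, Fib, Weq). model_structure \<A> CoFib Fib Weq \<and>
     weakly_projective \<A> CoFib Fib Weq}"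

definition \<Phi> ::
  "('o, 'm, 'z) exact_cat_data_scheme \<Rightarrow> 'o set \<times> 'o set \<Rightarrow> 'm set \<times> 'm set \<times> 'm set" where
  "\<Phi> \<A> = (\<lambda>(\<X>, \<Y>). (CoFib_\<omega> \<A> \<X>, Fib_\<omega> \<A> \<X> \<Y>, Weq_\<omega> \<A> \<X> \<Y>))"

definition \<Psi> ::
  "('o, 'm, 'z) exact_cat_data_scheme \<Rightarrow> 'm set \<times> 'm set \<times> 'm set \<Rightarrow> 'o set \<times> 'o set" where
  "\<Psi> \<A> = (\<lambda>(CoFib, Fib, Weq).
     (cofibrant_objects \<A> CoFib, trivial_objects \<A> Weq \<inter> fibrant_objects \<A> Fib))"

end

theory Submission
  imports Defs
begin

text \<open>The crux is two out of three for \<open>Weq_\<omega>\<close>.  Writing \<open>\<omega> = \<X> \<inter> \<Y>\<close>, a morphism \<open>f : A \<rightarrow> B\<close> lies in \<open>Weq_\<omega>\<close> iff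
  \<open>Hom(X, A)/\<omega> \<rightarrow> Hom(X, B)/\<omega>\<close> is bijective for all \<open>X\<close> in \<open>\<X>\<close>, a condition for which two out of three and closure
  under retracts are evident.  All vanishing of \<open>Ext\<^sup>1\<close> is used through splittings of conflations and the
  resulting lifting property of inflations with cokernel in \<open>\<X>\<close> against deflations with kernel in \<open>\<Y>\<close>.
  Conversely, in a weakly projective model structure the trivial cofibrations are the split monomorphisms
  with cokernel in \<open>\<omega>\<close> (because all objects are fibrant), so the fibrations are \<open>Fib_\<omega>\<close>; cofibrations and
  fibrations determine the weak equivalences.\<close>

section \<open>Calculus in additive categories\<close>

text \<open>The defining condition of \<open>Weq_\<omega>\<close> is existential in W and t, and the
  data chosen for two morphisms do not visibly compose or cancel; testing on Hom out of
  \<open>\<X>\<close> modulo \<omega> removes the choice. The test objects come from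
  \<open>\<X>\<close> because such objects lift along the deflation (f, t), whose kernel lies in
  \<open>\<Y>\<close>, and because each of them embeds into an object of \<omega> with cokernel in
  \<open>\<X>\<close>, so that every morphism from it to an object of \<open>\<Y>\<close> factors
  through \<omega>. For the way back, contravariant finiteness supplies a single t that absorbs all
  errors from \<omega> at once, weak idempotent completeness makes (f, t) a deflation since a
  special precover factors through it, and heredity places its kernel in \<open>\<Y>\<close>. On the
  side of model structures, completeness of the pair comes from factoring morphisms to and from a
  zero object into a cofibration and a trivial fibration, contravariant finiteness from the other
  factorization, and heredity from two out of three.\<close>

context category
begin

text \<open>Carries the object facts along, so that adding \<open>h[unfolded Hom_iff]\<close> for
  each morphism at hand to the simp set discharges the typing premises of the calculation
  rules.\<close>

lemma Hom_iff:
  "f \<in> Hom \<A> X Y \<longleftrightarrow> f \<in> Arr \<A> \<and> Dom \<A> f = X \<and> Cod \<A> f = Y \<and> X \<in> Obj \<A> \<and> Y \<in> Obj \<A>"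
  by (auto simp: Hom_def Dom_in_Obj Cod_in_Obj)

lemma Arr_Hom: "f \<in> Arr \<A> \<Longrightarrow> f \<in> Hom \<A> (Dom \<A> f) (Cod \<A> f)"
  by (simp add: Hom_def)

lemma Dom_Cod_Obj [simp]: "f \<in> Arr \<A> \<Longrightarrow> Dom \<A> f \<in> Obj \<A>" "f \<in> Arr \<A> \<Longrightarrow> Cod \<A> f \<in> Obj \<A>"
  by (auto intro: Dom_in_Obj Cod_in_Obj)

lemma Comp_simps [simp]:
  assumes "f \<in> Arr \<A>" "g \<in> Arr \<A>" "Dom \<A> g = Cod \<A> f"
  shows "g \<cdot> f \<in> Arr \<A>" "Dom \<A> (g \<cdot> f) = Dom \<A> f" "Cod \<A> (g \<cdot> f) = Cod \<A> g"
  using Comp_in_Hom[of f "Dom \<A> f" "Cod \<A> f" g "Cod \<A> g"] assms by (auto simp: Hom_def)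

lemma Ident_simps [simp]:
  assumes "X \<in> Obj \<A>"
  shows "Ident \<A> X \<in> Arr \<A>" "Dom \<A> (Ident \<A> X) = X" "Cod \<A> (Ident \<A> X) = X"
  using Ident_in_Hom[OF assms] by (auto simp: Hom_def)

lemma Comp_assoc' [simp]:
  assumes "f \<in> Arr \<A>" "g \<in> Arr \<A>" "h \<in> Arr \<A>" "Dom \<A> g = Cod \<A> f" "Dom \<A> h = Cod \<A> g"
  shows "(h \<cdot> g) \<cdot> f = h \<cdot> (g \<cdot> f)"
  using Comp_assoc[of f "Dom \<A> f" "Cod \<A> f" g "Cod \<A> g" h "Cod \<A> h"] assms by (simp add: Hom_def)

lemma Comp_Ident' [simp]: "f \<in> Arr \<A> \<Longrightarrow> Dom \<A> f = X \<Longrightarrow> f \<cdot> Ident \<A> X = f"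
  using Comp_Ident[of f "Dom \<A> f" "Cod \<A> f"] by (auto simp: Hom_def)

lemma Ident_Comp' [simp]: "f \<in> Arr \<A> \<Longrightarrow> Cod \<A> f = X \<Longrightarrow> Ident \<A> X \<cdot> f = f"
  using Ident_Comp[of f "Dom \<A> f" "Cod \<A> f"] by (auto simp: Hom_def)

text \<open>Composites are normalized by nesting to the right, which hides a known equation for
  \<open>g \<cdot> f\<close> inside \<open>g \<cdot> (f \<cdot> x)\<close>. Instantiated with that
  equation, this rule makes it usable for rewriting again.\<close>

lemma Comp_Comp_eq:
  assumes "g \<cdot> f = h" "f \<in> Arr \<A>" "g \<in> Arr \<A>" "x \<in> Arr \<A>" "Dom \<A> g = Cod \<A> f" "Dom \<A> f = Cod \<A> x"
  shows "g \<cdot> (f \<cdot> x) = h \<cdot> x"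
  using assms by auto

lemma lift:
  assumes "has_lifting \<A> i p" "u \<in> Hom \<A> A D" "v \<in> Hom \<A> B E" "v \<cdot> i = p \<cdot> u"
    "i \<in> Hom \<A> A B" "p \<in> Hom \<A> D E"
  obtains h where "h \<in> Hom \<A> B D" "h \<cdot> i = u" "p \<cdot> h = v"
proof -
  have "Dom \<A> i = A" "Cod \<A> i = B" "Dom \<A> p = D" "Cod \<A> p = E"
    using assms by (simp_all add: Hom_iff)
  then show ?thesis using assms(1-4) that unfolding has_lifting_def by blast
qed

lemma liftingI:
  assumes "i \<in> Hom \<A> A B" "p \<in> Hom \<A> D E"
    "\<And>u v. u \<in> Hom \<A> A D \<Longrightarrow> v \<in> Hom \<A> B E \<Longrightarrow> v \<cdot> i = p \<cdot> u \<Longrightarrow>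
      \<exists>h \<in> Hom \<A> B D. h \<cdot> i = u \<and> p \<cdot> h = v"
  shows "has_lifting \<A> i p"
proof -
  have "Dom \<A> i = A" "Cod \<A> i = B" "Dom \<A> p = D" "Cod \<A> p = E"
    using assms by (simp_all add: Hom_iff)
  then show ?thesis using assms(3) unfolding has_lifting_def by blast
qed

lemma lifting_Comp:
  assumes i: "i \<in> Hom \<A> A B" and j: "j \<in> Hom \<A> B C" and p: "p \<in> Arr \<A>"
    and li: "has_lifting \<A> i p" and lj: "has_lifting \<A> j p"
  shows "has_lifting \<A> (j \<cdot> i) p"
proof (rule liftingI[OF _ Arr_Hom[OF p]])
  note [simp] = i[unfolded Hom_iff] j[unfolded Hom_iff] p
  show "j \<cdot> i \<in> Hom \<A> A C" by (simp add: Hom_iff)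
  fix u v assume u: "u \<in> Hom \<A> A (Dom \<A> p)" and v: "v \<in> Hom \<A> C (Cod \<A> p)" and e: "v \<cdot> j \<cdot> i = p \<cdot> u"
  note [simp] = u[unfolded Hom_iff] v[unfolded Hom_iff]
  obtain h where h: "h \<in> Hom \<A> B (Dom \<A> p)" "h \<cdot> i = u" "p \<cdot> h = v \<cdot> j"
    by (rule lift[OF li u, of "v \<cdot> j"]) (use e in \<open>auto simp: Hom_iff\<close>)
  obtain k where k: "k \<in> Hom \<A> C (Dom \<A> p)" "k \<cdot> j = h" "p \<cdot> k = v"
    by (rule lift[OF lj h(1) v]) (use h in \<open>auto simp: Hom_iff\<close>)
  have "k \<cdot> j \<cdot> i = u" using Comp_assoc'[of i j k] k h by (simp add: Hom_iff)
  then show "\<exists>h \<in> Hom \<A> C (Dom \<A> p). h \<cdot> j \<cdot> i = u \<and> p \<cdot> h = v" using k by blast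
qed

lemma retract_ofE:
  assumes "is_retract_of \<A> f g" "f \<in> Hom \<A> A B" "g \<in> Hom \<A> A' B'"
  obtains s r s' r' where "s \<in> Hom \<A> A A'" "r \<in> Hom \<A> A' A" "s' \<in> Hom \<A> B B'" "r' \<in> Hom \<A> B' B"
    "r \<cdot> s = Ident \<A> A" "r' \<cdot> s' = Ident \<A> B" "g \<cdot> s = s' \<cdot> f" "f \<cdot> r = r' \<cdot> g"
proof -
  have "Dom \<A> f = A" "Cod \<A> f = B" "Dom \<A> g = A'" "Cod \<A> g = B'"
    using assms by (simp_all add: Hom_iff)
  then show ?thesis using assms(1) that unfolding is_retract_of_def by blast
qed

text \<open>Composing the square for f with r and r' gives a square for g; the filler of the latter
  composed with s' fills the former.\<close>

lemma retract_lifting: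
  assumes fg: "is_retract_of \<A> f g" and g: "has_lifting \<A> g p" and p: "p \<in> Arr \<A>"
  shows "has_lifting \<A> f p"
proof -
  have [simp]: "f \<in> Arr \<A>" "g \<in> Arr \<A>" "p \<in> Arr \<A>" using fg p by (auto simp: is_retract_of_def)
  obtain s r s' r' where
    h: "s \<in> Hom \<A> (Dom \<A> f) (Dom \<A> g)" "r \<in> Hom \<A> (Dom \<A> g) (Dom \<A> f)"
      "s' \<in> Hom \<A> (Cod \<A> f) (Cod \<A> g)" "r' \<in> Hom \<A> (Cod \<A> g) (Cod \<A> f)"
    and e: "r \<cdot> s = Ident \<A> (Dom \<A> f)" "r' \<cdot> s' = Ident \<A> (Cod \<A> f)" "g \<cdot> s = s' \<cdot> f" "f \<cdot> r = r' \<cdot> g"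
    by (rule retract_ofE[OF fg Arr_Hom Arr_Hom]) auto
  note [simp] = h[unfolded Hom_iff] e(1,2)
  show ?thesis
  proof (rule liftingI[OF Arr_Hom Arr_Hom])
    fix u v assume u: "u \<in> Hom \<A> (Dom \<A> f) (Dom \<A> p)" and v: "v \<in> Hom \<A> (Cod \<A> f) (Cod \<A> p)"
      and uv: "v \<cdot> f = p \<cdot> u"
    note [simp] = u[unfolded Hom_iff] v[unfolded Hom_iff]
    have "(v \<cdot> r') \<cdot> g = p \<cdot> (u \<cdot> r)"
      using Comp_Comp_eq[OF uv, of r] by (simp add: e(4)[symmetric])
    then obtain w where w: "w \<in> Hom \<A> (Cod \<A> g) (Dom \<A> p)" "w \<cdot> g = u \<cdot> r" "p \<cdot> w = v \<cdot> r'"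
      by (rule lift[OF g, rotated 2]) (auto simp: Hom_iff)
    note [simp] = w(1)[unfolded Hom_iff]
    have "(w \<cdot> s') \<cdot> f = u" using Comp_Comp_eq[OF w(2), of s] by (simp add: e(3)[symmetric])
    moreover have "p \<cdot> (w \<cdot> s') = v" using Comp_Comp_eq[OF w(3), of s'] by simp
    ultimately show "\<exists>h \<in> Hom \<A> (Cod \<A> f) (Dom \<A> p). h \<cdot> f = u \<and> p \<cdot> h = v"
      by (intro bexI[of _ "w \<cdot> s'"]) (auto simp: Hom_iff)
  qed simp_all
qed

lemma retract_ofI:
  assumes "f \<in> Hom \<A> A B" "g \<in> Hom \<A> A' B'"
    "s \<in> Hom \<A> A A'" "r \<in> Hom \<A> A' A" "s' \<in> Hom \<A> B B'" "r' \<in> Hom \<A> B' B"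
    "r \<cdot> s = Ident \<A> A" "r' \<cdot> s' = Ident \<A> B" "g \<cdot> s = s' \<cdot> f" "f \<cdot> r = r' \<cdot> g"
  shows "is_retract_of \<A> f g"
proof -
  have "Dom \<A> f = A" "Cod \<A> f = B" "Dom \<A> g = A'" "Cod \<A> g = B'" "f \<in> Arr \<A>" "g \<in> Arr \<A>"
    using assms by (simp_all add: Hom_iff)
  then show ?thesis unfolding is_retract_of_def using assms(3-) by blast
qed

lemma Ident_iso [simp]: "X \<in> Obj \<A> \<Longrightarrow> is_iso \<A> (Ident \<A> X)"
  unfolding is_iso_def by (auto simp: Hom_iff intro!: bexI[of _ "Ident \<A> X"])

lemma isoI:
  assumes "f \<in> Hom \<A> X Y" "g \<in> Hom \<A> Y X" "g \<cdot> f = Ident \<A> X" "f \<cdot> g = Ident \<A> Y"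
  shows "is_iso \<A> f"
proof -
  have "Dom \<A> f = X" "Cod \<A> f = Y" "f \<in> Arr \<A>"
    using assms by (simp_all add: Hom_iff)
  then show ?thesis unfolding is_iso_def using assms(2-) by blast
qed

lemma isoE:
  assumes "is_iso \<A> f" "f \<in> Hom \<A> X Y"
  obtains g where "g \<in> Hom \<A> Y X" "g \<cdot> f = Ident \<A> X" "f \<cdot> g = Ident \<A> Y"
proof -
  have "Dom \<A> f = X" "Cod \<A> f = Y"
    using assms by (simp_all add: Hom_iff)
  then show ?thesis using assms(1) that unfolding is_iso_def by blast
qed

end

text \<open>Hom groups are indexed by two objects; both are read off from f, so that subtraction
  needs no object arguments.\<close>

definition (in additive_category) neg :: "'m \<Rightarrow> 'm" where
  "neg f = inv\<^bsub>\<lparr>carrier = Hom \<A> (Dom \<A> f) (Cod \<A> f), mult = Add_Arr \<A>, one = Zero_Arr \<A> (Dom \<A> f) (Cod \<A> f)\<rparr>\<^esub> f"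

context additive_category
begin

lemma Zero_simps [simp]:
  assumes "X \<in> Obj \<A>" "Y \<in> Obj \<A>"
  shows "Zero_Arr \<A> X Y \<in> Arr \<A>" "Dom \<A> (Zero_Arr \<A> X Y) = X" "Cod \<A> (Zero_Arr \<A> X Y) = Y"
proof -
  interpret G: comm_group "\<lparr>carrier = Hom \<A> X Y, mult = Add_Arr \<A>, one = Zero_Arr \<A> X Y\<rparr>"
    by (rule Hom_group[OF assms])
  show "Zero_Arr \<A> X Y \<in> Arr \<A>" "Dom \<A> (Zero_Arr \<A> X Y) = X" "Cod \<A> (Zero_Arr \<A> X Y) = Y"
    using G.one_closed by (simp_all add: Hom_def)
qed

lemma
  assumes "f \<in> Arr \<A>" "g \<in> Arr \<A>" "Dom \<A> g = Dom \<A> f" "Cod \<A> g = Cod \<A> f"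
  shows Add_simps [simp]: "f \<oplus> g \<in> Arr \<A>" "Dom \<A> (f \<oplus> g) = Dom \<A> f" "Cod \<A> (f \<oplus> g) = Cod \<A> f"
    and Add_commute: "f \<oplus> g = g \<oplus> f"
proof -
  interpret G: comm_group "\<lparr>carrier = Hom \<A> (Dom \<A> f) (Cod \<A> f), mult = Add_Arr \<A>,
    one = Zero_Arr \<A> (Dom \<A> f) (Cod \<A> f)\<rparr>"
    by (rule Hom_group) (use assms in auto)
  show "f \<oplus> g \<in> Arr \<A>" "Dom \<A> (f \<oplus> g) = Dom \<A> f" "Cod \<A> (f \<oplus> g) = Cod \<A> f"  "f \<oplus> g = g \<oplus> f"
    using G.m_closed[of f g] G.m_comm[of f g] assms by (simp_all add: Hom_def)
qed

lemma Add_assoc [simp]: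
  assumes "f \<in> Arr \<A>" "g \<in> Arr \<A>" "Dom \<A> g = Dom \<A> f" "Cod \<A> g = Cod \<A> f"
    "h \<in> Arr \<A>" "Dom \<A> h = Dom \<A> f" "Cod \<A> h = Cod \<A> f"
  shows "(f \<oplus> g) \<oplus> h = f \<oplus> (g \<oplus> h)"
proof -
  interpret G: comm_group "\<lparr>carrier = Hom \<A> (Dom \<A> f) (Cod \<A> f), mult = Add_Arr \<A>,
    one = Zero_Arr \<A> (Dom \<A> f) (Cod \<A> f)\<rparr>"
    by (rule Hom_group) (use assms in auto)
  show ?thesis using G.m_assoc[of f g h] assms by (simp add: Hom_def)
qed

lemma Add_Zero [simp]:
  assumes "f \<in> Arr \<A>" "Dom \<A> f = X" "Cod \<A> f = Y"
  shows "f \<oplus> Zero_Arr \<A> X Y = f" "Zero_Arr \<A> X Y \<oplus> f = f"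
proof -
  interpret G: comm_group "\<lparr>carrier = Hom \<A> (Dom \<A> f) (Cod \<A> f), mult = Add_Arr \<A>,
    one = Zero_Arr \<A> (Dom \<A> f) (Cod \<A> f)\<rparr>"
    by (rule Hom_group) (use assms in auto)
  show "f \<oplus> Zero_Arr \<A> X Y = f" "Zero_Arr \<A> X Y \<oplus> f = f"
    using G.r_one[of f] G.l_one[of f] assms by (simp_all add: Hom_def)
qed

lemma neg_simps [simp]:
  assumes "f \<in> Arr \<A>"
  shows "neg f \<in> Arr \<A>" "Dom \<A> (neg f) = Dom \<A> f" "Cod \<A> (neg f) = Cod \<A> f"
    "f \<oplus> neg f = Zero_Arr \<A> (Dom \<A> f) (Cod \<A> f)" "neg f \<oplus> f = Zero_Arr \<A> (Dom \<A> f) (Cod \<A> f)"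
proof -
  interpret G: comm_group "\<lparr>carrier = Hom \<A> (Dom \<A> f) (Cod \<A> f), mult = Add_Arr \<A>,
    one = Zero_Arr \<A> (Dom \<A> f) (Cod \<A> f)\<rparr>"
    by (rule Hom_group) (use assms in auto)
  show "neg f \<in> Arr \<A>" "Dom \<A> (neg f) = Dom \<A> f" "Cod \<A> (neg f) = Cod \<A> f"
    "f \<oplus> neg f = Zero_Arr \<A> (Dom \<A> f) (Cod \<A> f)" "neg f \<oplus> f = Zero_Arr \<A> (Dom \<A> f) (Cod \<A> f)"
    using G.inv_closed[of f] G.r_inv[of f] G.l_inv[of f] assms unfolding neg_def
    by (simp_all add: Hom_def)
qed

lemma Add_neg_cancel [simp]:
  assumes "f \<in> Arr \<A>" "g \<in> Arr \<A>" "Dom \<A> g = Dom \<A> f" "Cod \<A> g = Cod \<A> f"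
  shows "f \<oplus> (neg f \<oplus> g) = g" "neg f \<oplus> (f \<oplus> g) = g"
  using Add_assoc[of f "neg f" g] Add_assoc[of "neg f" f g] assms by simp_all

lemma Add_diff_cancel [simp]:
  assumes "f \<in> Arr \<A>" "g \<in> Arr \<A>" "Dom \<A> g = Dom \<A> f" "Cod \<A> g = Cod \<A> f"
  shows "f \<oplus> (g \<oplus> neg f) = g"
proof -
  have "f \<oplus> (g \<oplus> neg f) = f \<oplus> (neg f \<oplus> g)" using assms by (subst Add_commute[of g]) auto
  then show ?thesis using assms by simp
qed

lemma Add_left_cancel:
  assumes "f \<in> Arr \<A>" "g \<in> Arr \<A>" "Dom \<A> g = Dom \<A> f" "Cod \<A> g = Cod \<A> f"
    "h \<in> Arr \<A>" "Dom \<A> h = Dom \<A> f" "Cod \<A> h = Cod \<A> f" "f \<oplus> g = f \<oplus> h"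
  shows "g = h"
proof -
  have "g = neg f \<oplus> (f \<oplus> g)" using assms(1-7) by simp
  also have "\<dots> = neg f \<oplus> (f \<oplus> h)" by (simp only: assms(8))
  also have "\<dots> = h" using assms(1-7) by simp
  finally show ?thesis .
qed

lemma Comp_Add' [simp]:
  assumes "f \<in> Arr \<A>" "g \<in> Arr \<A>" "h \<in> Arr \<A>" "Dom \<A> g = Cod \<A> f" "Dom \<A> h = Cod \<A> f" "Cod \<A> h = Cod \<A> g"
  shows "(g \<oplus> h) \<cdot> f = (g \<cdot> f) \<oplus> (h \<cdot> f)"
  using Comp_Add[of f "Dom \<A> f" "Cod \<A> f" g "Cod \<A> g" h] assms by (simp add: Hom_def)

lemma Add_Comp' [simp]:
  assumes "f \<in> Arr \<A>" "g \<in> Arr \<A>" "h \<in> Arr \<A>" "Dom \<A> f = Dom \<A> g" "Dom \<A> h = Cod \<A> f" "Cod \<A> f = Cod \<A> g"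
  shows "h \<cdot> (f \<oplus> g) = (h \<cdot> f) \<oplus> (h \<cdot> g)"
  using Add_Comp[of f "Dom \<A> f" "Cod \<A> f" g h "Cod \<A> h"] assms by (simp add: Hom_def)

text \<open>Composition is additive in each argument, so a composite with a zero morphism is its own
  double; this yields \<open>Comp_Zero\<close> and \<open>Zero_Comp\<close>.\<close>

lemma idem_Zero:
  assumes "f \<in> Arr \<A>" "f \<oplus> f = f"
  shows "f = Zero_Arr \<A> (Dom \<A> f) (Cod \<A> f)"
  using Add_left_cancel[of f f "Zero_Arr \<A> (Dom \<A> f) (Cod \<A> f)"] assms by simp

lemma Comp_Zero [simp]:
  assumes "f \<in> Arr \<A>" "Dom \<A> f = Y" "X \<in> Obj \<A>"
  shows "f \<cdot> Zero_Arr \<A> X Y = Zero_Arr \<A> X (Cod \<A> f)"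
proof -
  have Y [simp]: "Y \<in> Obj \<A>" using assms by auto
  have "f \<cdot> Zero_Arr \<A> X Y \<oplus> f \<cdot> Zero_Arr \<A> X Y = f \<cdot> (Zero_Arr \<A> X Y \<oplus> Zero_Arr \<A> X Y)"
    by (subst Add_Comp') (use assms in auto)
  also have "\<dots> = f \<cdot> Zero_Arr \<A> X Y" using assms by simp
  finally show ?thesis using idem_Zero[of "f \<cdot> Zero_Arr \<A> X Y"] assms by simp
qed

lemma Zero_Comp [simp]:
  assumes "f \<in> Arr \<A>" "Cod \<A> f = Y" "Z \<in> Obj \<A>"
  shows "Zero_Arr \<A> Y Z \<cdot> f = Zero_Arr \<A> (Dom \<A> f) Z"
proof -
  have Y [simp]: "Y \<in> Obj \<A>" using assms by auto
  have "Zero_Arr \<A> Y Z \<cdot> f \<oplus> Zero_Arr \<A> Y Z \<cdot> f = (Zero_Arr \<A> Y Z \<oplus> Zero_Arr \<A> Y Z) \<cdot> f"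
    by (subst Comp_Add') (use assms in auto)
  also have "\<dots> = Zero_Arr \<A> Y Z \<cdot> f" using assms by simp
  finally show ?thesis using idem_Zero[of "Zero_Arr \<A> Y Z \<cdot> f"] assms by simp
qed

lemma neg_unique:
  assumes "f \<in> Hom \<A> X Y" "g \<in> Hom \<A> X Y" "f \<oplus> g = Zero_Arr \<A> X Y"
  shows "g = neg f"
proof -
  note [simp] = assms(1,2)[unfolded Hom_iff]
  have "f \<oplus> g = f \<oplus> neg f" by (simp add: assms(3))
  then show ?thesis by (rule Add_left_cancel[rotated -1]) simp_all
qed

lemma neg_Comp [simp]:
  assumes "f \<in> Arr \<A>" "g \<in> Arr \<A>" "Dom \<A> g = Cod \<A> f"
  shows "neg g \<cdot> f = neg (g \<cdot> f)" "g \<cdot> neg f = neg (g \<cdot> f)"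
proof -
  have "g \<cdot> f \<oplus> neg g \<cdot> f = (g \<oplus> neg g) \<cdot> f" using assms by (subst Comp_Add') simp_all
  also have "\<dots> = Zero_Arr \<A> (Dom \<A> f) (Cod \<A> g)" using assms by simp
  finally show "neg g \<cdot> f = neg (g \<cdot> f)" by (rule neg_unique[rotated -1]) (use assms in \<open>simp_all add: Hom_iff\<close>)
  have "g \<cdot> f \<oplus> g \<cdot> neg f = g \<cdot> (f \<oplus> neg f)" using assms by (subst Add_Comp') simp_all
  also have "\<dots> = Zero_Arr \<A> (Dom \<A> f) (Cod \<A> g)" using assms by simp
  finally show "g \<cdot> neg f = neg (g \<cdot> f)" by (rule neg_unique[rotated -1]) (use assms in \<open>simp_all add: Hom_iff\<close>)
qed

lemma neg_neg [simp]: "f \<in> Arr \<A> \<Longrightarrow> neg (neg f) = f"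
  by (rule neg_unique[symmetric, of _ "Dom \<A> f" "Cod \<A> f"]) (simp_all add: Hom_iff)

lemma neg_diff:
  assumes "f \<in> Hom \<A> X Y" "g \<in> Hom \<A> X Y"
  shows "neg (f \<oplus> neg g) = g \<oplus> neg f"
  by (rule neg_unique[symmetric, of _ X Y]) (use assms in \<open>simp_all add: Hom_iff\<close>)

lemma neg_Zero [simp]: "X \<in> Obj \<A> \<Longrightarrow> Y \<in> Obj \<A> \<Longrightarrow> neg (Zero_Arr \<A> X Y) = Zero_Arr \<A> X Y"
  using neg_unique[of "Zero_Arr \<A> X Y" X Y "Zero_Arr \<A> X Y"] by (simp add: Hom_iff)

section \<open>Zero objects, biproducts and kernels\<close>

lemma zero_object_Obj: "is_zero_object \<A> Z \<Longrightarrow> Z \<in> Obj \<A>"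
  by (simp add: is_zero_object_def)

lemma to_zero_object:
  assumes "is_zero_object \<A> Z" "f \<in> Hom \<A> X Z"
  shows "f = Zero_Arr \<A> X Z"
proof -
  have "X \<in> Obj \<A>" "Z \<in> Obj \<A>" using assms by (auto simp: Hom_iff)
  moreover then have "Zero_Arr \<A> X Z \<in> Hom \<A> X Z" by (simp add: Hom_iff)
  moreover have "\<exists>!f. f \<in> Hom \<A> X Z" using assms(1) \<open>X \<in> Obj \<A>\<close> unfolding is_zero_object_def by blast
  ultimately show ?thesis using assms(2) by blast
qed

lemma from_zero_object:
  assumes "is_zero_object \<A> Z" "f \<in> Hom \<A> Z X"
  shows "f = Zero_Arr \<A> Z X"
proof -
  have "X \<in> Obj \<A>" "Z \<in> Obj \<A>" using assms by (auto simp: Hom_iff)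
  moreover then have "Zero_Arr \<A> Z X \<in> Hom \<A> Z X" by (simp add: Hom_iff)
  moreover have "\<exists>!f. f \<in> Hom \<A> Z X" using assms(1) \<open>X \<in> Obj \<A>\<close> unfolding is_zero_object_def by blast
  ultimately show ?thesis using assms(2) by blast
qed

lemma zero_object_Ident: "is_zero_object \<A> Z \<Longrightarrow> Ident \<A> Z = Zero_Arr \<A> Z Z"
  by (rule to_zero_object) (auto simp: Hom_iff dest: zero_object_Obj)

lemma biproductD:
  assumes "is_biproduct \<A> X Y P iX iY pX pY"
  shows "iX \<in> Hom \<A> X P" "iY \<in> Hom \<A> Y P" "pX \<in> Hom \<A> P X" "pY \<in> Hom \<A> P Y"
    "pX \<cdot> iX = Ident \<A> X" "pY \<cdot> iY = Ident \<A> Y" "pX \<cdot> iY = Zero_Arr \<A> Y X" "pY \<cdot> iX = Zero_Arr \<A> X Y"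
    "(iX \<cdot> pX) \<oplus> (iY \<cdot> pY) = Ident \<A> P"
  using assms unfolding is_biproduct_def by auto

lemma biproduct_decomp:
  assumes "is_biproduct \<A> X Y P iX iY pX pY" "g \<in> Hom \<A> T P"
  shows "g = iX \<cdot> (pX \<cdot> g) \<oplus> iY \<cdot> (pY \<cdot> g)"
proof -
  note b = biproductD[OF assms(1)]
  note [simp] = b(1-4)[unfolded Hom_iff] assms(2)[unfolded Hom_iff]
  have "g = ((iX \<cdot> pX) \<oplus> (iY \<cdot> pY)) \<cdot> g" unfolding b(9) by simp
  then show ?thesis by simp
qed

lemma biproduct_swap:
  "is_biproduct \<A> X Y P iX iY pX pY \<Longrightarrow> is_biproduct \<A> Y X P iY iX pY pX"
  unfolding is_biproduct_def by (simp add: Hom_iff Add_commute)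

lemma kernel_Arr:
  assumes "is_kernel \<A> k f"
  shows "k \<in> Arr \<A>" "f \<in> Arr \<A>" "Cod \<A> k = Dom \<A> f"
proof -
  note k = assms[unfolded is_kernel_def]
  show "k \<in> Arr \<A>" "f \<in> Arr \<A>" "Cod \<A> k = Dom \<A> f"
    by (fact k[THEN conjunct1] k[THEN conjunct2, THEN conjunct1]
      k[THEN conjunct2, THEN conjunct2, THEN conjunct1])+
qed

lemma kernel_ex1:
  assumes "is_kernel \<A> k f" "g \<in> Hom \<A> T (Dom \<A> f)" "f \<cdot> g = Zero_Arr \<A> T (Cod \<A> f)"
  shows "\<exists>!h. h \<in> Hom \<A> T (Dom \<A> k) \<and> k \<cdot> h = g"
proof -
  have "T \<in> Obj \<A>" using assms(2) by (simp add: Hom_iff)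
  moreover have "\<forall>T \<in> Obj \<A>. \<forall>g \<in> Hom \<A> T (Dom \<A> f). f \<cdot> g = Zero_Arr \<A> T (Cod \<A> f) \<longrightarrow>
        (\<exists>!h. h \<in> Hom \<A> T (Dom \<A> k) \<and> k \<cdot> h = g)"
    using assms(1) unfolding is_kernel_def by (elim conjE)
  ultimately show ?thesis using assms(2,3) by blast
qed

lemma kernelD:
  assumes "is_kernel \<A> k f" "f \<in> Hom \<A> X Y"
  shows "k \<in> Hom \<A> (Dom \<A> k) X" "f \<cdot> k = Zero_Arr \<A> (Dom \<A> k) Y"
  using assms unfolding is_kernel_def by (simp_all add: Hom_iff)

lemma kernel_factor:
  assumes "is_kernel \<A> k f" "k \<in> Hom \<A> K X" "f \<in> Hom \<A> X Y" "g \<in> Hom \<A> T X" "f \<cdot> g = Zero_Arr \<A> T Y"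
  obtains h where "h \<in> Hom \<A> T K" "k \<cdot> h = g"
proof -
  have "Dom \<A> k = K" "Dom \<A> f = X" "Cod \<A> f = Y" "T \<in> Obj \<A>"
    using assms by (simp_all add: Hom_iff)
  then show ?thesis using assms(1,4,5) that unfolding is_kernel_def by blast
qed

lemma kernel_mono:
  assumes "is_kernel \<A> k f" "k \<in> Hom \<A> K X" "u \<in> Hom \<A> T K" "v \<in> Hom \<A> T K" "k \<cdot> u = k \<cdot> v"
  shows "u = v"
proof -
  obtain Y where f: "f \<in> Hom \<A> X Y"
    using kernel_Arr[OF assms(1)] assms(2) by (simp add: Hom_iff)
  note [simp] = assms(2-4)[unfolded Hom_iff] f[unfolded Hom_iff]
  have "f \<cdot> (k \<cdot> u) = Zero_Arr \<A> K Y \<cdot> u"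
    by (rule Comp_Comp_eq) (use kernelD[OF assms(1) f] in simp_all)
  then have "f \<cdot> (k \<cdot> u) = Zero_Arr \<A> T Y" by simp
  moreover have "k \<cdot> u \<in> Hom \<A> T X" by (simp add: Hom_iff)
  ultimately have "\<exists>!h. h \<in> Hom \<A> T (Dom \<A> k) \<and> k \<cdot> h = k \<cdot> u"
    by (intro kernel_ex1[OF assms(1)]) simp_all
  moreover have "Dom \<A> k = K" by simp
  ultimately have ex: "\<exists>!h. h \<in> Hom \<A> T K \<and> k \<cdot> h = k \<cdot> u" by (simp only:)
  have "(THE h. h \<in> Hom \<A> T K \<and> k \<cdot> h = k \<cdot> u) = u"
    by (rule the1_equality[OF ex]) (intro conjI assms refl)
  moreover have "(THE h. h \<in> Hom \<A> T K \<and> k \<cdot> h = k \<cdot> u) = v"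
    by (rule the1_equality[OF ex]) (intro conjI assms assms(5)[symmetric])
  ultimately show ?thesis by (rule trans[OF sym])
qed

lemma kernelI:
  assumes "k \<in> Hom \<A> K X" "f \<in> Hom \<A> X Y" "f \<cdot> k = Zero_Arr \<A> K Y"
    "\<And>T u v. u \<in> Hom \<A> T K \<Longrightarrow> v \<in> Hom \<A> T K \<Longrightarrow> k \<cdot> u = k \<cdot> v \<Longrightarrow> u = v"
    "\<And>T g. g \<in> Hom \<A> T X \<Longrightarrow> f \<cdot> g = Zero_Arr \<A> T Y \<Longrightarrow> \<exists>h \<in> Hom \<A> T K. k \<cdot> h = g"
  shows "is_kernel \<A> k f"
proof -
  have "\<exists>!h. h \<in> Hom \<A> T K \<and> k \<cdot> h = g" if "g \<in> Hom \<A> T X" "f \<cdot> g = Zero_Arr \<A> T Y" for T g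
    using assms(5)[OF that] assms(4)[of _ T] by blast
  moreover have "Dom \<A> k = K" "Cod \<A> k = X" "Dom \<A> f = X" "Cod \<A> f = Y" "k \<in> Arr \<A>" "f \<in> Arr \<A>"
    using assms by (simp_all add: Hom_iff)
  ultimately show ?thesis using assms(3) unfolding is_kernel_def by simp
qed

end

section \<open>The opposite exact category\<close>

text \<open>Reversing arrows exchanges kernels with cokernels, pullbacks with pushouts and
  inflations with deflations. Facts on cokernels, pushouts and inflations are obtained by
  instantiating their duals at \<open>opp \<A>\<close> and simplifying.\<close>

definition opp :: "('o, 'm, 'z) exact_cat_data_scheme \<Rightarrow> ('o, 'm) exact_cat_data" where
  "opp \<A> = \<lparr>Obj = Obj \<A>, Arr = Arr \<A>, Dom = Cod \<A>, Cod = Dom \<A>, Ident = Ident \<A>,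
    Comp = (\<lambda>g f. Comp \<A> f g), Add_Arr = Add_Arr \<A>, Zero_Arr = (\<lambda>X Y. Zero_Arr \<A> Y X),
    Conf = {(d, i). (i, d) \<in> Conf \<A>}\<rparr>"

lemma opp_simps [simp]:
  "Obj (opp \<A>) = Obj \<A>" "Arr (opp \<A>) = Arr \<A>" "Dom (opp \<A>) = Cod \<A>" "Cod (opp \<A>) = Dom \<A>"
  "Ident (opp \<A>) = Ident \<A>" "Comp (opp \<A>) g f = Comp \<A> f g" "Add_Arr (opp \<A>) = Add_Arr \<A>"
  "Zero_Arr (opp \<A>) X Y = Zero_Arr \<A> Y X" "(d, i) \<in> Conf (opp \<A>) \<longleftrightarrow> (i, d) \<in> Conf \<A>"
  by (simp_all add: opp_def)

lemma Hom_opp [simp]: "Hom (opp \<A>) X Y = Hom \<A> Y X"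
  by (auto simp: Hom_def)

lemma is_kernel_opp [simp]: "is_kernel (opp \<A>) k f \<longleftrightarrow> is_cokernel \<A> k f"
  unfolding is_kernel_def is_cokernel_def by simp

lemma is_cokernel_opp [simp]: "is_cokernel (opp \<A>) k f \<longleftrightarrow> is_kernel \<A> k f"
  unfolding is_kernel_def is_cokernel_def by simp

lemma is_iso_opp [simp]: "is_iso (opp \<A>) f \<longleftrightarrow> is_iso \<A> f"
  unfolding is_iso_def by (simp add: conj_commute)

lemma is_pullback_opp [simp]: "is_pullback (opp \<A>) i f j f' \<longleftrightarrow> is_pushout \<A> i f j f'"
  unfolding is_pullback_def is_pushout_def by simp

lemma is_pushout_opp [simp]: "is_pushout (opp \<A>) d f e f' \<longleftrightarrow> is_pullback \<A> d f e f'"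
  unfolding is_pullback_def is_pushout_def by simp

lemma inflations_opp [simp]: "inflations (opp \<A>) = deflations \<A>"
  unfolding inflations_def deflations_def by simp

lemma deflations_opp [simp]: "deflations (opp \<A>) = inflations \<A>"
  unfolding inflations_def deflations_def by simp

lemma is_biproduct_opp [simp]:
  "is_biproduct (opp \<A>) X Y P iX iY pX pY \<longleftrightarrow> is_biproduct \<A> X Y P pX pY iX iY"
  unfolding is_biproduct_def by auto

lemma is_zero_object_opp [simp]: "is_zero_object (opp \<A>) Z \<longleftrightarrow> is_zero_object \<A> Z"
  unfolding is_zero_object_def by auto

context exact_category
begin

lemma Conf_is_kernel: "(i, d) \<in> Conf \<A> \<Longrightarrow> is_kernel \<A> i d"
  and Conf_is_cokernel: "(i, d) \<in> Conf \<A> \<Longrightarrow> is_cokernel \<A> d i"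
  by (auto dest!: Conf_kernel_cokernel simp: is_kernel_cokernel_pair_def)

lemma iso_square_inverse:
  assumes "i \<in> Hom \<A> K X" "i' \<in> Hom \<A> K' X'" "a \<in> Hom \<A> K' K" "b \<in> Hom \<A> X' X"
    "a' \<in> Hom \<A> K K'" "b' \<in> Hom \<A> X X'" "i \<cdot> a = b \<cdot> i'" "b' \<cdot> b = Ident \<A> X'" "a \<cdot> a' = Ident \<A> K"
  shows "b' \<cdot> i = i' \<cdot> a'"
proof -
  note [simp] = assms(1-6)[unfolded Hom_iff]
  have "b' \<cdot> i = b' \<cdot> (i \<cdot> (a \<cdot> a'))" by (simp add: assms(9))
  also have "\<dots> = b' \<cdot> ((i \<cdot> a) \<cdot> a')" by simp
  also have "\<dots> = (b' \<cdot> b) \<cdot> (i' \<cdot> a')" unfolding assms(7) by simp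
  also have "\<dots> = i' \<cdot> a'" unfolding assms(8) by simp
  finally show ?thesis .
qed

lemma category_opp: "category (opp \<A>)"
  by unfold_locales (simp_all add: Hom_iff)

lemma additive_opp: "additive_category (opp \<A>)"
proof (intro additive_category.intro category_opp additive_category_axioms.intro)
  fix X Y assume "X \<in> Obj (opp \<A>)" "Y \<in> Obj (opp \<A>)"
  then show "comm_group \<lparr>carrier = Hom (opp \<A>) X Y, mult = Add_Arr (opp \<A>), one = Zero_Arr (opp \<A>) X Y\<rparr>"
    using Hom_group[of Y X] by simp
next
  fix X Y assume "X \<in> Obj (opp \<A>)" "Y \<in> Obj (opp \<A>)"
  then show "\<exists>P iX iY pX pY. is_biproduct (opp \<A>) X Y P iX iY pX pY"
    using biproduct_exists[of X Y] by simp blast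
qed (simp_all add: Hom_iff zero_object_exists)

text \<open>The other axioms come in dual pairs or are self-dual. Closure under isomorphism does not
  dualize verbatim: read in \<open>\<A>\<close>, the given isomorphisms run from the new pair to the
  old one, so their inverses are needed, and \<open>iso_square_inverse\<close> turns the squares
  around.\<close>

lemma exact_opp: "exact_category (opp \<A>)"
proof (intro exact_category.intro additive_opp exact_category_axioms.intro)
  fix i d i' d' a b c
  assume a: "(i, d) \<in> Conf (opp \<A>)" "is_kernel_cokernel_pair (opp \<A>) i' d'"
       "is_iso (opp \<A>) a" "is_iso (opp \<A>) b" "is_iso (opp \<A>) c"
       "a \<in> Hom (opp \<A>) (Dom (opp \<A>) i) (Dom (opp \<A>) i')" "b \<in> Hom (opp \<A>) (Cod (opp \<A>) i) (Cod (opp \<A>) i')"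
       "c \<in> Hom (opp \<A>) (Cod (opp \<A>) d) (Cod (opp \<A>) d')"
       "b \<cdot>\<^bsub>opp \<A>\<^esub> i = i' \<cdot>\<^bsub>opp \<A>\<^esub> a" "c \<cdot>\<^bsub>opp \<A>\<^esub> d = d' \<cdot>\<^bsub>opp \<A>\<^esub> b"
  note b = a[simplified]
  have ker: "is_kernel \<A> d' i'" "is_cokernel \<A> i' d'"
    using a(2) by (simp_all add: is_kernel_cokernel_pair_def)
  note d = kernel_Arr[OF Conf_is_kernel[OF b(1)]] kernel_Arr[OF ker(1)]
  have d1: "d \<in> Hom \<A> (Dom \<A> d) (Dom \<A> i)" "i \<in> Hom \<A> (Dom \<A> i) (Cod \<A> i)"
    "d' \<in> Hom \<A> (Dom \<A> d') (Dom \<A> i')" "i' \<in> Hom \<A> (Dom \<A> i') (Cod \<A> i')"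
    using d by (simp_all add: Hom_def)
  have b7: "b \<in> Hom \<A> (Dom \<A> i') (Dom \<A> i)" using b(7) d by simp
  obtain a' where a': "a' \<in> Hom \<A> (Cod \<A> i) (Cod \<A> i')" "a' \<cdot> a = Ident \<A> (Cod \<A> i')" "a \<cdot> a' = Ident \<A> (Cod \<A> i)"
    by (rule isoE[OF b(3) b(6)])
  obtain b' where b': "b' \<in> Hom \<A> (Dom \<A> i) (Dom \<A> i')" "b' \<cdot> b = Ident \<A> (Dom \<A> i')" "b \<cdot> b' = Ident \<A> (Dom \<A> i)"
    by (rule isoE[OF b(4) b7])
  obtain c' where c': "c' \<in> Hom \<A> (Dom \<A> d) (Dom \<A> d')" "c' \<cdot> c = Ident \<A> (Dom \<A> d')" "c \<cdot> c' = Ident \<A> (Dom \<A> d)"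
    by (rule isoE[OF b(5) b(8)])
  have "(d', i') \<in> Conf \<A>"
  proof (rule Conf_iso_closed[OF b(1)])
    show "is_kernel_cokernel_pair \<A> d' i'" using ker by (simp add: is_kernel_cokernel_pair_def)
    show "is_iso \<A> c'" "is_iso \<A> b'" "is_iso \<A> a'"
      by (rule isoI[OF c'(1) b(8) c'(3,2)], rule isoI[OF b'(1) b7 b'(3,2)], rule isoI[OF a'(1) b(6) a'(3,2)])
    show "c' \<in> Hom \<A> (Dom \<A> d) (Dom \<A> d')" "a' \<in> Hom \<A> (Cod \<A> i) (Cod \<A> i')" "b' \<in> Hom \<A> (Cod \<A> d) (Cod \<A> d')"
      using c'(1) b'(1) a'(1) d by simp_all
    show "b' \<cdot> d = d' \<cdot> c'"
      by (rule iso_square_inverse[OF d1(1) d1(3) b(8) b7 c'(1) b'(1) b(10) b'(2) c'(3)])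
    show "a' \<cdot> i = i' \<cdot> b'"
      by (rule iso_square_inverse[OF d1(2) d1(4) b7 b(6) b'(1) a'(1) b(9) a'(2) b'(3)])
  qed
  then show "(i', d') \<in> Conf (opp \<A>)" by simp
next
  fix i d assume "(i, d) \<in> Conf (opp \<A>)"
  then show "is_kernel_cokernel_pair (opp \<A>) i d"
    using Conf_kernel_cokernel[of d i] by (simp add: is_kernel_cokernel_pair_def)
next
  fix i j assume "i \<in> inflations (opp \<A>)" "j \<in> inflations (opp \<A>)" "Dom (opp \<A>) j = Cod (opp \<A>) i"
  then show "j \<cdot>\<^bsub>opp \<A>\<^esub> i \<in> inflations (opp \<A>)" using deflation_Comp[of j i] by simp
next
  fix i j assume "i \<in> deflations (opp \<A>)" "j \<in> deflations (opp \<A>)" "Dom (opp \<A>) j = Cod (opp \<A>) i"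
  then show "j \<cdot>\<^bsub>opp \<A>\<^esub> i \<in> deflations (opp \<A>)" using inflation_Comp[of j i] by simp
next
  fix i f assume "i \<in> inflations (opp \<A>)" "f \<in> Arr (opp \<A>)" "Dom (opp \<A>) f = Dom (opp \<A>) i"
  then show "\<exists>j f'. is_pushout (opp \<A>) i f j f' \<and> j \<in> inflations (opp \<A>)"
    using deflation_pullback[of i f] by simp
next
  fix i f assume "i \<in> deflations (opp \<A>)" "f \<in> Arr (opp \<A>)" "Cod (opp \<A>) f = Cod (opp \<A>) i"
  then show "\<exists>j f'. is_pullback (opp \<A>) i f j f' \<and> j \<in> deflations (opp \<A>)"
    using inflation_pushout[of i f] by simp
qed (simp_all add: Ident_inflation Ident_deflation)

end

section \<open>Kernels, pullbacks and biproducts in exact categories\<close>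

text \<open>Attaches the three objects to a conflation, since the diagram chases need typed
  morphisms besides membership in \<open>Conf\<close>.\<close>

definition (in exact_category) confl :: "'m \<Rightarrow> 'm \<Rightarrow> 'o \<Rightarrow> 'o \<Rightarrow> 'o \<Rightarrow> bool" where
  "confl i d F E X \<longleftrightarrow> (i, d) \<in> Conf \<A> \<and> i \<in> Hom \<A> F E \<and> d \<in> Hom \<A> E X"

context exact_category
begin

section \<open>Cokernels and conflations\<close>

lemma cokernelI:
  assumes "c \<in> Hom \<A> X C" "f \<in> Hom \<A> Y X" "c \<cdot> f = Zero_Arr \<A> Y C"
    "\<And>T u v. u \<in> Hom \<A> C T \<Longrightarrow> v \<in> Hom \<A> C T \<Longrightarrow> u \<cdot> c = v \<cdot> c \<Longrightarrow> u = v"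
    "\<And>T g. g \<in> Hom \<A> X T \<Longrightarrow> g \<cdot> f = Zero_Arr \<A> Y T \<Longrightarrow> \<exists>h \<in> Hom \<A> C T. h \<cdot> c = g"
  shows "is_cokernel \<A> c f"
  using additive_category.kernelI[OF additive_opp, of c C X f Y, simplified] assms by blast

lemma cokernel_factor:
  assumes "is_cokernel \<A> c f" "c \<in> Hom \<A> X C" "f \<in> Hom \<A> Y X" "g \<in> Hom \<A> X T" "g \<cdot> f = Zero_Arr \<A> Y T"
  obtains h where "h \<in> Hom \<A> C T" "h \<cdot> c = g"
  using additive_category.kernel_factor[OF additive_opp, of c f C X Y g T, simplified, OF assms] by blast

lemma cokernel_epi:
  assumes "is_cokernel \<A> c f" "c \<in> Hom \<A> X C" "u \<in> Hom \<A> C T" "v \<in> Hom \<A> C T" "u \<cdot> c = v \<cdot> c"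
  shows "u = v"
  using additive_category.kernel_mono[OF additive_opp, of c f C X u T v, simplified, OF assms] .

lemma cokernel_Arr:
  assumes "is_cokernel \<A> c f"
  shows "c \<in> Arr \<A>" "f \<in> Arr \<A>" "Dom \<A> c = Cod \<A> f"
  using additive_category.kernel_Arr[OF additive_opp, of c f] assms by simp_all

lemma confl_opp [simp]: "exact_category.confl (opp \<A>) d i X E F \<longleftrightarrow> confl i d F E X"
  unfolding exact_category.confl_def[OF exact_opp] confl_def by auto

lemma confl_Hom:
  assumes "confl i d F E X"
  shows "i \<in> Hom \<A> F E" "d \<in> Hom \<A> E X" "(i, d) \<in> Conf \<A>" "is_kernel \<A> i d" "is_cokernel \<A> d i"
  using assms unfolding confl_def by (auto intro: Conf_is_kernel Conf_is_cokernel)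

lemma confl_Zero:
  assumes "confl i d F E X"
  shows "d \<cdot> i = Zero_Arr \<A> F X"
  using kernelD(2)[OF confl_Hom(4,2)[OF assms]] confl_Hom(1)[OF assms] by (simp add: Hom_iff)

lemma confl_inflation: "confl i d F E X \<Longrightarrow> i \<in> inflations \<A>"
  and confl_deflation: "confl i d F E X \<Longrightarrow> d \<in> deflations \<A>"
  unfolding confl_def inflations_def deflations_def by auto

lemma Conf_confl: "(i, d) \<in> Conf \<A> \<Longrightarrow> confl i d (Dom \<A> i) (Dom \<A> d) (Cod \<A> d)"
  using kernel_Arr[OF Conf_is_kernel] unfolding confl_def by (auto simp: Hom_def)

lemma inflation_Arr: "i \<in> inflations \<A> \<Longrightarrow> i \<in> Arr \<A>"
  unfolding inflations_def by (auto dest: Conf_is_kernel kernel_Arr)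

lemma deflation_Arr: "i \<in> deflations \<A> \<Longrightarrow> i \<in> Arr \<A>"
  unfolding deflations_def by (auto dest: Conf_is_kernel kernel_Arr)

lemma inflationE:
  assumes "i \<in> inflations \<A>" "i \<in> Hom \<A> F E"
  obtains d X where "confl i d F E X"
proof -
  obtain d where d: "(i, d) \<in> Conf \<A>" using assms unfolding inflations_def by blast
  have "confl i d F E (Cod \<A> d)"
    using Conf_confl[OF d] kernel_Arr[OF Conf_is_kernel[OF d]] assms(2) by (simp add: Hom_iff)
  then show ?thesis by (rule that)
qed

lemma deflationE:
  assumes "d \<in> deflations \<A>" "d \<in> Hom \<A> E X"
  obtains i F where "confl i d F E X"
proof -
  obtain i where d: "(i, d) \<in> Conf \<A>" using assms unfolding deflations_def by blast
  have "confl i d (Dom \<A> i) E X"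
    using Conf_confl[OF d] assms(2) by (simp add: Hom_iff)
  then show ?thesis by (rule that)
qed

lemma confl_factor:
  assumes "confl i d F E X" "g \<in> Hom \<A> T E" "d \<cdot> g = Zero_Arr \<A> T X"
  obtains h where "h \<in> Hom \<A> T F" "i \<cdot> h = g"
  by (rule kernel_factor[OF confl_Hom(4,1,2)[OF assms(1)] assms(2,3)])

lemma confl_cofactor:
  assumes "confl i d F E X" "g \<in> Hom \<A> E T" "g \<cdot> i = Zero_Arr \<A> F T"
  obtains h where "h \<in> Hom \<A> X T" "h \<cdot> d = g"
  by (rule cokernel_factor[OF confl_Hom(5,2,1)[OF assms(1)] assms(2,3)])

lemma confl_mono:
  assumes "confl i d F E X" "u \<in> Hom \<A> T F" "v \<in> Hom \<A> T F" "i \<cdot> u = i \<cdot> v"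
  shows "u = v"
  by (rule kernel_mono[OF confl_Hom(4,1)[OF assms(1)] assms(2-4)])

lemma confl_epi:
  assumes "confl i d F E X" "u \<in> Hom \<A> X T" "v \<in> Hom \<A> X T" "u \<cdot> d = v \<cdot> d"
  shows "u = v"
  by (rule cokernel_epi[OF confl_Hom(5,2)[OF assms(1)] assms(2-4)])

text \<open>Two kernels of d differ by an isomorphism, here a with inverse b, and conflations are
  closed under isomorphism. Hence any convenient kernel of a deflation may complete it to a
  conflation.\<close>

lemma kernel_confl:
  assumes c: "confl i d F E X" and k: "is_kernel \<A> k d" "k \<in> Hom \<A> K E"
  shows "confl k d K E X"
proof -
  note h = confl_Hom[OF c]
  note [simp] = h(1,2)[unfolded Hom_iff] k(2)[unfolded Hom_iff]
  have dk: "d \<cdot> k = Zero_Arr \<A> K X" using kernelD(2)[OF k(1) h(2)] by simp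
  obtain a where a: "a \<in> Hom \<A> F K" "k \<cdot> a = i" by (rule kernel_factor[OF k h(2) h(1) confl_Zero[OF c]])
  obtain b where b: "b \<in> Hom \<A> K F" "i \<cdot> b = k" by (rule confl_factor[OF c k(2) dk])
  note [simp] = a(1)[unfolded Hom_iff] b(1)[unfolded Hom_iff]
  have ba: "b \<cdot> a = Ident \<A> F"
    by (rule confl_mono[OF c, of _ F]) (simp_all add: Hom_iff Comp_Comp_eq[OF b(2)] a(2))
  have ab: "a \<cdot> b = Ident \<A> K"
    by (rule kernel_mono[OF k, of _ K]) (simp_all add: Hom_iff Comp_Comp_eq[OF a(2)] b(2))
  have "is_cokernel \<A> d k"
  proof (rule cokernelI[OF h(2) k(2) dk])
    fix T u v assume "u \<in> Hom \<A> X T" "v \<in> Hom \<A> X T" "u \<cdot> d = v \<cdot> d"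
    then show "u = v" by (rule confl_epi[OF c])
  next
    fix T g assume g: "g \<in> Hom \<A> E T" "g \<cdot> k = Zero_Arr \<A> K T"
    note [simp] = g(1)[unfolded Hom_iff]
    have "g \<cdot> i = Zero_Arr \<A> F T" using Comp_Comp_eq[OF g(2), of a] by (simp add: a(2))
    from confl_cofactor[OF c g(1) this] show "\<exists>h \<in> Hom \<A> X T. h \<cdot> d = g" by blast
  qed
  then have kc: "is_kernel_cokernel_pair \<A> k d" using k by (simp add: is_kernel_cokernel_pair_def)
  have "(k, d) \<in> Conf \<A>"
    by (rule Conf_iso_closed[OF h(3) kc, of a "Ident \<A> E" "Ident \<A> X"])
      (use a(1,2) isoI[OF a(1) b(1) ba ab] in \<open>simp_all add: Hom_iff\<close>)
  then show ?thesis using k(2) h(2) by (simp add: confl_def)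
qed

lemma cokernel_confl:
  assumes "confl i d F E X" "is_cokernel \<A> c i" "c \<in> Hom \<A> E C"
  shows "confl i c F E C"
  using exact_category.kernel_confl[OF exact_opp, of d i X E F c C] assms by simp

text \<open>Stated for kernels alone, so that its instance in \<open>opp \<A>\<close> is the
  cokernel half of \<open>confl_iso_middle\<close>.\<close>

lemma kernel_iso_middle:
  assumes k: "is_kernel \<A> i d" "i \<in> Hom \<A> F E" "d \<in> Hom \<A> E X"
    and t: "t \<in> Hom \<A> E E'" "t' \<in> Hom \<A> E' E" "t' \<cdot> t = Ident \<A> E" "t \<cdot> t' = Ident \<A> E'"
  shows "is_kernel \<A> (t \<cdot> i) (d \<cdot> t')"
proof -
  note [simp] = k(2,3)[unfolded Hom_iff] t(1,2)[unfolded Hom_iff]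
  have di: "d \<cdot> i = Zero_Arr \<A> F X" using kernelD(2)[OF k(1,3)] by simp
  show ?thesis
  proof (rule kernelI[of _ F E' _ X])
    show "(d \<cdot> t') \<cdot> (t \<cdot> i) = Zero_Arr \<A> F X" by (simp add: Comp_Comp_eq[OF t(3)] di)
  next
    fix T u v assume uv: "u \<in> Hom \<A> T F" "v \<in> Hom \<A> T F" "(t \<cdot> i) \<cdot> u = (t \<cdot> i) \<cdot> v"
    note [simp] = uv(1,2)[unfolded Hom_iff]
    have "t' \<cdot> ((t \<cdot> i) \<cdot> u) = t' \<cdot> ((t \<cdot> i) \<cdot> v)" using uv(3) by (rule arg_cong)
    then have "i \<cdot> u = i \<cdot> v" by (simp add: Comp_Comp_eq[OF t(3)])
    then show "u = v" by (rule kernel_mono[OF k(1,2) uv(1,2)])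
  next
    fix T g assume g: "g \<in> Hom \<A> T E'" "(d \<cdot> t') \<cdot> g = Zero_Arr \<A> T X"
    note [simp] = g(1)[unfolded Hom_iff]
    obtain h where h: "h \<in> Hom \<A> T F" "i \<cdot> h = t' \<cdot> g"
      by (rule kernel_factor[OF k, of "t' \<cdot> g", rotated -1], rule that, assumption+) (use g(2) in \<open>simp_all add: Hom_iff\<close>)
    note [simp] = h(1)[unfolded Hom_iff]
    have "(t \<cdot> i) \<cdot> h = g" by (simp add: h(2) Comp_Comp_eq[OF t(4)])
    then show "\<exists>h \<in> Hom \<A> T F. (t \<cdot> i) \<cdot> h = g" using h(1) by blast
  qed (simp_all add: Hom_iff)
qed

lemma confl_iso_middle:
  assumes c: "confl i d F E X"
    and t: "t \<in> Hom \<A> E E'" "t' \<in> Hom \<A> E' E" "t' \<cdot> t = Ident \<A> E" "t \<cdot> t' = Ident \<A> E'"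
  shows "confl (t \<cdot> i) (d \<cdot> t') F E' X"
proof -
  note h = confl_Hom[OF c]
  note [simp] = h(1,2)[unfolded Hom_iff] t(1,2)[unfolded Hom_iff]
  have "is_kernel \<A> (t \<cdot> i) (d \<cdot> t')" by (rule kernel_iso_middle[OF h(4,1,2) t])
  moreover have "is_cokernel \<A> (d \<cdot> t') (t \<cdot> i)"
    using exact_category.kernel_iso_middle[OF exact_opp, of d i X E F t' E' t] h t by simp
  ultimately have kc: "is_kernel_cokernel_pair \<A> (t \<cdot> i) (d \<cdot> t')" by (simp add: is_kernel_cokernel_pair_def)
  have "(t \<cdot> i, d \<cdot> t') \<in> Conf \<A>"
    by (rule Conf_iso_closed[OF h(3) kc, of "Ident \<A> F" t "Ident \<A> X"])
      (use isoI[OF t] in \<open>simp_all add: Hom_iff t\<close>)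
  then show ?thesis by (simp add: confl_def Hom_iff)
qed

section \<open>Pullbacks, pushouts and split conflations\<close>

lemma pullbackE:
  assumes "is_pullback \<A> d f e f'" "d \<in> Hom \<A> Y Z" "f \<in> Hom \<A> T Z"
  obtains P where "e \<in> Hom \<A> P T" "f' \<in> Hom \<A> P Y" "d \<cdot> f' = f \<cdot> e"
proof
  have "e \<in> Arr \<A> \<and> f' \<in> Arr \<A> \<and> Cod \<A> f' = Dom \<A> d \<and> Cod \<A> e = Dom \<A> f \<and> Dom \<A> f' = Dom \<A> e \<and> d \<cdot> f' = f \<cdot> e"
    using assms(1) unfolding is_pullback_def by blast
  then show "e \<in> Hom \<A> (Dom \<A> e) T" "f' \<in> Hom \<A> (Dom \<A> e) Y" "d \<cdot> f' = f \<cdot> e"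
    using assms(2,3) by (simp_all add: Hom_def)
qed

lemma pullback_ex1:
  assumes "is_pullback \<A> d f e f'" "d \<in> Hom \<A> Y Z" "f \<in> Hom \<A> T Z" "e \<in> Hom \<A> P T"
    and u: "u \<in> Hom \<A> S Y" and v: "v \<in> Hom \<A> S T" and uv: "d \<cdot> u = f \<cdot> v"
  shows "\<exists>!h. h \<in> Hom \<A> S P \<and> f' \<cdot> h = u \<and> e \<cdot> h = v"
proof -
  have eq: "Dom \<A> d = Y" "Dom \<A> f = T" "Dom \<A> e = P" and S: "S \<in> Obj \<A>" using assms by (simp_all add: Hom_iff)
  have "\<forall>T \<in> Obj \<A>. \<forall>u \<in> Hom \<A> T (Dom \<A> d). \<forall>v \<in> Hom \<A> T (Dom \<A> f).
        d \<cdot> u = f \<cdot> v \<longrightarrow> (\<exists>!h. h \<in> Hom \<A> T (Dom \<A> e) \<and> f' \<cdot> h = u \<and> e \<cdot> h = v)"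
    using assms(1) unfolding is_pullback_def by blast
  note this[unfolded eq, THEN bspec, OF S, THEN bspec, OF u, THEN bspec, OF v, THEN mp, OF uv]
  then show ?thesis .
qed

lemma pullback_factor:
  assumes "is_pullback \<A> d f e f'" "d \<in> Hom \<A> Y Z" "f \<in> Hom \<A> T Z" "e \<in> Hom \<A> P T"
    and u: "u \<in> Hom \<A> S Y" and v: "v \<in> Hom \<A> S T" and uv: "d \<cdot> u = f \<cdot> v"
  obtains h where "h \<in> Hom \<A> S P" "f' \<cdot> h = u" "e \<cdot> h = v"
  using ex1_implies_ex[OF pullback_ex1[OF assms]] by blast

lemma pullback_unique:
  assumes pb: "is_pullback \<A> d f e f'" "d \<in> Hom \<A> Y Z" "f \<in> Hom \<A> T Z" "e \<in> Hom \<A> P T"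
    and u: "u \<in> Hom \<A> S P" and v: "v \<in> Hom \<A> S P" and uv: "f' \<cdot> u = f' \<cdot> v" "e \<cdot> u = e \<cdot> v"
  shows "u = v"
proof -
  obtain P' where "e \<in> Hom \<A> P' T" and f': "f' \<in> Hom \<A> P' Y" and e: "d \<cdot> f' = f \<cdot> e" by (rule pullbackE[OF pb(1-3)])
  then have [simp]: "P' = P" using pb(4) by (simp add: Hom_iff)
  note [simp] = pb(2-4)[unfolded Hom_iff] u[unfolded Hom_iff] v[unfolded Hom_iff] f'[unfolded Hom_iff]
  have "d \<cdot> (f' \<cdot> v) = f \<cdot> (e \<cdot> v)" by (simp add: Comp_Comp_eq[OF e])
  then have ex: "\<exists>!h. h \<in> Hom \<A> S P \<and> f' \<cdot> h = f' \<cdot> v \<and> e \<cdot> h = e \<cdot> v"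
    by (intro pullback_ex1[OF pb]) (simp_all add: Hom_iff)
  have "(THE h. h \<in> Hom \<A> S P \<and> f' \<cdot> h = f' \<cdot> v \<and> e \<cdot> h = e \<cdot> v) = u"
    by (rule the1_equality[OF ex]) (intro conjI u uv)
  moreover have "(THE h. h \<in> Hom \<A> S P \<and> f' \<cdot> h = f' \<cdot> v \<and> e \<cdot> h = e \<cdot> v) = v"
    by (rule the1_equality[OF ex]) (intro conjI v refl)
  ultimately show ?thesis by (rule trans[OF sym])
qed

lemma pushoutE:
  assumes "is_pushout \<A> i f j f'" "i \<in> Hom \<A> X Y" "f \<in> Hom \<A> X T"
  obtains P where "j \<in> Hom \<A> T P" "f' \<in> Hom \<A> Y P" "f' \<cdot> i = j \<cdot> f"
  by (rule exact_category.pullbackE[OF exact_opp, of i f j f' Y X T, simplified, OF assms]) (rule that)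

lemma pushout_factor:
  assumes "is_pushout \<A> i f j f'" "i \<in> Hom \<A> X Y" "f \<in> Hom \<A> X T" "j \<in> Hom \<A> T P"
    "u \<in> Hom \<A> Y S" "v \<in> Hom \<A> T S" "u \<cdot> i = v \<cdot> f"
  obtains h where "h \<in> Hom \<A> P S" "h \<cdot> f' = u" "h \<cdot> j = v"
  by (rule exact_category.pullback_factor[OF exact_opp, of i f j f' Y X T P u S v, simplified, OF assms]) (rule that)

lemma pushout_unique:
  assumes "is_pushout \<A> i f j f'" "i \<in> Hom \<A> X Y" "f \<in> Hom \<A> X T" "j \<in> Hom \<A> T P"
    "u \<in> Hom \<A> P S" "v \<in> Hom \<A> P S" "u \<cdot> f' = v \<cdot> f'" "u \<cdot> j = v \<cdot> j"
  shows "u = v"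
  by (rule exact_category.pullback_unique[OF exact_opp, of i f j f' Y X T P u S v, simplified, OF assms])

lemma pushoutI:
  assumes "i \<in> Hom \<A> X Y" "f \<in> Hom \<A> X T" "j \<in> Hom \<A> T P" "f' \<in> Hom \<A> Y P" "f' \<cdot> i = j \<cdot> f"
    "\<And>S u v. u \<in> Hom \<A> P S \<Longrightarrow> v \<in> Hom \<A> P S \<Longrightarrow> u \<cdot> f' = v \<cdot> f' \<Longrightarrow> u \<cdot> j = v \<cdot> j \<Longrightarrow> u = v"
    "\<And>S u v. u \<in> Hom \<A> Y S \<Longrightarrow> v \<in> Hom \<A> T S \<Longrightarrow> u \<cdot> i = v \<cdot> f \<Longrightarrow>
      \<exists>h \<in> Hom \<A> P S. h \<cdot> f' = u \<and> h \<cdot> j = v"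
  shows "is_pushout \<A> i f j f'"
proof -
  have eq: "Dom \<A> i = X" "Cod \<A> i = Y" "Dom \<A> f = X" "Cod \<A> f = T" "Dom \<A> j = T" "Cod \<A> j = P"
    "Dom \<A> f' = Y" "Cod \<A> f' = P" "i \<in> Arr \<A>" "f \<in> Arr \<A>" "j \<in> Arr \<A>" "f' \<in> Arr \<A>"
    using assms(1-4) by (simp_all add: Hom_def)
  have "\<exists>!h. h \<in> Hom \<A> P S \<and> h \<cdot> f' = u \<and> h \<cdot> j = v"
    if uv: "u \<in> Hom \<A> Y S" "v \<in> Hom \<A> T S" "u \<cdot> i = v \<cdot> f" for S u v
  proof (rule ex_ex1I)
    show "\<exists>h. h \<in> Hom \<A> P S \<and> h \<cdot> f' = u \<and> h \<cdot> j = v" using assms(7)[OF uv] by blast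
    fix h k assume hk: "h \<in> Hom \<A> P S \<and> h \<cdot> f' = u \<and> h \<cdot> j = v" "k \<in> Hom \<A> P S \<and> k \<cdot> f' = u \<and> k \<cdot> j = v"
    show "h = k" by (rule assms(6)[OF conjunct1[OF hk(1)] conjunct1[OF hk(2)]]) (use hk in simp_all)
  qed
  then show ?thesis unfolding is_pushout_def eq using assms(5) eq by blast
qed

text \<open>The kernel of the pullback of d is the pair (k, 0): a morphism killed by e is determined
  by its component in Y, and that component factors through k.\<close>

lemma pullback_kernel:
  assumes c: "confl k d K Y Z" and f: "f \<in> Hom \<A> T Z" and pb: "is_pullback \<A> d f e f'" and e: "e \<in> Hom \<A> P T"
  obtains k' where "k' \<in> Hom \<A> K P" "f' \<cdot> k' = k" "is_kernel \<A> k' e"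
proof -
  note h = confl_Hom[OF c]
  obtain P' where "e \<in> Hom \<A> P' T" and f': "f' \<in> Hom \<A> P' Y" and de: "d \<cdot> f' = f \<cdot> e" by (rule pullbackE[OF pb h(2) f])
  then have [simp]: "P' = P" using e by (simp add: Hom_iff)
  note [simp] = h(1,2)[unfolded Hom_iff] f[unfolded Hom_iff] e[unfolded Hom_iff] f'[unfolded Hom_iff]
  have zero: "Zero_Arr \<A> K T \<in> Hom \<A> K T" by (simp add: Hom_iff)
  obtain k' where k': "k' \<in> Hom \<A> K P" "f' \<cdot> k' = k" "e \<cdot> k' = Zero_Arr \<A> K T"
    by (rule pullback_factor[OF pb h(2) f e h(1) zero]) (simp add: confl_Zero[OF c])
  note [simp] = k'(1)[unfolded Hom_iff]
  have "is_kernel \<A> k' e"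
  proof (rule kernelI[OF k'(1) e k'(3)])
    fix S u v assume uv: "u \<in> Hom \<A> S K" "v \<in> Hom \<A> S K" "k' \<cdot> u = k' \<cdot> v"
    note [simp] = uv(1,2)[unfolded Hom_iff]
    have "f' \<cdot> (k' \<cdot> u) = f' \<cdot> (k' \<cdot> v)" using uv(3) by (rule arg_cong)
    then have "k \<cdot> u = k \<cdot> v" by (simp add: Comp_Comp_eq[OF k'(2)])
    then show "u = v" by (rule confl_mono[OF c uv(1,2)])
  next
    fix S g assume g: "g \<in> Hom \<A> S P" "e \<cdot> g = Zero_Arr \<A> S T"
    note [simp] = g(1)[unfolded Hom_iff]
    obtain l where l: "l \<in> Hom \<A> S K" "k \<cdot> l = f' \<cdot> g"
      by (rule confl_factor[OF c, of "f' \<cdot> g", rotated -1], rule that, assumption+) (simp_all add: Hom_iff Comp_Comp_eq[OF de] g(2))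
    note [simp] = l(1)[unfolded Hom_iff]
    have "k' \<cdot> l = g"
      by (rule pullback_unique[OF pb h(2) f e, of _ S])
        (simp_all add: Hom_iff Comp_Comp_eq[OF k'(2)] Comp_Comp_eq[OF k'(3)] l(2) g(2))
    then show "\<exists>h \<in> Hom \<A> S K. k' \<cdot> h = g" using l(1) by blast
  qed
  then show ?thesis using k' that by blast
qed

lemma deflation_pullbackE:
  assumes c: "confl k d K Y Z" and f: "f \<in> Hom \<A> T Z"
  obtains k' e f' P where "confl k' e K P T" "f' \<in> Hom \<A> P Y" "f' \<cdot> k' = k" "d \<cdot> f' = f \<cdot> e"
    "is_pullback \<A> d f e f'"
proof -
  note h = confl_Hom[OF c]
  obtain e f' where pb: "is_pullback \<A> d f e f'" and e: "e \<in> deflations \<A>"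
    using deflation_pullback[OF confl_deflation[OF c], of f] f h(2) by (auto simp: Hom_iff)
  obtain P where P: "e \<in> Hom \<A> P T" "f' \<in> Hom \<A> P Y" "d \<cdot> f' = f \<cdot> e" by (rule pullbackE[OF pb h(2) f])
  obtain k' where k': "k' \<in> Hom \<A> K P" "f' \<cdot> k' = k" "is_kernel \<A> k' e" by (rule pullback_kernel[OF c f pb P(1)])
  obtain k1 K1 where "confl k1 e K1 P T" by (rule deflationE[OF e P(1)])
  then have "confl k' e K P T" by (rule kernel_confl[OF _ k'(3,1)])
  then show ?thesis using that P k' pb by blast
qed

lemma inflation_pushoutE:
  assumes "confl i d X Y C" "f \<in> Hom \<A> X T"
  obtains j d' f' P where "confl j d' T P C" "f' \<in> Hom \<A> Y P" "d' \<cdot> f' = d" "f' \<cdot> i = j \<cdot> f"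
    "is_pushout \<A> i f j f'"
  by (rule exact_category.deflation_pullbackE[OF exact_opp, of d i C Y X f T, simplified, OF assms]) (rule that)

text \<open>The axiom provides one pushout that is an inflation. Any other pushout of the same data
  is isomorphic to it, and the isomorphism transports the conflation.\<close>

lemma pushout_inflation:
  assumes c: "confl i d X Y C" and f: "f \<in> Hom \<A> X T" and po: "is_pushout \<A> i f j f'" and j: "j \<in> Hom \<A> T P"
  obtains d' where "confl j d' T P C" "d' \<cdot> f' = d"
proof -
  note h = confl_Hom[OF c]
  obtain P' where "j \<in> Hom \<A> T P'" and f': "f' \<in> Hom \<A> Y P'" and ij: "f' \<cdot> i = j \<cdot> f" by (rule pushoutE[OF po h(1) f])
  then have [simp]: "P' = P" using j by (simp add: Hom_iff)
  obtain j1 d1 f1 P1 where j1: "confl j1 d1 T P1 C" "f1 \<in> Hom \<A> Y P1" "d1 \<cdot> f1 = d" "f1 \<cdot> i = j1 \<cdot> f"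
    and po1: "is_pushout \<A> i f j1 f1"
    by (rule inflation_pushoutE[OF c f])
  note h1 = confl_Hom[OF j1(1)]
  note [simp] = h(1,2)[unfolded Hom_iff] f[unfolded Hom_iff] j[unfolded Hom_iff] f'[unfolded Hom_iff]
    h1(1,2)[unfolded Hom_iff] j1(2)[unfolded Hom_iff]
  obtain t where t: "t \<in> Hom \<A> P1 P" "t \<cdot> f1 = f'" "t \<cdot> j1 = j"
    by (rule pushout_factor[OF po1 h(1) f h1(1) f'[simplified] j]) (use ij in simp)
  obtain t' where t': "t' \<in> Hom \<A> P P1" "t' \<cdot> f' = f1" "t' \<cdot> j = j1"
    by (rule pushout_factor[OF po h(1) f j j1(2) h1(1)]) (use j1 in simp)
  note [simp] = t(1)[unfolded Hom_iff] t'(1)[unfolded Hom_iff]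
  have "t' \<cdot> t = Ident \<A> P1"
    by (rule pushout_unique[OF po1 h(1) f h1(1), of _ P1]) (simp_all add: Hom_iff t t')
  moreover have "t \<cdot> t' = Ident \<A> P"
    by (rule pushout_unique[OF po h(1) f j, of _ P]) (simp_all add: Hom_iff t t')
  ultimately have "confl (t \<cdot> j1) (d1 \<cdot> t') T P C"
    by (rule confl_iso_middle[OF j1(1) t(1) t'(1)])
  moreover have "(d1 \<cdot> t') \<cdot> f' = d" by (simp add: t'(2) j1(3))
  ultimately show ?thesis using that t(3) by simp
qed

lemma biproduct_kernel:
  assumes "is_biproduct \<A> X Y P iX iY pX pY"
  shows "is_kernel \<A> iY pX"
proof -
  note b = biproductD[OF assms]
  note [simp] = b(1-4)[unfolded Hom_iff]
  show ?thesis
  proof (rule kernelI[OF b(2,3,7)])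
    fix T u v assume uv: "u \<in> Hom \<A> T Y" "v \<in> Hom \<A> T Y" "iY \<cdot> u = iY \<cdot> v"
    note [simp] = uv(1,2)[unfolded Hom_iff]
    have "pY \<cdot> (iY \<cdot> u) = pY \<cdot> (iY \<cdot> v)" using uv(3) by (rule arg_cong)
    then show "u = v" by (simp add: Comp_Comp_eq[OF b(6)])
  next
    fix T g assume g: "g \<in> Hom \<A> T P" "pX \<cdot> g = Zero_Arr \<A> T X"
    note [simp] = g(1)[unfolded Hom_iff]
    have "iY \<cdot> (pY \<cdot> g) = g" by (subst (2) biproduct_decomp[OF assms g(1)]) (simp add: g(2))
    then show "\<exists>h \<in> Hom \<A> T Y. iY \<cdot> h = g" by (intro bexI[of _ "pY \<cdot> g"]) (simp_all add: Hom_iff)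
  qed
qed

lemma section_biproduct:
  assumes c: "confl i d F E X" and s: "s \<in> Hom \<A> X E" "d \<cdot> s = Ident \<A> X"
  obtains r where "is_biproduct \<A> F X E i s r d"
proof -
  note h = confl_Hom[OF c]
  note [simp] = h(1,2)[unfolded Hom_iff] s(1)[unfolded Hom_iff]
  \<comment> \<open>The morphism 1 - s d is killed by d, hence factors through the kernel i; the
    factor is the retraction.\<close>
  obtain r where r: "r \<in> Hom \<A> E F" "i \<cdot> r = Ident \<A> E \<oplus> neg (s \<cdot> d)"
    by (rule confl_factor[OF c, of "Ident \<A> E \<oplus> neg (s \<cdot> d)", rotated -1], rule that, assumption+) (simp_all add: Hom_iff Comp_Comp_eq[OF s(2)])
  note [simp] = r(1)[unfolded Hom_iff]
  have "r \<cdot> i = Ident \<A> F"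
    by (rule confl_mono[OF c, of _ F]) (simp_all add: Hom_iff Comp_Comp_eq[OF r(2)] confl_Zero[OF c])
  moreover have "r \<cdot> s = Zero_Arr \<A> X F"
    by (rule confl_mono[OF c, of _ X]) (simp_all add: Hom_iff Comp_Comp_eq[OF r(2)] s(2))
  moreover have "(i \<cdot> r) \<oplus> (s \<cdot> d) = Ident \<A> E" unfolding r(2) by simp
  ultimately have "is_biproduct \<A> F X E i s r d"
    unfolding is_biproduct_def using h(1,2) s r(1) confl_Zero[OF c] by simp
  then show ?thesis by (rule that)
qed

lemma retraction_biproduct:
  assumes "confl i d F E X" "r \<in> Hom \<A> E F" "r \<cdot> i = Ident \<A> F"
  obtains s where "is_biproduct \<A> F X E i s r d"
  by (rule exact_category.section_biproduct[OF exact_opp, of d i X E F r, simplified, OF assms])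
    (rule that, rule biproduct_swap)

end

section \<open>Split extensions and weak idempotent completeness\<close>

text \<open>Vanishing of Ext^1(X, F) without equivalence classes, with F as the kernel term and X as
  the cokernel term; \<open>Ext1_vanishes_iff\<close> makes the link.\<close>

definition (in exact_category) ext_splits :: "'o \<Rightarrow> 'o \<Rightarrow> bool" where
  "ext_splits X F \<longleftrightarrow> (\<forall>i d E. confl i d F E X \<longrightarrow> (\<exists>s \<in> Hom \<A> X E. d \<cdot> s = Ident \<A> X))"

context exact_category
begin

lemma ext_splitsI:
  assumes "\<And>i d E. confl i d F E X \<Longrightarrow> \<exists>r \<in> Hom \<A> E F. r \<cdot> i = Ident \<A> F"
  shows "ext_splits X F"
  unfolding ext_splits_def
proof (intro allI impI)
  fix i d E assume c: "confl i d F E X"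
  obtain r where r: "r \<in> Hom \<A> E F" "r \<cdot> i = Ident \<A> F" using assms[OF c] by blast
  obtain s where "is_biproduct \<A> F X E i s r d" by (rule retraction_biproduct[OF c r])
  from biproductD(2,6)[OF this] show "\<exists>s \<in> Hom \<A> X E. d \<cdot> s = Ident \<A> X" by blast
qed

text \<open>Pulling the conflation back along g gives an extension of X by F; its section followed
  by the projection to E is the lift.\<close>

lemma ext_splits_lift:
  assumes s: "ext_splits X F" and c: "confl i d F E Z" and g: "g \<in> Hom \<A> X Z"
  obtains h where "h \<in> Hom \<A> X E" "d \<cdot> h = g"
proof -
  obtain k' e f' P where pb: "confl k' e F P X" "f' \<in> Hom \<A> P E" "d \<cdot> f' = g \<cdot> e"
    by (rule deflation_pullbackE[OF c g])
  obtain t where t: "t \<in> Hom \<A> X P" "e \<cdot> t = Ident \<A> X" using s pb(1) unfolding ext_splits_def by blast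
  note [simp] = confl_Hom(1,2)[OF c, unfolded Hom_iff] confl_Hom(1,2)[OF pb(1), unfolded Hom_iff]
    g[unfolded Hom_iff] pb(2)[unfolded Hom_iff] t(1)[unfolded Hom_iff]
  have "d \<cdot> (f' \<cdot> t) = g" by (simp add: Comp_Comp_eq[OF pb(3)] t(2))
  then show ?thesis by (rule that[rotated]) (simp add: Hom_iff)
qed

text \<open>Pushing out along g gives an extension of X by F; it splits, and its retraction to F
  restricted to E is the extension of g.\<close>

lemma ext_splits_extend:
  assumes s: "ext_splits X F" and c: "confl i d A E X" and g: "g \<in> Hom \<A> A F"
  obtains h where "h \<in> Hom \<A> E F" "h \<cdot> i = g"
proof -
  obtain j d' f' P where po: "confl j d' F P X" "f' \<in> Hom \<A> E P" "f' \<cdot> i = j \<cdot> g"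
    by (rule inflation_pushoutE[OF c g])
  obtain t where t: "t \<in> Hom \<A> X P" "d' \<cdot> t = Ident \<A> X" using s po(1) unfolding ext_splits_def by blast
  obtain r where "is_biproduct \<A> F X P j t r d'" by (rule section_biproduct[OF po(1) t])
  note r = biproductD(3,5)[OF this]
  note [simp] = confl_Hom(1,2)[OF c, unfolded Hom_iff] confl_Hom(1,2)[OF po(1), unfolded Hom_iff]
    g[unfolded Hom_iff] po(2)[unfolded Hom_iff] r(1)[unfolded Hom_iff]
  have "(r \<cdot> f') \<cdot> i = g" by (simp add: po(3) Comp_Comp_eq[OF r(2)])
  then show ?thesis by (rule that[rotated]) (simp add: Hom_iff)
qed

text \<open>After pulling \<open>p\<close> back along \<open>v\<close>, the kernel of \<open>P \<rightarrow> B \<rightarrow> C\<close> is the biproduct of \<open>A\<close> and \<open>F\<close>;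
  extending its projection to \<open>F\<close> over \<open>P\<close> yields a splitting of \<open>P \<rightarrow> B\<close> compatible with \<open>u\<close>.\<close>

lemma ext_splits_lifting:
  assumes s: "ext_splits C F" and ci: "confl i c A B C" and cp: "confl k p F D E"
  shows "has_lifting \<A> i p"
proof (rule liftingI[OF confl_Hom(1)[OF ci] confl_Hom(2)[OF cp]])
  fix u v assume u: "u \<in> Hom \<A> A D" and v: "v \<in> Hom \<A> B E" and uv: "v \<cdot> i = p \<cdot> u"
  obtain k1 e f' P where pb: "confl k1 e F P B" "f' \<in> Hom \<A> P D" "f' \<cdot> k1 = k" "p \<cdot> f' = v \<cdot> e" "is_pullback \<A> p v e f'"
    by (rule deflation_pullbackE[OF cp v])
  note hi = confl_Hom[OF ci] and hp = confl_Hom[OF cp] and he = confl_Hom[OF pb(1)]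
  note [simp] = hi(1,2)[unfolded Hom_iff] hp(1,2)[unfolded Hom_iff] he(1,2)[unfolded Hom_iff]
    pb(2)[unfolded Hom_iff] u[unfolded Hom_iff] v[unfolded Hom_iff]
  obtain a where a: "a \<in> Hom \<A> A P" "f' \<cdot> a = u" "e \<cdot> a = i"
    by (rule pullback_factor[OF pb(5) hp(2) v he(2) u hi(1)]) (simp_all add: uv)
  note [simp] = a(1)[unfolded Hom_iff]
  have "c \<cdot> e \<in> deflations \<A>"
    by (rule deflation_Comp) (use confl_deflation[OF ci] confl_deflation[OF pb(1)] in simp_all)
  moreover have ce: "c \<cdot> e \<in> Hom \<A> P C" by (simp add: Hom_iff)
  ultimately obtain m M where m: "confl m (c \<cdot> e) M P C" by (rule deflationE)
  note [simp] = confl_Hom(1)[OF m, unfolded Hom_iff]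
  obtain a' where a': "a' \<in> Hom \<A> A M" "m \<cdot> a' = a"
    by (rule confl_factor[OF m a(1)]) (simp_all add: a(3) confl_Zero[OF ci])
  obtain k' where k': "k' \<in> Hom \<A> F M" "m \<cdot> k' = k1"
    by (rule confl_factor[OF m he(1)]) (simp_all add: confl_Zero[OF pb(1)])
  note [simp] = a'(1)[unfolded Hom_iff] k'(1)[unfolded Hom_iff]
  have cem: "c \<cdot> (e \<cdot> m) = Zero_Arr \<A> M C" using confl_Zero[OF m] by simp
  have em: "e \<cdot> m \<in> Hom \<A> M B" by (simp add: Hom_iff)
  obtain n where n: "n \<in> Hom \<A> M A" "i \<cdot> n = e \<cdot> m"
    by (rule confl_factor[OF ci em cem])
  note [simp] = n(1)[unfolded Hom_iff]
  have na: "n \<cdot> a' = Ident \<A> A"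
    by (rule confl_mono[OF ci, of _ A]) (simp_all add: Hom_iff Comp_Comp_eq[OF n(2)] a'(2) a(3))
  have z: "e \<cdot> (m \<cdot> (Ident \<A> M \<oplus> neg (a' \<cdot> n))) = Zero_Arr \<A> M B"
    by (simp add: Comp_Comp_eq[OF a'(2)] Comp_Comp_eq[OF a(3)] n(2))
  have zH: "m \<cdot> (Ident \<A> M \<oplus> neg (a' \<cdot> n)) \<in> Hom \<A> M P" by (simp add: Hom_iff)
  \<comment> \<open>M is the biproduct of A and F with injections a' and k' and projections n and r.
    Since m (1 - a' n) is killed by e, it factors through k1, and the factor is r.\<close>
  obtain r where r: "r \<in> Hom \<A> M F" "k1 \<cdot> r = m \<cdot> (Ident \<A> M \<oplus> neg (a' \<cdot> n))"
    by (rule confl_factor[OF pb(1) zH z])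
  note [simp] = r(1)[unfolded Hom_iff]
  have r2: "k1 \<cdot> r = m \<oplus> neg (a \<cdot> n)" unfolding r(2) by (simp add: Comp_Comp_eq[OF a'(2)])
  have nk: "n \<cdot> k' = Zero_Arr \<A> F A"
    by (rule confl_mono[OF ci, of _ F]) (simp_all add: Hom_iff Comp_Comp_eq[OF n(2)] k'(2) confl_Zero[OF pb(1)])
  have rk: "r \<cdot> k' = Ident \<A> F"
    by (rule confl_mono[OF pb(1), of _ F]) (simp_all add: Hom_iff Comp_Comp_eq[OF r2] k'(2) nk)
  have ra: "r \<cdot> a' = Zero_Arr \<A> A F"
    by (rule confl_mono[OF pb(1), of _ A]) (simp_all add: Hom_iff Comp_Comp_eq[OF r2] a'(2) na)
  obtain R where R: "R \<in> Hom \<A> P F" "R \<cdot> m = r" by (rule ext_splits_extend[OF s m r(1)])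
  note [simp] = R(1)[unfolded Hom_iff]
  have Rk: "R \<cdot> k1 = Ident \<A> F" using Comp_Comp_eq[OF R(2), of k'] by (simp add: k'(2) rk)
  have Ra: "R \<cdot> a = Zero_Arr \<A> A F" using Comp_Comp_eq[OF R(2), of a'] by (simp add: a'(2) ra)
  obtain t where b: "is_biproduct \<A> F B P k1 t R e" by (rule retraction_biproduct[OF pb(1) R(1) Rk])
  note t = biproductD(2,6)[OF b]
  note [simp] = t(1)[unfolded Hom_iff]
  \<comment> \<open>In the decomposition of a along k1 and t the first summand vanishes because R
    kills a, so the section t extends a over B.\<close>
  have ti: "t \<cdot> i = a" using biproduct_decomp[OF b a(1)] by (simp add: Ra a(3))
  have "(f' \<cdot> t) \<cdot> i = u" by (simp add: ti a(2))
  moreover have "p \<cdot> (f' \<cdot> t) = v" by (simp add: Comp_Comp_eq[OF pb(4)] t(2))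
  moreover have "f' \<cdot> t \<in> Hom \<A> B D" by (simp add: Hom_iff)
  ultimately show "\<exists>h \<in> Hom \<A> B D. h \<cdot> i = u \<and> p \<cdot> h = v" by blast
qed

lemma extensions_iff: "(i, d) \<in> extensions \<A> X F \<longleftrightarrow> (\<exists>E. confl i d F E X)"
proof
  assume "(i, d) \<in> extensions \<A> X F"
  then have "(i, d) \<in> Conf \<A>" "Dom \<A> i = F" "Cod \<A> d = X" unfolding extensions_def by auto
  then show "\<exists>E. confl i d F E X" using Conf_confl by blast
next
  assume "\<exists>E. confl i d F E X"
  then show "(i, d) \<in> extensions \<A> X F" unfolding extensions_def by (auto simp: confl_def Hom_iff)
qed

lemma ext_equivI:
  assumes c: "confl i d F E X" and c': "confl i' d' F E' X" and f: "f \<in> Hom \<A> E E'" "is_iso \<A> f" "f \<cdot> i = i'" "d' \<cdot> f = d"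
  shows "((i, d), (i', d')) \<in> ext_equiv \<A> X F"
proof -
  have "Cod \<A> i = E" "Cod \<A> i' = E'" using confl_Hom(1)[OF c] confl_Hom(1)[OF c'] by (simp_all add: Hom_iff)
  then show ?thesis using assms extensions_iff unfolding ext_equiv_def by blast
qed

text \<open>The inverse of the comparison morphism is the same formula with the two biproducts
  exchanged, so one of the two composites is enough: the other is the instance with swapped
  roles.\<close>

lemma biproduct_comparison:
  assumes b: "is_biproduct \<A> F X E i s r d" and b': "is_biproduct \<A> F X E' i' s' r' d'"
  shows "(i' \<cdot> r) \<oplus> (s' \<cdot> d) \<in> Hom \<A> E E'" "((i' \<cdot> r) \<oplus> (s' \<cdot> d)) \<cdot> i = i'" "d' \<cdot> ((i' \<cdot> r) \<oplus> (s' \<cdot> d)) = d"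
    "((i \<cdot> r') \<oplus> (s \<cdot> d')) \<cdot> ((i' \<cdot> r) \<oplus> (s' \<cdot> d)) = Ident \<A> E"
proof -
  note b = biproductD[OF b] and b' = biproductD[OF b']
  note [simp] = b(1-4)[unfolded Hom_iff] b'(1-4)[unfolded Hom_iff]
  show "(i' \<cdot> r) \<oplus> (s' \<cdot> d) \<in> Hom \<A> E E'" by (simp add: Hom_iff)
  show "((i' \<cdot> r) \<oplus> (s' \<cdot> d)) \<cdot> i = i'" by (simp add: b(5,8))
  show "d' \<cdot> ((i' \<cdot> r) \<oplus> (s' \<cdot> d)) = d" by (simp add: Comp_Comp_eq[OF b'(8)] Comp_Comp_eq[OF b'(6)])
  show "((i \<cdot> r') \<oplus> (s \<cdot> d')) \<cdot> ((i' \<cdot> r) \<oplus> (s' \<cdot> d)) = Ident \<A> E"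
    by (simp add: Comp_Comp_eq[OF b'(8)] Comp_Comp_eq[OF b'(6)] Comp_Comp_eq[OF b'(5)] Comp_Comp_eq[OF b'(7)] b(9))
qed

end

section \<open>Consequences of weak idempotent completeness, and Ext^1 as splitting\<close>

context wic_exact_category
begin

lemma biproduct_confl:
  assumes "is_biproduct \<A> X Y P iX iY pX pY"
  shows "confl iX pY X P Y"
proof -
  note b = biproductD[OF assms]
  have "is_split_epi \<A> pY" using b unfolding is_split_epi_def by (auto simp: Hom_iff)
  then have "pY \<in> deflations \<A>" by (rule split_epi_deflation)
  then obtain k K where "confl k pY K P Y" using b(4) by (rule deflationE)
  then show ?thesis by (rule kernel_confl[OF _ biproduct_kernel[OF biproduct_swap[OF assms]] b(1)])
qed

text \<open>The retraction r is a split epimorphism, hence a deflation, and its kernel is the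
  missing complement of s. So split monomorphisms are inflations, which is weak idempotent
  completeness of \<open>opp \<A>\<close>.\<close>

lemma split_mono_confl:
  assumes s: "s \<in> Hom \<A> X Y" and r: "r \<in> Hom \<A> Y X" and rs: "r \<cdot> s = Ident \<A> X"
  obtains t c C where "is_biproduct \<A> X C Y s t r c" "confl s c X Y C"
proof -
  have "is_split_epi \<A> r" using assms unfolding is_split_epi_def by (auto simp: Hom_iff)
  then have "r \<in> deflations \<A>" by (rule split_epi_deflation)
  then obtain k K where k: "confl k r K Y X" using r by (rule deflationE)
  obtain q where "is_biproduct \<A> K X Y k s q r" by (rule section_biproduct[OF k s rs])
  from biproduct_swap[OF this] have "is_biproduct \<A> X K Y s k r q" .
  from that[OF this biproduct_confl[OF this]] show ?thesis .
qed

lemma wic_opp: "wic_exact_category (opp \<A>)"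
proof (intro wic_exact_category.intro exact_opp wic_exact_category_axioms.intro)
  fix p assume "is_split_epi (opp \<A>) p"
  then obtain s where p: "p \<in> Arr \<A>" and s: "s \<in> Hom \<A> (Cod \<A> p) (Dom \<A> p)" "s \<cdot> p = Ident \<A> (Dom \<A> p)"
    unfolding is_split_epi_def by auto
  obtain t c C where "confl p c (Dom \<A> p) (Cod \<A> p) C" by (rule split_mono_confl[OF Arr_Hom[OF p] s])
  then show "p \<in> deflations (opp \<A>)" by (simp add: confl_inflation)
qed

text \<open>Pull \<open>g \<cdot> f\<close> back along \<open>g\<close>: the projection \<open>f'\<close> to \<open>A\<close> is split by \<open>s = (1, f)\<close>, so the pullback is
  \<open>A \<oplus> K\<close> with \<open>K\<close> the kernel of \<open>g\<close>, and the inclusion of \<open>K\<close> into \<open>B\<close> is a pushout of the kernel of \<open>g \<cdot> f\<close>.\<close>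

lemma deflation_Comp_cancel:
  assumes f: "f \<in> Hom \<A> A B" and g: "g \<in> Hom \<A> B C" and gf: "g \<cdot> f \<in> deflations \<A>"
  shows "g \<in> deflations \<A>"
proof -
  note [simp] = f[unfolded Hom_iff] g[unfolded Hom_iff]
  have gfH: "g \<cdot> f \<in> Hom \<A> A C" by (simp add: Hom_iff)
  obtain l L where l: "confl l (g \<cdot> f) L A C" by (rule deflationE[OF gf gfH])
  note [simp] = confl_Hom(1)[OF l, unfolded Hom_iff]
  obtain l2 e f' P where pb: "confl l2 e L P B" "f' \<in> Hom \<A> P A" "f' \<cdot> l2 = l" "(g \<cdot> f) \<cdot> f' = g \<cdot> e" "is_pullback \<A> (g \<cdot> f) g e f'"
    by (rule deflation_pullbackE[OF l g])
  note he = confl_Hom[OF pb(1)]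
  note [simp] = he(1,2)[unfolded Hom_iff] pb(2)[unfolded Hom_iff]
  have idA: "Ident \<A> A \<in> Hom \<A> A A" by (simp add: Hom_iff)
  obtain s where s: "s \<in> Hom \<A> A P" "f' \<cdot> s = Ident \<A> A" "e \<cdot> s = f"
    by (rule pullback_factor[OF pb(5) gfH g he(2) idA f]) simp_all
  note [simp] = s(1)[unfolded Hom_iff]
  obtain m n K where b: "is_biproduct \<A> A K P s m f' n" by (rule split_mono_confl[OF s(1) pb(2) s(2)])
  note b' = biproductD[OF b]
  note [simp] = b'(2,4)[unfolded Hom_iff]
  define k where "k = e \<cdot> m"
  \<comment> \<open>The sign is forced: e kills l2 = s l + m n l2, which gives f l + k n l2 = 0, so
    that f l = k l' requires l' to be the negative of n l2.\<close>
  define l' where "l' = neg (n \<cdot> l2)"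
  have kH: "k \<in> Hom \<A> K B" and l'H: "l' \<in> Hom \<A> L K" unfolding k_def l'_def by (simp_all add: Hom_iff)
  note [simp] = kH[unfolded Hom_iff] l'H[unfolded Hom_iff]
  have gk: "g \<cdot> k = Zero_Arr \<A> K C"
    using Comp_Comp_eq[OF pb(4), of m, symmetric] by (simp add: k_def b'(7))
  have e_dec: "e = f \<cdot> f' \<oplus> k \<cdot> n"
    using arg_cong[OF b'(9), of "\<lambda>x. e \<cdot> x"] by (simp add: k_def Comp_Comp_eq[OF s(3)])
  have l2_dec: "l2 = s \<cdot> l \<oplus> m \<cdot> (n \<cdot> l2)"
    using biproduct_decomp[OF b he(1)] by (simp add: pb(3))
  have "f \<cdot> l \<oplus> k \<cdot> (n \<cdot> l2) = Zero_Arr \<A> L B"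
    using confl_Zero[OF pb(1)] by (subst (asm) e_dec) (simp add: pb(3))
  then have "k \<cdot> (n \<cdot> l2) = neg (f \<cdot> l)" by (intro neg_unique[of _ L B]) (simp_all add: Hom_iff)
  then have sq: "f \<cdot> l = k \<cdot> l'" by (simp add: l'_def)
  have po: "is_pushout \<A> l l' k f"
  proof (rule pushoutI[OF _ l'H kH f sq])
    show "l \<in> Hom \<A> L A" by (simp add: Hom_iff)
  next
    fix S u v assume uv: "u \<in> Hom \<A> B S" "v \<in> Hom \<A> B S" "u \<cdot> f = v \<cdot> f" "u \<cdot> k = v \<cdot> k"
    note [simp] = uv(1,2)[unfolded Hom_iff]
    show "u = v"
    proof (rule confl_epi[OF pb(1) uv(1,2)])
      show "u \<cdot> e = v \<cdot> e" by (subst (1 2) e_dec) (simp add: Comp_Comp_eq[OF uv(3)] Comp_Comp_eq[OF uv(4)])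
    qed
  next
    fix S u v assume uv: "u \<in> Hom \<A> A S" "v \<in> Hom \<A> K S" "u \<cdot> l = v \<cdot> l'"
    note [simp] = uv(1,2)[unfolded Hom_iff]
    define w where "w = u \<cdot> f' \<oplus> v \<cdot> n"
    have w: "w \<in> Hom \<A> P S" unfolding w_def by (simp add: Hom_iff)
    have "w \<cdot> l2 = u \<cdot> l \<oplus> v \<cdot> (n \<cdot> l2)" unfolding w_def by (simp add: pb(3))
    also have "\<dots> = Zero_Arr \<A> L S" unfolding uv(3) l'_def by simp
    finally obtain h where h: "h \<in> Hom \<A> B S" "h \<cdot> e = w" by (rule confl_cofactor[OF pb(1) w])
    note [simp] = h(1)[unfolded Hom_iff] w[unfolded Hom_iff]
    have "h \<cdot> f = u" using Comp_Comp_eq[OF h(2), of s] by (simp add: s(3) w_def b'(8) s(2))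
    moreover have "h \<cdot> k = v" unfolding k_def using Comp_Comp_eq[OF h(2), of m] by (simp add: w_def b'(6,7))
    ultimately show "\<exists>h \<in> Hom \<A> B S. h \<cdot> f = u \<and> h \<cdot> k = v" using h(1) by blast
  qed
  obtain c C' where kc: "confl k c K B C'" by (rule pushout_inflation[OF l l'H po kH])
  have "is_cokernel \<A> g k"
  proof (rule cokernelI[OF g kH gk])
    fix T u v assume uv: "u \<in> Hom \<A> C T" "v \<in> Hom \<A> C T" "u \<cdot> g = v \<cdot> g"
    note [simp] = uv(1,2)[unfolded Hom_iff]
    show "u = v" by (rule confl_epi[OF l uv(1,2)]) (simp add: Comp_Comp_eq[OF uv(3)])
  next
    fix T u assume u: "u \<in> Hom \<A> B T" "u \<cdot> k = Zero_Arr \<A> K T"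
    note [simp] = u(1)[unfolded Hom_iff]
    have ufl: "(u \<cdot> f) \<cdot> l = Zero_Arr \<A> L T" by (simp add: sq Comp_Comp_eq[OF u(2)])
    have uf: "u \<cdot> f \<in> Hom \<A> A T" by (simp add: Hom_iff)
    obtain v where v: "v \<in> Hom \<A> C T" "v \<cdot> (g \<cdot> f) = u \<cdot> f" by (rule confl_cofactor[OF l uf ufl])
    note [simp] = v(1)[unfolded Hom_iff]
    have "v \<cdot> g = u"
    proof (rule confl_epi[OF pb(1), of _ T])
      show "(v \<cdot> g) \<cdot> e = u \<cdot> e"
        using Comp_Comp_eq[OF v(2), of f']
        by (subst (1 2) e_dec) (simp add: Comp_Comp_eq[OF gk] Comp_Comp_eq[OF u(2)])
    qed (simp_all add: Hom_iff)
    then show "\<exists>h \<in> Hom \<A> C T. h \<cdot> g = u" using v(1) by blast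
  qed
  then have "confl k g K B C" by (rule cokernel_confl[OF kc _ g])
  then show ?thesis by (rule confl_deflation)
qed

lemma inflation_Comp_cancel:
  assumes "f \<in> Hom \<A> A B" "g \<in> Hom \<A> B C" "g \<cdot> f \<in> inflations \<A>"
  shows "f \<in> inflations \<A>"
  using wic_exact_category.deflation_Comp_cancel[OF wic_opp, of g C B f A] assms by simp

text \<open>A section exhibits the middle term as a biproduct, and any two biproducts of F and X are
  identified by \<open>biproduct_comparison\<close>, so splitting collapses all extensions into one
  class. Conversely, an equivalence from a biproduct carries the injection of X to a
  section.\<close>

lemma Ext1_vanishes_iff:
  assumes X: "X \<in> Obj \<A>" and F: "F \<in> Obj \<A>"
  shows "Ext1_vanishes \<A> X F \<longleftrightarrow> ext_splits X F"
proof
  assume van: "Ext1_vanishes \<A> X F"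
  show "ext_splits X F"
    unfolding ext_splits_def
  proof (intro allI impI)
    fix i d E assume c: "confl i d F E X"
    note [simp] = confl_Hom(1,2)[OF c, unfolded Hom_iff]
    have eq: "((i, d), (i, d)) \<in> ext_equiv \<A> X F"
      by (rule ext_equivI[OF c c, of "Ident \<A> E"]) (simp_all add: Hom_iff)
    have "(i, d) \<in> extensions \<A> X F" using c extensions_iff by blast
    then have "ext_equiv \<A> X F `` {(i, d)} \<in> Ext1 \<A> X F" unfolding Ext1_def by (rule quotientI)
    then have "ext_equiv \<A> X F `` {(i, d)} = Ext1_zero \<A> X F" using van unfolding Ext1_vanishes_def by simp
    then have "(i, d) \<in> Ext1_zero \<A> X F" using eq by blast
    then obtain P iF iX pF pX where b: "is_biproduct \<A> F X P iF iX pF pX" and r: "((iF, pX), (i, d)) \<in> ext_equiv \<A> X F"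
      unfolding Ext1_zero_def by blast
    note [simp] = biproductD(1-4)[OF b, unfolded Hom_iff]
    from r obtain \<phi> where p: "\<phi> \<in> Hom \<A> (Cod \<A> iF) (Cod \<A> i)" "d \<cdot> \<phi> = pX" unfolding ext_equiv_def by blast
    have p1: "\<phi> \<in> Hom \<A> P E" using p(1) by simp
    note [simp] = p1[unfolded Hom_iff]
    have "d \<cdot> (\<phi> \<cdot> iX) = Ident \<A> X" by (simp add: Comp_Comp_eq[OF p(2)] biproductD(6)[OF b])
    moreover have "\<phi> \<cdot> iX \<in> Hom \<A> X E" by (simp add: Hom_iff)
    ultimately show "\<exists>s \<in> Hom \<A> X E. d \<cdot> s = Ident \<A> X" by blast
  qed
next
  assume split: "ext_splits X F"
  have all: "(x, y) \<in> ext_equiv \<A> X F" if x: "x \<in> extensions \<A> X F" and y: "y \<in> extensions \<A> X F" for x y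
  proof -
    obtain i d where x': "x = (i, d)" by (rule prod.exhaust)
    obtain i' d' where y': "y = (i', d')" by (rule prod.exhaust)
    obtain E where c: "confl i d F E X" using x x' extensions_iff by blast
    obtain E' where c': "confl i' d' F E' X" using y y' extensions_iff by blast
    obtain s where s: "s \<in> Hom \<A> X E" "d \<cdot> s = Ident \<A> X" using split c unfolding ext_splits_def by blast
    obtain s' where s': "s' \<in> Hom \<A> X E'" "d' \<cdot> s' = Ident \<A> X" using split c' unfolding ext_splits_def by blast
    obtain r where b: "is_biproduct \<A> F X E i s r d" by (rule section_biproduct[OF c s])
    obtain r' where b': "is_biproduct \<A> F X E' i' s' r' d'" by (rule section_biproduct[OF c' s'])
    note f = biproduct_comparison[OF b b'] and g = biproduct_comparison[OF b' b]
    show ?thesis unfolding x' y' by (rule ext_equivI[OF c c' f(1) isoI[OF f(1) g(1) f(4) g(4)] f(2,3)])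
  qed
  have sub: "ext_equiv \<A> X F \<subseteq> extensions \<A> X F \<times> extensions \<A> X F" unfolding ext_equiv_def by blast
  have img: "ext_equiv \<A> X F `` {x} = extensions \<A> X F" if "x \<in> extensions \<A> X F" for x
    using all[OF that] sub by blast
  \<comment> \<open>The biproduct guarantees that extensions exist at all; otherwise the quotient
    would be empty instead of a singleton.\<close>
  obtain P iF iX pF pX where b: "is_biproduct \<A> F X P iF iX pF pX" using biproduct_exists[OF F X] by blast
  then have mem: "(iF, pX) \<in> extensions \<A> X F" using biproduct_confl extensions_iff by blast
  have "Ext1 \<A> X F = {extensions \<A> X F}"
    unfolding Ext1_def quotient_def using img mem by auto
  moreover have "Ext1_zero \<A> X F = extensions \<A> X F"
    unfolding Ext1_zero_def using img[OF mem] b sub by blast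
  ultimately show "Ext1_vanishes \<A> X F" unfolding Ext1_vanishes_def by simp
qed

end

section \<open>Complete cotorsion pairs\<close>

text \<open>The explicit form of the trivial fibrations on both sides of the bijection, established
  in \<open>TFib_\<omega>_eq\<close> and \<open>TFib_eq\<close>.\<close>

definition TFib_\<omega> :: "('o, 'm, 'z) exact_cat_data_scheme \<Rightarrow> 'o set \<Rightarrow> 'm set" where
  "TFib_\<omega> \<A> \<Y> = {p \<in> deflations \<A>. Ker_in \<A> p \<Y>}"

context exact_category
begin

lemma TFibI: "confl k p F D E \<Longrightarrow> F \<in> \<Y> \<Longrightarrow> p \<in> TFib_\<omega> \<A> \<Y>"
  unfolding TFib_\<omega>_def Ker_in_def
  using confl_deflation[of k p F D E] confl_Hom(1,4)[of k p F D E] by (auto simp: Hom_iff)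

lemma TFibE:
  assumes "p \<in> TFib_\<omega> \<A> \<Y>" "p \<in> Hom \<A> D E"
  obtains k F where "confl k p F D E" "F \<in> \<Y>"
proof -
  obtain k where k: "is_kernel \<A> k p" "Dom \<A> k \<in> \<Y>" and p: "p \<in> deflations \<A>"
    using assms(1) unfolding TFib_\<omega>_def Ker_in_def by blast
  obtain k' F where "confl k' p F D E" by (rule deflationE[OF p assms(2)])
  then have "confl k p (Dom \<A> k) D E" by (rule kernel_confl[OF _ k(1) kernelD(1)[OF k(1) assms(2)]])
  then show ?thesis using k(2) by (rule that)
qed

lemma CoFibI: "confl i c A B C \<Longrightarrow> C \<in> \<X> \<Longrightarrow> i \<in> CoFib_\<omega> \<A> \<X>"
  unfolding CoFib_\<omega>_def Coker_in_def
  using confl_inflation[of i c A B C] confl_Hom(2,5)[of i c A B C] by (auto simp: Hom_iff)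

lemma CoFibE:
  assumes "i \<in> CoFib_\<omega> \<A> \<X>" "i \<in> Hom \<A> A B"
  obtains c C where "confl i c A B C" "C \<in> \<X>"
proof -
  obtain c where c: "is_cokernel \<A> c i" "Cod \<A> c \<in> \<X>" and i: "i \<in> inflations \<A>"
    using assms(1) unfolding CoFib_\<omega>_def Coker_in_def by blast
  obtain c' C where c': "confl i c' A B C" by (rule inflationE[OF i assms(2)])
  have "c \<in> Hom \<A> B (Cod \<A> c)" using cokernel_Arr[OF c(1)] assms(2) by (simp add: Hom_iff)
  then have "confl i c A B (Cod \<A> c)" by (rule cokernel_confl[OF c' c(1)])
  then show ?thesis using c(2) by (rule that)
qed

lemma TFib_Arr: "p \<in> TFib_\<omega> \<A> \<Y> \<Longrightarrow> p \<in> Arr \<A>"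
  unfolding TFib_\<omega>_def using deflation_Arr by blast

lemma CoFib_\<omega>_Arr: "p \<in> CoFib_\<omega> \<A> \<Y> \<Longrightarrow> p \<in> Arr \<A>"
  unfolding CoFib_\<omega>_def using inflation_Arr by blast

text \<open>Only vanishing of extensions is assumed, so the lemma serves both a given cotorsion pair
  and the pair extracted from a model structure.\<close>

lemma CoFib_TFib_lifting:
  assumes "\<And>C F. C \<in> \<X> \<Longrightarrow> F \<in> \<Y> \<Longrightarrow> ext_splits C F" "i \<in> CoFib_\<omega> \<A> \<X>" "p \<in> TFib_\<omega> \<A> \<Y>"
  shows "has_lifting \<A> i p"
proof -
  obtain c C where c: "confl i c (Dom \<A> i) (Cod \<A> i) C" "C \<in> \<X>"
    by (rule CoFibE[OF assms(2) Arr_Hom[OF CoFib_\<omega>_Arr[OF assms(2)]]])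
  obtain k F where k: "confl k p F (Dom \<A> p) (Cod \<A> p)" "F \<in> \<Y>"
    by (rule TFibE[OF assms(3) Arr_Hom[OF TFib_Arr[OF assms(3)]]])
  show ?thesis by (rule ext_splits_lifting[OF assms(1)[OF c(2) k(2)] c(1) k(1)])
qed

text \<open>Serves in two ways: X is a cokernel of the morphism out of Z, which relates cofibrations
  to cofibrant objects, and identities are deflations with zero kernel.\<close>

lemma zero_object_confl:
  assumes Z: "is_zero_object \<A> Z" and X: "X \<in> Obj \<A>"
  shows "confl (Zero_Arr \<A> Z X) (Ident \<A> X) Z X X"
proof -
  have [simp]: "Z \<in> Obj \<A>" "X \<in> Obj \<A>" using Z X by (auto dest: zero_object_Obj)
  have H: "Ident \<A> X \<in> Hom \<A> X X" "Zero_Arr \<A> Z X \<in> Hom \<A> Z X" by (simp_all add: Hom_iff)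
  obtain k K where k: "confl k (Ident \<A> X) K X X" by (rule deflationE[OF Ident_deflation[OF X] H(1)])
  have "is_kernel \<A> (Zero_Arr \<A> Z X) (Ident \<A> X)"
  proof (rule kernelI[OF H(2,1)])
    fix T u v assume "u \<in> Hom \<A> T Z" "v \<in> Hom \<A> T Z"
    then show "u = v" using to_zero_object[OF Z] by metis
  next
    fix T g assume g: "g \<in> Hom \<A> T X" "Ident \<A> X \<cdot> g = Zero_Arr \<A> T X"
    note [simp] = g(1)[unfolded Hom_iff]
    have "Zero_Arr \<A> Z X \<cdot> Zero_Arr \<A> T Z = g" using g(2) by simp
    moreover have "Zero_Arr \<A> T Z \<in> Hom \<A> T Z" by (simp add: Hom_iff)
    ultimately show "\<exists>h \<in> Hom \<A> T Z. Zero_Arr \<A> Z X \<cdot> h = g" by blast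
  qed simp
  then show ?thesis by (rule kernel_confl[OF k _ H(2)])
qed

text \<open>Allows a zero object as either summand in the definition of \<open>Weq_\<omega>\<close>:
  as W when the morphism is already a deflation with kernel in \<open>\<Y>\<close>, and as the
  domain when trivial objects are computed.\<close>

lemma zero_object_biproduct:
  assumes Z: "is_zero_object \<A> Z" and X: "X \<in> Obj \<A>"
  shows "is_biproduct \<A> X Z X (Ident \<A> X) (Zero_Arr \<A> Z X) (Ident \<A> X) (Zero_Arr \<A> X Z)"
proof -
  have [simp]: "Z \<in> Obj \<A>" "X \<in> Obj \<A>" using Z X by (auto dest: zero_object_Obj)
  show ?thesis unfolding is_biproduct_def by (simp add: Hom_iff zero_object_Ident[OF Z])
qed

lemma Fib_\<omega>_lift:
  assumes "f \<in> Fib_\<omega> \<A> \<X> \<Y>" "f \<in> Hom \<A> A B" "W \<in> \<X> \<inter> \<Y>" "g \<in> Hom \<A> W B"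
  obtains h where "h \<in> Hom \<A> W A" "f \<cdot> h = g"
proof -
  have "Dom \<A> f = A" "Cod \<A> f = B" using assms(2) by (simp_all add: Hom_iff)
  then show ?thesis using assms(1,3,4) that unfolding Fib_\<omega>_def by blast
qed

text \<open>On the summand A the filler is forced to be u; on W it is a lift of
  \<open>v \<cdot> t\<close> along p, which exists because W lies in \<omega>.\<close>

lemma split_lifting:
  assumes b: "is_biproduct \<A> A W B i t r c" and W: "W \<in> \<X> \<inter> \<Y>" and p: "p \<in> Fib_\<omega> \<A> \<X> \<Y>"
  shows "has_lifting \<A> i p"
proof -
  have [simp]: "p \<in> Arr \<A>" using p unfolding Fib_\<omega>_def by blast
  note b' = biproductD[OF b]
  note [simp] = b'(1-4)[unfolded Hom_iff]
  obtain D E where pH: "p \<in> Hom \<A> D E" by (meson Arr_Hom \<open>p \<in> Arr \<A>\<close>)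
  note [simp] = pH[unfolded Hom_iff]
  show ?thesis
  proof (rule liftingI[OF b'(1) pH])
    fix u v assume uv: "u \<in> Hom \<A> A D" "v \<in> Hom \<A> B E" "v \<cdot> i = p \<cdot> u"
    note [simp] = uv(1,2)[unfolded Hom_iff]
    have vt: "v \<cdot> t \<in> Hom \<A> W E" by (simp add: Hom_iff)
    obtain l where l: "l \<in> Hom \<A> W D" "p \<cdot> l = v \<cdot> t" by (rule Fib_\<omega>_lift[OF p pH W vt])
    note [simp] = l(1)[unfolded Hom_iff]
    have "(u \<cdot> r \<oplus> l \<cdot> c) \<cdot> i = u" by (simp add: b'(5,8))
    moreover have "p \<cdot> (u \<cdot> r \<oplus> l \<cdot> c) = v"
      using arg_cong[OF b'(9), of "\<lambda>x. v \<cdot> x"] by (simp add: Comp_Comp_eq[OF l(2)] Comp_Comp_eq[OF uv(3)])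
    moreover have "u \<cdot> r \<oplus> l \<cdot> c \<in> Hom \<A> B D" by (simp add: Hom_iff)
    ultimately show "\<exists>h \<in> Hom \<A> B D. h \<cdot> i = u \<and> p \<cdot> h = v" by blast
  qed
qed

text \<open>The defining datum of a weak equivalence read as a factorization: f is (f, t) restricted
  to the first summand, so a split inclusion with complement in \<omega> followed by a deflation
  with kernel in \<open>\<Y>\<close> has the required form.\<close>

lemma Weq_\<omega>I:
  assumes b: "is_biproduct \<A> A W P i t r c" and W: "W \<in> \<X> \<inter> \<Y>" and q: "q \<in> TFib_\<omega> \<A> \<Y>" "q \<in> Hom \<A> P B"
  shows "q \<cdot> i \<in> Weq_\<omega> \<A> \<X> \<Y>"
proof -
  note b' = biproductD[OF b]
  note [simp] = b'(1-4)[unfolded Hom_iff] q(2)[unfolded Hom_iff]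
  have eq: "((q \<cdot> i) \<cdot> r) \<oplus> ((q \<cdot> t) \<cdot> c) = q"
    using arg_cong[OF b'(9), of "\<lambda>x. q \<cdot> x"] by simp
  have q': "q \<in> deflations \<A>" "Ker_in \<A> q \<Y>" using q(1) unfolding TFib_\<omega>_def by blast+
  have "is_biproduct \<A> (Dom \<A> (q \<cdot> i)) W P i t r c \<and> ((q \<cdot> i) \<cdot> r) \<oplus> ((q \<cdot> t) \<cdot> c) \<in> deflations \<A>
      \<and> Ker_in \<A> (((q \<cdot> i) \<cdot> r) \<oplus> ((q \<cdot> t) \<cdot> c)) \<Y>"
    unfolding eq using b q' by simp
  moreover have "q \<cdot> t \<in> Hom \<A> W (Cod \<A> (q \<cdot> i))" "q \<cdot> i \<in> Arr \<A>" by (simp_all add: Hom_iff)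
  ultimately show ?thesis using W unfolding Weq_\<omega>_def by blast
qed

lemma Weq_\<omega>E:
  assumes "f \<in> Weq_\<omega> \<A> \<X> \<Y>" "f \<in> Hom \<A> A B"
  obtains W t P i j r c where "W \<in> \<X> \<inter> \<Y>" "t \<in> Hom \<A> W B" "is_biproduct \<A> A W P i j r c"
    "(f \<cdot> r) \<oplus> (t \<cdot> c) \<in> TFib_\<omega> \<A> \<Y>" "(f \<cdot> r) \<oplus> (t \<cdot> c) \<in> Hom \<A> P B" "((f \<cdot> r) \<oplus> (t \<cdot> c)) \<cdot> i = f"
proof -
  note [simp] = assms(2)[unfolded Hom_iff]
  have "Dom \<A> f = A" "Cod \<A> f = B" by simp_all
  then obtain W t P i j r c where h: "W \<in> \<X> \<inter> \<Y>" "t \<in> Hom \<A> W B" "is_biproduct \<A> A W P i j r c"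
    "(f \<cdot> r) \<oplus> (t \<cdot> c) \<in> TFib_\<omega> \<A> \<Y>"
    using assms(1) unfolding Weq_\<omega>_def TFib_\<omega>_def by (smt (verit) mem_Collect_eq)
  note b = biproductD[OF h(3)]
  note [simp] = b(1-4)[unfolded Hom_iff] h(2)[unfolded Hom_iff]
  have "(f \<cdot> r) \<oplus> (t \<cdot> c) \<in> Hom \<A> P B" "((f \<cdot> r) \<oplus> (t \<cdot> c)) \<cdot> i = f"
    by (simp_all add: Hom_iff b(5,8))
  with h show ?thesis by (rule that)
qed

end

locale cotorsion_setting = wic_exact_category \<A>
  for \<A> :: "('o, 'm, 'z) exact_cat_data_scheme" (structure) +
  fixes \<X> \<Y> :: "'o set"
  assumes in_S_C: "(\<X>, \<Y>) \<in> S_C \<A>"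
begin

lemma S_C_conds:
  "cotorsion_pair \<A> \<X> \<Y>" "complete_pair \<A> \<X> \<Y>" "hereditary_pair \<A> \<X> \<Y>"
  "contravariantly_finite \<A> (\<X> \<inter> \<Y>)"
  using in_S_C by (simp_all add: S_C_def)

lemma X_iff: "C \<in> \<X> \<longleftrightarrow> C \<in> Obj \<A> \<and> (\<forall>F \<in> \<Y>. Ext1_vanishes \<A> C F)"
proof -
  have eq: "\<X> = {X \<in> Obj \<A>. \<forall>F \<in> \<Y>. Ext1_vanishes \<A> X F}"
    using S_C_conds(1) unfolding cotorsion_pair_def by (elim conjE)
  show ?thesis by (subst eq) simp
qed

lemma Y_iff: "F \<in> \<Y> \<longleftrightarrow> F \<in> Obj \<A> \<and> (\<forall>C \<in> \<X>. Ext1_vanishes \<A> C F)"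
proof -
  have eq: "\<Y> = {Y \<in> Obj \<A>. \<forall>C \<in> \<X>. Ext1_vanishes \<A> C Y}"
    using S_C_conds(1) unfolding cotorsion_pair_def by (elim conjE)
  show ?thesis by (subst eq) simp
qed

lemma X_Obj: "C \<in> \<X> \<Longrightarrow> C \<in> Obj \<A>" and Y_Obj: "F \<in> \<Y> \<Longrightarrow> F \<in> Obj \<A>"
  using X_iff Y_iff by blast+

lemma ext: "C \<in> \<X> \<Longrightarrow> F \<in> \<Y> \<Longrightarrow> ext_splits C F"
  using Ext1_vanishes_iff[of C F] X_iff[of C] Y_Obj[of F] by blast

text \<open>Taking g to be an identity gives a section of each extension. Phrased as a lifting test,
  the closure properties of \<open>\<X>\<close> reduce to composing and adding lifts.\<close>

lemma X_I:
  assumes C: "C \<in> Obj \<A>"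
    and lift: "\<And>p D E g. p \<in> TFib_\<omega> \<A> \<Y> \<Longrightarrow> p \<in> Hom \<A> D E \<Longrightarrow> g \<in> Hom \<A> C E \<Longrightarrow> \<exists>h \<in> Hom \<A> C D. p \<cdot> h = g"
  shows "C \<in> \<X>"
proof -
  have "ext_splits C F" if F: "F \<in> \<Y>" for F
    unfolding ext_splits_def
  proof (intro allI impI)
    fix i d E assume c: "confl i d F E C"
    show "\<exists>s \<in> Hom \<A> C E. d \<cdot> s = Ident \<A> C"
      by (rule lift[OF TFibI[OF c F] confl_Hom(2)[OF c]]) (simp add: Hom_iff C)
  qed
  then have "\<forall>F \<in> \<Y>. Ext1_vanishes \<A> C F" using Ext1_vanishes_iff[OF C] Y_Obj by blast
  then show ?thesis using X_iff C by blast
qed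

lemma Y_I:
  assumes F: "F \<in> Obj \<A>"
    and ext: "\<And>i c E C. confl i c F E C \<Longrightarrow> C \<in> \<X> \<Longrightarrow> \<exists>r \<in> Hom \<A> E F. r \<cdot> i = Ident \<A> F"
  shows "F \<in> \<Y>"
proof -
  have "ext_splits C F" if C: "C \<in> \<X>" for C
    by (rule ext_splitsI) (rule ext[OF _ C])
  then have "\<forall>C \<in> \<X>. Ext1_vanishes \<A> C F" using Ext1_vanishes_iff[OF _ F] X_Obj by blast
  then show ?thesis using Y_iff F by blast
qed

lemma X_lift:
  assumes "C \<in> \<X>" "p \<in> TFib_\<omega> \<A> \<Y>" "p \<in> Hom \<A> D E" "g \<in> Hom \<A> C E"
  obtains h where "h \<in> Hom \<A> C D" "p \<cdot> h = g"
proof -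
  obtain k F where k: "confl k p F D E" "F \<in> \<Y>" by (rule TFibE[OF assms(2,3)])
  show ?thesis by (rule ext_splits_lift[OF ext[OF assms(1) k(2)] k(1) assms(4)]) (rule that)
qed

lemma Y_extend:
  assumes "F \<in> \<Y>" "confl i c A B C" "C \<in> \<X>" "g \<in> Hom \<A> A F"
  obtains h where "h \<in> Hom \<A> B F" "h \<cdot> i = g"
  by (rule ext_splits_extend[OF ext[OF assms(3,1)] assms(2,4)]) (rule that)

lemma adm_exactE:
  assumes "adm_exact \<A> X Y Z"
  obtains i d where "confl i d X Y Z"
  using assms unfolding adm_exact_def confl_def by blast

lemma X_precover:
  assumes "B \<in> Obj \<A>"
  obtains k p F C where "confl k p F C B" "C \<in> \<X>" "F \<in> \<Y>"
proof -
  obtain F C where "F \<in> \<Y>" "C \<in> \<X>" "adm_exact \<A> F C B"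
    using S_C_conds(2) assms unfolding complete_pair_def by blast
  then show ?thesis using that adm_exactE by metis
qed

lemma Y_preenvelope:
  assumes "B \<in> Obj \<A>"
  obtains i d F C where "confl i d B F C" "C \<in> \<X>" "F \<in> \<Y>"
proof -
  obtain F C where "F \<in> \<Y>" "C \<in> \<X>" "adm_exact \<A> B F C"
    using S_C_conds(2) assms unfolding complete_pair_def by blast
  then show ?thesis using that adm_exactE by metis
qed

lemma Y_cokernel: "confl i d F G Z \<Longrightarrow> F \<in> \<Y> \<Longrightarrow> G \<in> \<Y> \<Longrightarrow> Z \<in> \<Y>"
  using S_C_conds(3) unfolding hereditary_pair_def adm_exact_def confl_def by blast

lemma omega_approx:
  assumes "B \<in> Obj \<A>"
  obtains W t where "W \<in> \<X> \<inter> \<Y>" "t \<in> Hom \<A> W B"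
    "\<And>W' g. W' \<in> \<X> \<inter> \<Y> \<Longrightarrow> g \<in> Hom \<A> W' B \<Longrightarrow> \<exists>h \<in> Hom \<A> W' W. t \<cdot> h = g"
  using S_C_conds(4) assms unfolding contravariantly_finite_def by blast

section \<open>Closure properties of the two classes of a cotorsion pair\<close>

lemma X_retract:
  assumes "C \<in> \<X>" and a: "a \<in> Hom \<A> C' C" and b: "b \<in> Hom \<A> C C'" and ba: "b \<cdot> a = Ident \<A> C'"
  shows "C' \<in> \<X>"
proof (rule X_I)
  note [simp] = a[unfolded Hom_iff] b[unfolded Hom_iff]
  show "C' \<in> Obj \<A>" by simp
  fix p D E g assume p: "p \<in> TFib_\<omega> \<A> \<Y>" "p \<in> Hom \<A> D E" "g \<in> Hom \<A> C' E"
  note [simp] = p(2,3)[unfolded Hom_iff]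
  have gb: "g \<cdot> b \<in> Hom \<A> C E" by (simp add: Hom_iff)
  obtain h where h: "h \<in> Hom \<A> C D" "p \<cdot> h = g \<cdot> b" by (rule X_lift[OF assms(1) p(1,2) gb])
  note [simp] = h(1)[unfolded Hom_iff]
  have "p \<cdot> (h \<cdot> a) = g" by (simp add: Comp_Comp_eq[OF h(2)] ba)
  then show "\<exists>h \<in> Hom \<A> C' D. p \<cdot> h = g" by (intro bexI[of _ "h \<cdot> a"]) (simp_all add: Hom_iff)
qed

lemma Y_retract:
  assumes F: "F \<in> \<Y>" and a: "a \<in> Hom \<A> F' F" and b: "b \<in> Hom \<A> F F'" and ba: "b \<cdot> a = Ident \<A> F'"
  shows "F' \<in> \<Y>"
proof (rule Y_I)
  note [simp] = a[unfolded Hom_iff] b[unfolded Hom_iff]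
  show "F' \<in> Obj \<A>" by simp
  fix i c E C assume i: "confl i c F' E C" "C \<in> \<X>"
  note [simp] = confl_Hom(1)[OF i(1), unfolded Hom_iff]
  obtain h where h: "h \<in> Hom \<A> E F" "h \<cdot> i = a" by (rule Y_extend[OF F i a])
  note [simp] = h(1)[unfolded Hom_iff]
  have "(b \<cdot> h) \<cdot> i = Ident \<A> F'" by (simp add: h(2) ba)
  then show "\<exists>r \<in> Hom \<A> E F'. r \<cdot> i = Ident \<A> F'" by (intro bexI[of _ "b \<cdot> h"]) (simp_all add: Hom_iff)
qed

lemma X_zero: assumes Z: "is_zero_object \<A> Z" shows "Z \<in> \<X>"
proof (rule X_I)
  show [simp]: "Z \<in> Obj \<A>" by (rule zero_object_Obj[OF Z])
  fix p D E g assume p: "p \<in> TFib_\<omega> \<A> \<Y>" "p \<in> Hom \<A> D E" "g \<in> Hom \<A> Z E"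
  note [simp] = p(2,3)[unfolded Hom_iff]
  have "p \<cdot> Zero_Arr \<A> Z D = g" using from_zero_object[OF Z p(3)] by simp
  then show "\<exists>h \<in> Hom \<A> Z D. p \<cdot> h = g" by (intro bexI[of _ "Zero_Arr \<A> Z D"]) (simp_all add: Hom_iff)
qed

lemma Y_zero: assumes Z: "is_zero_object \<A> Z" shows "Z \<in> \<Y>"
proof (rule Y_I)
  show [simp]: "Z \<in> Obj \<A>" by (rule zero_object_Obj[OF Z])
  fix i c E C assume i: "confl i c Z E C"
  note [simp] = confl_Hom(1)[OF i(1), unfolded Hom_iff]
  have "Zero_Arr \<A> E Z \<cdot> i = Ident \<A> Z" using zero_object_Ident[OF Z] by simp
  then show "\<exists>r \<in> Hom \<A> E Z. r \<cdot> i = Ident \<A> Z" by (intro bexI[of _ "Zero_Arr \<A> E Z"]) (simp_all add: Hom_iff)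
qed

lemma X_biproduct:
  assumes b: "is_biproduct \<A> A B P i j q r" and A: "A \<in> \<X>" and B: "B \<in> \<X>"
  shows "P \<in> \<X>"
proof (rule X_I)
  note b' = biproductD[OF b]
  note [simp] = b'(1-4)[unfolded Hom_iff]
  show "P \<in> Obj \<A>" by simp
  fix p D E g assume p: "p \<in> TFib_\<omega> \<A> \<Y>" "p \<in> Hom \<A> D E" "g \<in> Hom \<A> P E"
  note [simp] = p(2,3)[unfolded Hom_iff]
  have g: "g \<cdot> i \<in> Hom \<A> A E" "g \<cdot> j \<in> Hom \<A> B E" by (simp_all add: Hom_iff)
  obtain h where h: "h \<in> Hom \<A> A D" "p \<cdot> h = g \<cdot> i" by (rule X_lift[OF A p(1,2) g(1)])
  obtain k where k: "k \<in> Hom \<A> B D" "p \<cdot> k = g \<cdot> j" by (rule X_lift[OF B p(1,2) g(2)])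
  note [simp] = h(1)[unfolded Hom_iff] k(1)[unfolded Hom_iff]
  have "p \<cdot> (h \<cdot> q \<oplus> k \<cdot> r) = g"
    using arg_cong[OF b'(9), of "\<lambda>x. g \<cdot> x"] by (simp add: Comp_Comp_eq[OF h(2)] Comp_Comp_eq[OF k(2)])
  then show "\<exists>h \<in> Hom \<A> P D. p \<cdot> h = g" by (intro bexI[of _ "h \<cdot> q \<oplus> k \<cdot> r"]) (simp_all add: Hom_iff)
qed

lemma Y_biproduct:
  assumes b: "is_biproduct \<A> A B P i j q r" and A: "A \<in> \<Y>" and B: "B \<in> \<Y>"
  shows "P \<in> \<Y>"
proof (rule Y_I)
  note b' = biproductD[OF b]
  note [simp] = b'(1-4)[unfolded Hom_iff]
  show "P \<in> Obj \<A>" by simp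
  fix m c E C assume m: "confl m c P E C" "C \<in> \<X>"
  note [simp] = confl_Hom(1)[OF m(1), unfolded Hom_iff]
  obtain h where h: "h \<in> Hom \<A> E A" "h \<cdot> m = q" by (rule Y_extend[OF A m b'(3)])
  obtain k where k: "k \<in> Hom \<A> E B" "k \<cdot> m = r" by (rule Y_extend[OF B m b'(4)])
  note [simp] = h(1)[unfolded Hom_iff] k(1)[unfolded Hom_iff]
  have "(i \<cdot> h \<oplus> j \<cdot> k) \<cdot> m = Ident \<A> P" by (simp add: h(2) k(2) b'(9))
  then show "\<exists>r \<in> Hom \<A> E P. r \<cdot> m = Ident \<A> P" by (intro bexI[of _ "i \<cdot> h \<oplus> j \<cdot> k"]) (simp_all add: Hom_iff)
qed

text \<open>A lift is chosen on A and then extended over B by filling the resulting square from i to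
  p, which is possible because the cokernel of i lies in \<open>\<X>\<close>.\<close>

lemma X_extension:
  assumes c: "confl i c A B C" and A: "A \<in> \<X>" and C: "C \<in> \<X>"
  shows "B \<in> \<X>"
proof (rule X_I)
  note [simp] = confl_Hom(1,2)[OF c, unfolded Hom_iff]
  show "B \<in> Obj \<A>" by simp
  fix p D E g assume p: "p \<in> TFib_\<omega> \<A> \<Y>" "p \<in> Hom \<A> D E" "g \<in> Hom \<A> B E"
  note [simp] = p(2,3)[unfolded Hom_iff]
  have g: "g \<cdot> i \<in> Hom \<A> A E" by (simp_all add: Hom_iff)
  obtain u where u: "u \<in> Hom \<A> A D" "p \<cdot> u = g \<cdot> i" by (rule X_lift[OF A p(1,2) g(1)])
  have "has_lifting \<A> i p" by (rule CoFib_TFib_lifting[OF ext CoFibI[OF c C] p(1)])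
  then obtain h where "h \<in> Hom \<A> B D" "h \<cdot> i = u" "p \<cdot> h = g"
    by (rule lift[OF _ u(1) p(3) u(2)[symmetric] confl_Hom(1)[OF c] p(2)])
  then show "\<exists>h \<in> Hom \<A> B D. p \<cdot> h = g" by blast
qed

lemma Y_extension:
  assumes c: "confl k p F D E" and F: "F \<in> \<Y>" and E: "E \<in> \<Y>"
  shows "D \<in> \<Y>"
proof (rule Y_I)
  note [simp] = confl_Hom(1,2)[OF c, unfolded Hom_iff]
  show "D \<in> Obj \<A>" by simp
  fix m c' B C assume m: "confl m c' D B C" "C \<in> \<X>"
  note [simp] = confl_Hom(1)[OF m(1), unfolded Hom_iff]
  have id: "Ident \<A> D \<in> Hom \<A> D D" by (simp add: Hom_iff)
  obtain v where v: "v \<in> Hom \<A> B E" "v \<cdot> m = p" by (rule Y_extend[OF E m confl_Hom(2)[OF c]])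
  have "has_lifting \<A> m p" by (rule CoFib_TFib_lifting[OF ext CoFibI[OF m] TFibI[OF c F]])
  then obtain h where "h \<in> Hom \<A> B D" "h \<cdot> m = Ident \<A> D" "p \<cdot> h = v"
    by (rule lift[OF _ id v(1) _ confl_Hom(1)[OF m(1)] confl_Hom(2)[OF c]]) (simp_all add: v(2))
  then show "\<exists>r \<in> Hom \<A> B D. r \<cdot> m = Ident \<A> D" by blast
qed

text \<open>A lifting problem for C is a square for i with zero top edge; its filler vanishes on A
  and therefore descends to C. Closure of cofibrations under retracts and composition follows
  without computing any cokernel.\<close>

lemma CoFib_of_lifting:
  assumes i: "i \<in> inflations \<A>" and l: "\<And>p. p \<in> TFib_\<omega> \<A> \<Y> \<Longrightarrow> has_lifting \<A> i p"
  shows "i \<in> CoFib_\<omega> \<A> \<X>"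
proof -
  obtain A B where iH: "i \<in> Hom \<A> A B" using Arr_Hom[OF inflation_Arr[OF i]] by blast
  obtain c C where c: "confl i c A B C" by (rule inflationE[OF i iH])
  note [simp] = confl_Hom(1,2)[OF c, unfolded Hom_iff]
  have "C \<in> \<X>"
  proof (rule X_I)
    fix p D E g assume p: "p \<in> TFib_\<omega> \<A> \<Y>" "p \<in> Hom \<A> D E" "g \<in> Hom \<A> C E"
    note [simp] = p(2,3)[unfolded Hom_iff]
    have uv: "Zero_Arr \<A> A D \<in> Hom \<A> A D" "g \<cdot> c \<in> Hom \<A> B E" "(g \<cdot> c) \<cdot> i = p \<cdot> Zero_Arr \<A> A D"
      by (simp_all add: Hom_iff confl_Zero[OF c])
    obtain h where h: "h \<in> Hom \<A> B D" "h \<cdot> i = Zero_Arr \<A> A D" "p \<cdot> h = g \<cdot> c"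
      by (rule lift[OF l[OF p(1)] uv iH p(2)])
    obtain h' where h': "h' \<in> Hom \<A> C D" "h' \<cdot> c = h" by (rule confl_cofactor[OF c h(1,2)])
    note [simp] = h'(1)[unfolded Hom_iff]
    have "p \<cdot> h' = g" by (rule confl_epi[OF c _ p(3)]) (simp_all add: Hom_iff h'(2) h(3))
    then show "\<exists>h \<in> Hom \<A> C D. p \<cdot> h = g" using h'(1) by blast
  qed simp
  then show ?thesis by (rule CoFibI[OF c])
qed

end

section \<open>Weak equivalences as stable equivalences\<close>

text \<open>The ideal divided out in the stable Hom groups. The quotients are never formed: equality
  of stable classes is expressed as \<open>through (x \<oplus> neg y)\<close>.\<close>

definition (in cotorsion_setting) through :: "'m \<Rightarrow> bool" where
  "through h \<longleftrightarrow> (\<exists>W \<in> \<X> \<inter> \<Y>. \<exists>a \<in> Hom \<A> (Dom \<A> h) W. \<exists>b \<in> Hom \<A> W (Cod \<A> h). b \<cdot> a = h)"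

text \<open>The morphisms inducing bijections \<open>Hom(X, A)/\<omega> \<rightarrow> Hom(X, B)/\<omega>\<close> for all \<open>X\<close> in \<open>\<X>\<close>.  They turn out to
  be the weak equivalences, and for them two out of three is immediate.\<close>

definition (in cotorsion_setting) stable_equiv :: "'m \<Rightarrow> bool" where
  "stable_equiv f \<longleftrightarrow> f \<in> Arr \<A> \<and>
     (\<forall>X \<in> \<X>. \<forall>g \<in> Hom \<A> X (Cod \<A> f). \<exists>h \<in> Hom \<A> X (Dom \<A> f). through (g \<oplus> neg (f \<cdot> h))) \<and>
     (\<forall>X \<in> \<X>. \<forall>g \<in> Hom \<A> X (Dom \<A> f). through (f \<cdot> g) \<longrightarrow> through g)"

context cotorsion_setting
begin

lemma throughI:
  assumes "W \<in> \<X> \<inter> \<Y>" "a \<in> Hom \<A> A W" "b \<in> Hom \<A> W B"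
  shows "through (b \<cdot> a)"
proof -
  have "Dom \<A> (b \<cdot> a) = A" "Cod \<A> (b \<cdot> a) = B" using assms(2,3) by (simp_all add: Hom_iff)
  then show ?thesis unfolding through_def using assms by blast
qed

lemma throughE:
  assumes "through h" "h \<in> Hom \<A> A B"
  obtains W a b where "W \<in> \<X> \<inter> \<Y>" "a \<in> Hom \<A> A W" "b \<in> Hom \<A> W B" "b \<cdot> a = h"
proof -
  have "Dom \<A> h = A" "Cod \<A> h = B" using assms(2) by (simp_all add: Hom_iff)
  then show ?thesis using assms(1) that unfolding through_def by blast
qed

lemma through_Comp_left:
  assumes t: "through h" and h: "h \<in> Hom \<A> A B" and g: "g \<in> Hom \<A> B C"
  shows "through (g \<cdot> h)"
proof -
  obtain W a b where w: "W \<in> \<X> \<inter> \<Y>" "a \<in> Hom \<A> A W" "b \<in> Hom \<A> W B" "b \<cdot> a = h" by (rule throughE[OF t h])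
  note [simp] = w(2,3)[unfolded Hom_iff] g[unfolded Hom_iff]
  have "through ((g \<cdot> b) \<cdot> a)" by (rule throughI[OF w(1,2), of _ C]) (simp add: Hom_iff)
  then show ?thesis by (simp add: w(4))
qed

lemma omega_biproduct:
  assumes "is_biproduct \<A> A B P i j q r" "A \<in> \<X> \<inter> \<Y>" "B \<in> \<X> \<inter> \<Y>"
  shows "P \<in> \<X> \<inter> \<Y>"
  using X_biproduct[OF assms(1)] Y_biproduct[OF assms(1)] assms(2,3) by blast

text \<open>The sum factors through the biproduct of the two intermediate objects, which stays in
  \<omega>.\<close>

lemma through_Add:
  assumes t: "through h" "through k" and h: "h \<in> Hom \<A> A B" and k: "k \<in> Hom \<A> A B"
  shows "through (h \<oplus> k)"
proof -
  obtain W a b where w: "W \<in> \<X> \<inter> \<Y>" "a \<in> Hom \<A> A W" "b \<in> Hom \<A> W B" "b \<cdot> a = h" by (rule throughE[OF t(1) h])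
  obtain W' a' b' where w': "W' \<in> \<X> \<inter> \<Y>" "a' \<in> Hom \<A> A W'" "b' \<in> Hom \<A> W' B" "b' \<cdot> a' = k" by (rule throughE[OF t(2) k])
  obtain P i j q r where p: "is_biproduct \<A> W W' P i j q r"
    using biproduct_exists[of W W'] w(1) w'(1) X_Obj by blast
  note p' = biproductD[OF p]
  note [simp] = w(2,3)[unfolded Hom_iff] w'(2,3)[unfolded Hom_iff] p'(1-4)[unfolded Hom_iff]
    h[unfolded Hom_iff] k[unfolded Hom_iff]
  have "through ((b \<cdot> q \<oplus> b' \<cdot> r) \<cdot> (i \<cdot> a \<oplus> j \<cdot> a'))"
    by (rule throughI[OF omega_biproduct[OF p w(1) w'(1)], of _ A _ B]) (simp_all add: Hom_iff)
  then show ?thesis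
    by (simp add: Comp_Comp_eq[OF p'(5)] Comp_Comp_eq[OF p'(6)] Comp_Comp_eq[OF p'(7)] Comp_Comp_eq[OF p'(8)] w(4) w'(4))
qed

lemma through_neg:
  assumes t: "through h" and h: "h \<in> Hom \<A> A B"
  shows "through (neg h)"
proof -
  note [simp] = h[unfolded Hom_iff]
  have "through (neg (Ident \<A> B) \<cdot> h)" by (rule through_Comp_left[OF t h, of _ B]) (simp add: Hom_iff)
  then show ?thesis by simp
qed

lemma through_diff_sym:
  assumes "through (x \<oplus> neg y)" "x \<in> Hom \<A> A B" "y \<in> Hom \<A> A B"
  shows "through (y \<oplus> neg x)"
proof -
  have "through (neg (x \<oplus> neg y))" by (rule through_neg[OF assms(1), of A B]) (use assms(2,3) in \<open>simp add: Hom_iff\<close>)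
  then show ?thesis by (simp add: neg_diff[OF assms(2,3)])
qed

lemma through_diff_trans:
  assumes "through (x \<oplus> neg y)" "through (y \<oplus> neg z)" "x \<in> Hom \<A> A B" "y \<in> Hom \<A> A B" "z \<in> Hom \<A> A B"
  shows "through (x \<oplus> neg z)"
proof -
  note [simp] = assms(3-5)[unfolded Hom_iff]
  have "through ((x \<oplus> neg y) \<oplus> (y \<oplus> neg z))" by (rule through_Add[OF assms(1,2), of A B]) (simp_all add: Hom_iff)
  then show ?thesis by simp
qed

lemma through_diff:
  assumes "through (x \<oplus> neg y)" "through y" "x \<in> Hom \<A> A B" "y \<in> Hom \<A> A B"
  shows "through x"
proof -
  note [simp] = assms(3-4)[unfolded Hom_iff]
  have "through ((x \<oplus> neg y) \<oplus> y)" by (rule through_Add[OF assms(1,2), of A B]) (simp_all add: Hom_iff)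
  then show ?thesis by simp
qed

lemma stable_equivI:
  assumes "f \<in> Hom \<A> A B"
    "\<And>X g. X \<in> \<X> \<Longrightarrow> g \<in> Hom \<A> X B \<Longrightarrow> \<exists>h \<in> Hom \<A> X A. through (g \<oplus> neg (f \<cdot> h))"
    "\<And>X g. X \<in> \<X> \<Longrightarrow> g \<in> Hom \<A> X A \<Longrightarrow> through (f \<cdot> g) \<Longrightarrow> through g"
  shows "stable_equiv f"
proof -
  have "Dom \<A> f = A" "Cod \<A> f = B" "f \<in> Arr \<A>" using assms(1) by (simp_all add: Hom_iff)
  then show ?thesis unfolding stable_equiv_def using assms(2,3) by blast
qed

lemma stable_equiv_surj:
  assumes "stable_equiv f" "f \<in> Hom \<A> A B" "X \<in> \<X>" "g \<in> Hom \<A> X B"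
  obtains h where "h \<in> Hom \<A> X A" "through (g \<oplus> neg (f \<cdot> h))"
proof -
  have "Dom \<A> f = A" "Cod \<A> f = B" using assms(2) by (simp_all add: Hom_iff)
  then show ?thesis using assms(1,3,4) that unfolding stable_equiv_def by blast
qed

lemma stable_equiv_inj:
  assumes "stable_equiv f" "f \<in> Hom \<A> A B" "X \<in> \<X>" "g \<in> Hom \<A> X A" "through (f \<cdot> g)"
  shows "through g"
proof -
  have "Dom \<A> f = A" "Cod \<A> f = B" using assms(2) by (simp_all add: Hom_iff)
  then show ?thesis using assms(1,3,4,5) unfolding stable_equiv_def by blast
qed

section \<open>Two out of three and retracts for stable equivalences\<close>

lemma stable_equiv_Comp:
  assumes f: "stable_equiv f" "f \<in> Hom \<A> A B" and g: "stable_equiv g" "g \<in> Hom \<A> B C"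
  shows "stable_equiv (g \<cdot> f)"
proof (rule stable_equivI)
  note [simp] = f(2)[unfolded Hom_iff] g(2)[unfolded Hom_iff]
  show "g \<cdot> f \<in> Hom \<A> A C" by (simp add: Hom_iff)
  fix X x assume X: "X \<in> \<X>" and x: "x \<in> Hom \<A> X C"
  note [simp] = x[unfolded Hom_iff]
  obtain y where y: "y \<in> Hom \<A> X B" "through (x \<oplus> neg (g \<cdot> y))" by (rule stable_equiv_surj[OF g X x])
  obtain z where z: "z \<in> Hom \<A> X A" "through (y \<oplus> neg (f \<cdot> z))" by (rule stable_equiv_surj[OF f X y(1)])
  note [simp] = y(1)[unfolded Hom_iff] z(1)[unfolded Hom_iff]
  have "through (g \<cdot> (y \<oplus> neg (f \<cdot> z)))" by (rule through_Comp_left[OF z(2) _ g(2), of X]) (simp add: Hom_iff)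
  then have "through ((g \<cdot> y) \<oplus> neg (g \<cdot> (f \<cdot> z)))" by simp
  then have "through (x \<oplus> neg (g \<cdot> (f \<cdot> z)))" by (rule through_diff_trans[OF y(2), of _ X C]) (simp_all add: Hom_iff)
  then show "\<exists>h \<in> Hom \<A> X A. through (x \<oplus> neg ((g \<cdot> f) \<cdot> h))" by (intro bexI[OF _ z(1)]) simp
next
  note [simp] = f(2)[unfolded Hom_iff] g(2)[unfolded Hom_iff]
  fix X x assume X: "X \<in> \<X>" and x: "x \<in> Hom \<A> X A" and t: "through ((g \<cdot> f) \<cdot> x)"
  note [simp] = x[unfolded Hom_iff]
  have "through (f \<cdot> x)" by (rule stable_equiv_inj[OF g X]) (use t in \<open>simp_all add: Hom_iff\<close>)
  then show "through x" by (rule stable_equiv_inj[OF f X x])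
qed

lemma stable_equiv_cancel_right:
  assumes f: "stable_equiv f" "f \<in> Hom \<A> A B" and g: "g \<in> Hom \<A> B C" and gf: "stable_equiv (g \<cdot> f)"
  shows "stable_equiv g"
proof (rule stable_equivI[OF g])
  note [simp] = f(2)[unfolded Hom_iff] g[unfolded Hom_iff]
  have gfH: "g \<cdot> f \<in> Hom \<A> A C" by (simp add: Hom_iff)
  { fix X x assume X: "X \<in> \<X>" and x: "x \<in> Hom \<A> X C"
    obtain z where z: "z \<in> Hom \<A> X A" "through (x \<oplus> neg ((g \<cdot> f) \<cdot> z))" by (rule stable_equiv_surj[OF gf gfH X x])
    note [simp] = z(1)[unfolded Hom_iff]
    show "\<exists>h \<in> Hom \<A> X B. through (x \<oplus> neg (g \<cdot> h))"
      by (rule bexI[of _ "f \<cdot> z"]) (use z(2) in \<open>simp_all add: Hom_iff\<close>) }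
  fix X y assume X: "X \<in> \<X>" and y: "y \<in> Hom \<A> X B" and t: "through (g \<cdot> y)"
  \<comment> \<open>Modulo \<omega> every y comes from A by stable surjectivity of f, which reduces
    injectivity of g to injectivity of \<open>g \<cdot> f\<close>.\<close>
  obtain z where z: "z \<in> Hom \<A> X A" "through (y \<oplus> neg (f \<cdot> z))" by (rule stable_equiv_surj[OF f X y(1)])
  note [simp] = y(1)[unfolded Hom_iff] z(1)[unfolded Hom_iff]
  have "through (g \<cdot> ((f \<cdot> z) \<oplus> neg y))"
    by (rule through_Comp_left[OF through_diff_sym[OF z(2), of X B] _ g, of X]) (simp_all add: Hom_iff)
  then have "through ((g \<cdot> (f \<cdot> z)) \<oplus> neg (g \<cdot> y))" by simp
  from through_diff[OF this t, of X C] have "through ((g \<cdot> f) \<cdot> z)" by (simp add: Hom_iff)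
  then have "through z" by (rule stable_equiv_inj[OF gf gfH X z(1)])
  then have "through (f \<cdot> z)" by (rule through_Comp_left[OF _ z(1) f(2)])
  then show "through y" by (rule through_diff[OF z(2), of X B]) (simp_all add: Hom_iff)
qed

lemma stable_equiv_cancel_left:
  assumes f: "f \<in> Hom \<A> A B" and g: "stable_equiv g" "g \<in> Hom \<A> B C" and gf: "stable_equiv (g \<cdot> f)"
  shows "stable_equiv f"
proof (rule stable_equivI[OF f])
  note [simp] = f[unfolded Hom_iff] g(2)[unfolded Hom_iff]
  have gfH: "g \<cdot> f \<in> Hom \<A> A C" by (simp add: Hom_iff)
  { fix X y assume X: "X \<in> \<X>" and y: "y \<in> Hom \<A> X B"
    note [simp] = y[unfolded Hom_iff]
    have gy: "g \<cdot> y \<in> Hom \<A> X C" by (simp add: Hom_iff)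
    obtain z where z: "z \<in> Hom \<A> X A" "through ((g \<cdot> y) \<oplus> neg ((g \<cdot> f) \<cdot> z))" by (rule stable_equiv_surj[OF gf gfH X gy])
    note [simp] = z(1)[unfolded Hom_iff]
    have "through (y \<oplus> neg (f \<cdot> z))"
      by (rule stable_equiv_inj[OF g X]) (use z(2) in \<open>simp_all add: Hom_iff\<close>)
    then show "\<exists>h \<in> Hom \<A> X A. through (y \<oplus> neg (f \<cdot> h))" using z(1) by blast }
  fix X x assume X: "X \<in> \<X>" and x: "x \<in> Hom \<A> X A" and t: "through (f \<cdot> x)"
  note [simp] = x[unfolded Hom_iff]
  have "through (g \<cdot> (f \<cdot> x))" by (rule through_Comp_left[OF t _ g(2), of X]) (simp add: Hom_iff)
  then have "through ((g \<cdot> f) \<cdot> x)" by simp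
  then show "through x" by (rule stable_equiv_inj[OF gf gfH X x])
qed

lemma stable_equiv_retract:
  assumes fg: "is_retract_of \<A> f g" and g: "stable_equiv g"
  shows "stable_equiv f"
proof -
  have "f \<in> Arr \<A>" "g \<in> Arr \<A>" using fg by (auto simp: is_retract_of_def)
  then obtain A B A' B' where fH: "f \<in> Hom \<A> A B" and gH: "g \<in> Hom \<A> A' B'" using Arr_Hom by metis
  obtain s r s' r' where
    h: "s \<in> Hom \<A> A A'" "r \<in> Hom \<A> A' A" "s' \<in> Hom \<A> B B'" "r' \<in> Hom \<A> B' B"
    and e: "r \<cdot> s = Ident \<A> A" "r' \<cdot> s' = Ident \<A> B" "g \<cdot> s = s' \<cdot> f" "f \<cdot> r = r' \<cdot> g"
    by (rule retract_ofE[OF fg fH gH])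
  note [simp] = h[unfolded Hom_iff] fH[unfolded Hom_iff] gH[unfolded Hom_iff]
  show ?thesis
  proof (rule stable_equivI[OF fH])
    fix X y assume X: "X \<in> \<X>" and y: "y \<in> Hom \<A> X B"
    note [simp] = y[unfolded Hom_iff]
    have sy: "s' \<cdot> y \<in> Hom \<A> X B'" by (simp add: Hom_iff)
    obtain z where z: "z \<in> Hom \<A> X A'" "through ((s' \<cdot> y) \<oplus> neg (g \<cdot> z))" by (rule stable_equiv_surj[OF g gH X sy])
    note [simp] = z(1)[unfolded Hom_iff]
    have "through (r' \<cdot> ((s' \<cdot> y) \<oplus> neg (g \<cdot> z)))" by (rule through_Comp_left[OF z(2) _ h(4), of X]) (simp add: Hom_iff)
    then have "through (y \<oplus> neg (f \<cdot> (r \<cdot> z)))" by (simp add: Comp_Comp_eq[OF e(2)] Comp_Comp_eq[OF e(4)])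
    then show "\<exists>h \<in> Hom \<A> X A. through (y \<oplus> neg (f \<cdot> h))" by (intro bexI[of _ "r \<cdot> z"]) (simp_all add: Hom_iff)
  next
    fix X x assume X: "X \<in> \<X>" and x: "x \<in> Hom \<A> X A" and t: "through (f \<cdot> x)"
    note [simp] = x[unfolded Hom_iff]
    have "through (s' \<cdot> (f \<cdot> x))" by (rule through_Comp_left[OF t _ h(3), of X]) (simp add: Hom_iff)
    then have "through (g \<cdot> (s \<cdot> x))" by (simp add: Comp_Comp_eq[OF e(3)])
    then have "through (s \<cdot> x)" by (intro stable_equiv_inj[OF g gH X, of "s \<cdot> x"]) (simp_all add: Hom_iff)
    then have "through (r \<cdot> (s \<cdot> x))" by (rule through_Comp_left[OF _ _ h(2), of _ X]) (simp add: Hom_iff)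
    then show "through x" by (simp add: Comp_Comp_eq[OF e(1)])
  qed
qed

text \<open>Surjectivity: a morphism from an object of \<open>\<X>\<close> lifts along \<phi> = (f,
  t), and the W-component of the lift is the error through \<omega>. Injectivity: a morphism that
  becomes stably zero in B can be corrected by one through \<omega> so as to land in the kernel M,
  and morphisms from \<open>\<X>\<close> to M factor through \<omega>.\<close>

lemma Weq_\<omega>_stable_equiv:
  assumes f: "f \<in> Weq_\<omega> \<A> \<X> \<Y>" "f \<in> Hom \<A> A B"
  shows "stable_equiv f"
proof -
  obtain W t P i j r c where W: "W \<in> \<X> \<inter> \<Y>" and t: "t \<in> Hom \<A> W B" and b: "is_biproduct \<A> A W P i j r c"
    and ph: "(f \<cdot> r) \<oplus> (t \<cdot> c) \<in> TFib_\<omega> \<A> \<Y>" "(f \<cdot> r) \<oplus> (t \<cdot> c) \<in> Hom \<A> P B" "((f \<cdot> r) \<oplus> (t \<cdot> c)) \<cdot> i = f"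
    by (rule Weq_\<omega>E[OF f])
  define \<phi> where "\<phi> = (f \<cdot> r) \<oplus> (t \<cdot> c)"
  note p = ph[folded \<phi>_def]
  obtain m M where m: "confl m \<phi> M P B" "M \<in> \<Y>" by (rule TFibE[OF p(1,2)])
  note b' = biproductD[OF b]
  note [simp] = b'(1-4)[unfolded Hom_iff] f(2)[unfolded Hom_iff] t[unfolded Hom_iff] p(2)[unfolded Hom_iff]
    confl_Hom(1)[OF m(1), unfolded Hom_iff]
  show ?thesis
  proof (rule stable_equivI[OF f(2)])
    fix X g assume X: "X \<in> \<X>" and g: "g \<in> Hom \<A> X B"
    obtain h where h: "h \<in> Hom \<A> X P" "\<phi> \<cdot> h = g" by (rule X_lift[OF X p(1,2) g])
    note [simp] = h(1)[unfolded Hom_iff]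
    have "g \<oplus> neg (f \<cdot> (r \<cdot> h)) = t \<cdot> (c \<cdot> h)" unfolding h(2)[symmetric] \<phi>_def by simp
    moreover have "through (t \<cdot> (c \<cdot> h))" by (rule throughI[OF W _ t, of _ X]) (simp add: Hom_iff)
    ultimately have "through (g \<oplus> neg (f \<cdot> (r \<cdot> h)))" by (simp only:)
    then show "\<exists>h \<in> Hom \<A> X A. through (g \<oplus> neg (f \<cdot> h))" by (rule bexI) (simp add: Hom_iff)
  next
    fix X g assume X: "X \<in> \<X>" and g: "g \<in> Hom \<A> X A" and fg: "through (f \<cdot> g)"
    note [simp] = g[unfolded Hom_iff]
    have fgH: "f \<cdot> g \<in> Hom \<A> X B" by (simp add: Hom_iff)
    obtain V a q where V: "V \<in> \<X> \<inter> \<Y>" "a \<in> Hom \<A> X V" "q \<in> Hom \<A> V B" "q \<cdot> a = f \<cdot> g" by (rule throughE[OF fg fgH])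
    obtain q' where q': "q' \<in> Hom \<A> V P" "\<phi> \<cdot> q' = q" using X_lift[OF _ p(1,2) V(3)] V(1) by blast
    note [simp] = V(2)[unfolded Hom_iff] q'(1)[unfolded Hom_iff]
    \<comment> \<open>Both terms have the image \<open>f \<cdot> g\<close> under \<phi>, so their
      difference lands in the kernel M.\<close>
    define d where "d = i \<cdot> g \<oplus> neg (q' \<cdot> a)"
    have dH: "d \<in> Hom \<A> X P" unfolding d_def by (simp add: Hom_iff)
    have d0: "\<phi> \<cdot> d = Zero_Arr \<A> X B" unfolding d_def by (simp add: Comp_Comp_eq[OF q'(2)] Comp_Comp_eq[OF p(3)] V(4))
    obtain n where n: "n \<in> Hom \<A> X M" "m \<cdot> n = d" by (rule confl_factor[OF m(1) dH d0])
    obtain w w' Y' X' where w: "confl w w' X Y' X'" "X' \<in> \<X>" "Y' \<in> \<Y>" by (rule Y_preenvelope[OF X_Obj[OF X]])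
    \<comment> \<open>The special preenvelope of an object of \<open>\<X>\<close> is an extension of
      objects of \<open>\<X>\<close>, so it lies in \<omega>; hence every morphism from X to an
      object of \<open>\<Y>\<close> factors through \<omega>.\<close>
    have Y': "Y' \<in> \<X> \<inter> \<Y>" using X_extension[OF w(1) X w(2)] w(3) by blast
    obtain n' where n': "n' \<in> Hom \<A> Y' M" "n' \<cdot> w = n" by (rule Y_extend[OF m(2) w(1,2) n(1)])
    have "through n" unfolding n'(2)[symmetric] by (rule throughI[OF Y' confl_Hom(1)[OF w(1)] n'(1)])
    then have "through d" unfolding n(2)[symmetric] by (rule through_Comp_left[OF _ n(1) confl_Hom(1)[OF m(1)]])
    then have "through (i \<cdot> g \<oplus> neg (q' \<cdot> a))" unfolding d_def .
    moreover have "through (q' \<cdot> a)" by (rule throughI[OF V(1,2) q'(1)])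
    ultimately have "through (i \<cdot> g)" by (rule through_diff[of _ _ X P]) (simp_all add: Hom_iff)
    then have "through (r \<cdot> (i \<cdot> g))" by (rule through_Comp_left[OF _ _ b'(3), of _ X]) (simp add: Hom_iff)
    then show "through g" by (simp add: Comp_Comp_eq[OF b'(5)])
  qed
qed

text \<open>With a special precover \<open>Y\<^sub>1 \<rightarrow> X\<^sub>1 \<rightarrow> K\<close> and a special preenvelope \<open>X\<^sub>1 \<rightarrow> V\<close>, the cokernel of \<open>Y\<^sub>1 \<rightarrow> V\<close> lies
  in \<open>\<Y>\<close> by heredity and contains \<open>K\<close> as a retract as soon as \<open>X\<^sub>1 \<rightarrow> K\<close> extends over \<open>V\<close>.\<close>

lemma Y_of_extension:
  assumes K: "K \<in> Obj \<A>"
    and ext: "\<And>X V X' w d x. confl w d X V X' \<Longrightarrow> X \<in> \<X> \<Longrightarrow> V \<in> \<Y> \<Longrightarrow> X' \<in> \<X> \<Longrightarrow> x \<in> Hom \<A> X K \<Longrightarrow>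
      \<exists>y \<in> Hom \<A> V K. y \<cdot> w = x"
  shows "K \<in> \<Y>"
proof -
  obtain k x Y1 X1 where x: "confl k x Y1 X1 K" "X1 \<in> \<X>" "Y1 \<in> \<Y>" by (rule X_precover[OF K])
  obtain w d V X2 where w: "confl w d X1 V X2" "X2 \<in> \<X>" "V \<in> \<Y>" by (rule Y_preenvelope[OF X_Obj[OF x(2)]])
  obtain y where y: "y \<in> Hom \<A> V K" "y \<cdot> w = x" using ext[OF w(1) x(2) w(3,2) confl_Hom(2)[OF x(1)]] by blast
  note [simp] = confl_Hom(1,2)[OF x(1), unfolded Hom_iff] confl_Hom(1,2)[OF w(1), unfolded Hom_iff] y(1)[unfolded Hom_iff]
  have "w \<cdot> k \<in> inflations \<A>" by (rule inflation_Comp[OF confl_inflation[OF x(1)] confl_inflation[OF w(1)]]) simp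
  moreover have "w \<cdot> k \<in> Hom \<A> Y1 V" by (simp add: Hom_iff)
  ultimately obtain q G where q: "confl (w \<cdot> k) q Y1 V G" by (rule inflationE)
  note [simp] = confl_Hom(2)[OF q, unfolded Hom_iff]
  have "y \<cdot> (w \<cdot> k) = Zero_Arr \<A> Y1 K" by (simp add: Comp_Comp_eq[OF y(2)] confl_Zero[OF x(1)])
  then obtain y' where y': "y' \<in> Hom \<A> G K" "y' \<cdot> q = y" by (rule confl_cofactor[OF q y(1)])
  have "(q \<cdot> w) \<cdot> k = Zero_Arr \<A> Y1 G" using confl_Zero[OF q] by simp
  moreover have "q \<cdot> w \<in> Hom \<A> X1 G" by (simp add: Hom_iff)
  ultimately obtain z where z: "z \<in> Hom \<A> K G" "z \<cdot> x = q \<cdot> w" using confl_cofactor[OF x(1)] by metis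
  note [simp] = y'(1)[unfolded Hom_iff] z(1)[unfolded Hom_iff]
  have "y' \<cdot> z = Ident \<A> K"
    by (rule confl_epi[OF x(1), of _ K]) (simp_all add: Hom_iff z(2) Comp_Comp_eq[OF y'(2)] y(2))
  then show ?thesis by (rule Y_retract[OF Y_cokernel[OF q x(3) w(3)] z(1) y'(1)])
qed

text \<open>With t an \<omega>-approximation of B, the morphism \<phi> = (f, t) absorbs the errors
  allowed by stable surjectivity, so objects of \<open>\<X>\<close> lift along \<phi> exactly. A
  special precover then shows that \<phi> is a deflation, and stable injectivity feeds
  \<open>Y_of_extension\<close> for its kernel.\<close>

lemma stable_equiv_Weq_\<omega>:
  assumes f: "stable_equiv f" "f \<in> Hom \<A> A B"
  shows "f \<in> Weq_\<omega> \<A> \<X> \<Y>"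
proof -
  note [simp] = f(2)[unfolded Hom_iff]
  have B: "B \<in> Obj \<A>" by simp
  obtain W t where W: "W \<in> \<X> \<inter> \<Y>" and t: "t \<in> Hom \<A> W B"
    and ta: "\<And>W' g. W' \<in> \<X> \<inter> \<Y> \<Longrightarrow> g \<in> Hom \<A> W' B \<Longrightarrow> \<exists>h \<in> Hom \<A> W' W. t \<cdot> h = g"
    using omega_approx[OF B] by metis
  note [simp] = t[unfolded Hom_iff]
  obtain P i j r c where b: "is_biproduct \<A> A W P i j r c" using biproduct_exists[of A W] by auto
  note b' = biproductD[OF b]
  note [simp] = b'(1-4)[unfolded Hom_iff]
  define \<phi> where "\<phi> = (f \<cdot> r) \<oplus> (t \<cdot> c)"
  have p: "\<phi> \<in> Hom \<A> P B" and pi: "\<phi> \<cdot> i = f" and pj: "\<phi> \<cdot> j = t" unfolding \<phi>_def by (simp_all add: Hom_iff b'(5-8))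
  note [simp] = p[unfolded Hom_iff]
  have lift: "\<exists>h \<in> Hom \<A> X P. \<phi> \<cdot> h = g" if X: "X \<in> \<X>" and g: "g \<in> Hom \<A> X B" for X g
  proof -
    note [simp] = g[unfolded Hom_iff]
    obtain h where h: "h \<in> Hom \<A> X A" "through (g \<oplus> neg (f \<cdot> h))" by (rule stable_equiv_surj[OF f X g])
    note [simp] = h(1)[unfolded Hom_iff]
    obtain V a q where V: "V \<in> \<X> \<inter> \<Y>" "a \<in> Hom \<A> X V" "q \<in> Hom \<A> V B" "q \<cdot> a = g \<oplus> neg (f \<cdot> h)"
      by (rule throughE[OF h(2), of X B]) (simp add: Hom_iff)
    \<comment> \<open>The error of the stable lift passes through V in \<omega>, hence through t,
      and becomes the W-component of an exact lift.\<close>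
    obtain q' where q': "q' \<in> Hom \<A> V W" "t \<cdot> q' = q" using ta[OF V(1,3)] by blast
    note [simp] = V(2)[unfolded Hom_iff] q'(1)[unfolded Hom_iff]
    have "\<phi> \<cdot> (i \<cdot> h \<oplus> j \<cdot> (q' \<cdot> a)) = g"
      by (simp add: Comp_Comp_eq[OF pi] Comp_Comp_eq[OF pj] Comp_Comp_eq[OF q'(2)] V(4))
    then show ?thesis by (rule bexI) (simp add: Hom_iff)
  qed
  obtain k0 p0 F0 C0 where p0: "confl k0 p0 F0 C0 B" "C0 \<in> \<X>" by (rule X_precover[OF B])
  obtain h0 where h0: "h0 \<in> Hom \<A> C0 P" "\<phi> \<cdot> h0 = p0" using lift[OF p0(2) confl_Hom(2)[OF p0(1)]] by blast
  \<comment> \<open>The deflation p0 factors through \<phi>, so the cancellation property of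
    deflations applies.\<close>
  have "\<phi> \<in> deflations \<A>"
    by (rule deflation_Comp_cancel[OF h0(1) p]) (simp add: h0(2) confl_deflation[OF p0(1)])
  then obtain k K where k: "confl k \<phi> K P B" using p by (rule deflationE)
  note [simp] = confl_Hom(1)[OF k, unfolded Hom_iff]
  have "K \<in> \<Y>"
  proof (rule Y_of_extension)
    fix X V X2 w d x
    assume w: "confl w d X V X2" and X: "X \<in> \<X>" and V: "V \<in> \<Y>" and X2: "X2 \<in> \<X>" and x: "x \<in> Hom \<A> X K"
    note [simp] = confl_Hom(1,2)[OF w, unfolded Hom_iff] x[unfolded Hom_iff]
    have kxH: "k \<cdot> x \<in> Hom \<A> X P" by (simp add: Hom_iff)
    have th1: "through (t \<cdot> (c \<cdot> (k \<cdot> x)))" by (rule throughI[OF W _ t, of _ X]) (simp add: Hom_iff)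
    have "\<phi> \<cdot> (k \<cdot> x) = Zero_Arr \<A> X B" by (simp add: Comp_Comp_eq[OF confl_Zero[OF k]])
    then have "t \<cdot> (c \<cdot> (k \<cdot> x)) \<oplus> f \<cdot> (r \<cdot> (k \<cdot> x)) = Zero_Arr \<A> X B"
      unfolding \<phi>_def by (subst Add_commute) simp_all
    then have "f \<cdot> (r \<cdot> (k \<cdot> x)) = neg (t \<cdot> (c \<cdot> (k \<cdot> x)))" by (intro neg_unique[of _ X B]) (simp_all add: Hom_iff)
    moreover have "through (neg (t \<cdot> (c \<cdot> (k \<cdot> x))))" by (rule through_neg[OF th1, of X B]) (simp add: Hom_iff)
    ultimately have "through (f \<cdot> (r \<cdot> (k \<cdot> x)))" by (simp only:)
    \<comment> \<open>The two components of \<open>k \<cdot> x\<close> cancel in B and one of them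
      passes through W, so the A-component is stably zero in B, hence already in A.\<close>
    then have "through (r \<cdot> (k \<cdot> x))" by (intro stable_equiv_inj[OF f X, of "r \<cdot> (k \<cdot> x)"]) (simp_all add: Hom_iff)
    then have "through (i \<cdot> (r \<cdot> (k \<cdot> x)))" by (rule through_Comp_left[OF _ _ b'(1), of _ X]) (simp add: Hom_iff)
    moreover have "through (j \<cdot> (c \<cdot> (k \<cdot> x)))" by (rule throughI[OF W _ b'(2), of _ X]) (simp add: Hom_iff)
    ultimately have "through (i \<cdot> (r \<cdot> (k \<cdot> x)) \<oplus> j \<cdot> (c \<cdot> (k \<cdot> x)))"
      by (rule through_Add[of _ _ X P]) (simp_all add: Hom_iff)
    then have "through (k \<cdot> x)" by (simp only: biproduct_decomp[OF b kxH, symmetric])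
    then obtain U a q where U: "U \<in> \<X> \<inter> \<Y>" "a \<in> Hom \<A> X U" "q \<in> Hom \<A> U P" "q \<cdot> a = k \<cdot> x" by (rule throughE[OF _ kxH])
    obtain a' where a': "a' \<in> Hom \<A> V U" "a' \<cdot> w = a" using Y_extend[OF _ w X2 U(2)] U(1) by blast
    note [simp] = U(3)[unfolded Hom_iff] a'(1)[unfolded Hom_iff]
    define H where "H = q \<cdot> a'"
    have H: "H \<in> Hom \<A> V P" "H \<cdot> w = k \<cdot> x" unfolding H_def by (simp_all add: Hom_iff a'(2) U(4))
    note [simp] = H(1)[unfolded Hom_iff]
    \<comment> \<open>H extends \<open>k \<cdot> x\<close> but need not land in K. Its image in B
      vanishes on X, hence factors over X2, which lies in \<open>\<X>\<close>; subtracting a lift of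
      that factor moves H into K without changing its restriction to X.\<close>
    have "(\<phi> \<cdot> H) \<cdot> w = Zero_Arr \<A> X B" by (simp add: H(2) Comp_Comp_eq[OF confl_Zero[OF k]])
    moreover have "\<phi> \<cdot> H \<in> Hom \<A> V B" by (simp add: Hom_iff)
    ultimately obtain g where g: "g \<in> Hom \<A> X2 B" "g \<cdot> d = \<phi> \<cdot> H" using confl_cofactor[OF w] by metis
    obtain l where l: "l \<in> Hom \<A> X2 P" "\<phi> \<cdot> l = g" using lift[OF X2 g(1)] by blast
    note [simp] = l(1)[unfolded Hom_iff]
    have "\<phi> \<cdot> (H \<oplus> neg (l \<cdot> d)) = Zero_Arr \<A> V B" by (simp add: Comp_Comp_eq[OF l(2)] g(2))
    moreover have "H \<oplus> neg (l \<cdot> d) \<in> Hom \<A> V P" by (simp add: Hom_iff)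
    ultimately obtain y where y: "y \<in> Hom \<A> V K" "k \<cdot> y = H \<oplus> neg (l \<cdot> d)" using confl_factor[OF k] by metis
    note [simp] = y(1)[unfolded Hom_iff]
    have "y \<cdot> w = x"
      by (rule confl_mono[OF k, of _ X]) (simp_all add: Hom_iff Comp_Comp_eq[OF y(2)] H(2) confl_Zero[OF w])
    then show "\<exists>y \<in> Hom \<A> V K. y \<cdot> w = x" using y(1) by blast
  qed simp
  then have "\<phi> \<in> TFib_\<omega> \<A> \<Y>" by (rule TFibI[OF k])
  then have "\<phi> \<cdot> i \<in> Weq_\<omega> \<A> \<X> \<Y>" by (rule Weq_\<omega>I[OF b W _ p])
  then show ?thesis by (simp add: pi)
qed

lemma Weq_\<omega>_iff: "f \<in> Weq_\<omega> \<A> \<X> \<Y> \<longleftrightarrow> stable_equiv f"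
proof -
  have "f \<in> Arr \<A>" if "f \<in> Weq_\<omega> \<A> \<X> \<Y> \<or> stable_equiv f"
    using that unfolding Weq_\<omega>_def stable_equiv_def by blast
  then show ?thesis using Weq_\<omega>_stable_equiv[OF _ Arr_Hom] stable_equiv_Weq_\<omega>[OF _ Arr_Hom] by blast
qed

end

section \<open>The model structure of a cotorsion pair\<close>

context cotorsion_setting
begin

lemma Ident_TFib: "X \<in> Obj \<A> \<Longrightarrow> Ident \<A> X \<in> TFib_\<omega> \<A> \<Y>"
  using zero_object_exists TFibI[OF zero_object_confl Y_zero] by blast

lemma split_TCoFib:
  assumes b: "is_biproduct \<A> A W B i t r c" and W: "W \<in> \<X> \<inter> \<Y>"
  shows "i \<in> CoFib_\<omega> \<A> \<X> \<inter> Weq_\<omega> \<A> \<X> \<Y>"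
proof
  note [simp] = biproductD(1)[OF b, unfolded Hom_iff]
  show "i \<in> CoFib_\<omega> \<A> \<X>" by (rule CoFibI[OF biproduct_confl[OF b]]) (use W in simp)
  have "Ident \<A> B \<cdot> i \<in> Weq_\<omega> \<A> \<X> \<Y>"
    by (rule Weq_\<omega>I[OF b W Ident_TFib Ident_in_Hom]) simp_all
  then show "i \<in> Weq_\<omega> \<A> \<X> \<Y>" by simp
qed

lemma TFib_sub:
  assumes q: "q \<in> TFib_\<omega> \<A> \<Y>"
  shows "q \<in> Fib_\<omega> \<A> \<X> \<Y> \<inter> Weq_\<omega> \<A> \<X> \<Y>"
proof
  obtain D E where qH: "q \<in> Hom \<A> D E" using Arr_Hom[OF TFib_Arr[OF q]] by blast
  note [simp] = qH[unfolded Hom_iff]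
  have "\<exists>h \<in> Hom \<A> W D. q \<cdot> h = g" if "W \<in> \<X> \<inter> \<Y>" "g \<in> Hom \<A> W E" for W g
    using X_lift[OF _ q qH that(2)] that(1) by blast
  then show "q \<in> Fib_\<omega> \<A> \<X> \<Y>" unfolding Fib_\<omega>_def by simp
  obtain Z where Z: "is_zero_object \<A> Z" using zero_object_exists by blast
  have "q \<cdot> Ident \<A> D \<in> Weq_\<omega> \<A> \<X> \<Y>"
    by (rule Weq_\<omega>I[OF zero_object_biproduct[OF Z] _ q qH]) (use X_zero[OF Z] Y_zero[OF Z] in simp_all)
  then show "q \<in> Weq_\<omega> \<A> \<X> \<Y>" by simp
qed

text \<open>As f is in \<open>Fib_\<omega>\<close>, the morphism t factors as f s, so (f, t) equals
  f e with e split by i. Hence f is a deflation by cancellation, and its kernel is a retract of the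
  kernel of (f, t).\<close>

lemma Fib_Weq_TFib:
  assumes f: "f \<in> Fib_\<omega> \<A> \<X> \<Y>" "f \<in> Weq_\<omega> \<A> \<X> \<Y>"
  shows "f \<in> TFib_\<omega> \<A> \<Y>"
proof -
  have "f \<in> Arr \<A>" using f(1) unfolding Fib_\<omega>_def by blast
  then obtain A B where fH: "f \<in> Hom \<A> A B" using Arr_Hom by blast
  obtain W t P i j r c where W: "W \<in> \<X> \<inter> \<Y>" and t: "t \<in> Hom \<A> W B" and b: "is_biproduct \<A> A W P i j r c"
    and ph: "(f \<cdot> r) \<oplus> (t \<cdot> c) \<in> TFib_\<omega> \<A> \<Y>" "(f \<cdot> r) \<oplus> (t \<cdot> c) \<in> Hom \<A> P B" "((f \<cdot> r) \<oplus> (t \<cdot> c)) \<cdot> i = f"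
    by (rule Weq_\<omega>E[OF f(2) fH])
  obtain s where s: "s \<in> Hom \<A> W A" "f \<cdot> s = t" by (rule Fib_\<omega>_lift[OF f(1) fH W t])
  note b' = biproductD[OF b]
  note [simp] = b'(1-4)[unfolded Hom_iff] fH[unfolded Hom_iff] t[unfolded Hom_iff] s(1)[unfolded Hom_iff]
  define e where "e = r \<oplus> s \<cdot> c"
  have e: "e \<in> Hom \<A> P A" unfolding e_def by (simp add: Hom_iff)
  note [simp] = e[unfolded Hom_iff]
  have fe: "f \<cdot> e = (f \<cdot> r) \<oplus> (t \<cdot> c)" unfolding e_def by (simp add: Comp_Comp_eq[OF s(2)])
  note p = ph(1,2)[folded fe]
  obtain m M where m: "confl m (f \<cdot> e) M P B" "M \<in> \<Y>" by (rule TFibE[OF p])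
  have "f \<in> deflations \<A>" by (rule deflation_Comp_cancel[OF e fH confl_deflation[OF m(1)]])
  then obtain k K where k: "confl k f K A B" using fH by (rule deflationE)
  note [simp] = confl_Hom(1)[OF k, unfolded Hom_iff] confl_Hom(1)[OF m(1), unfolded Hom_iff]
  have ei: "e \<cdot> i = Ident \<A> A" unfolding e_def by (simp add: b'(5,8))
  have "(f \<cdot> e) \<cdot> (i \<cdot> k) = Zero_Arr \<A> K B" by (simp add: Comp_Comp_eq[OF ei] confl_Zero[OF k])
  moreover have "i \<cdot> k \<in> Hom \<A> K P" by (simp add: Hom_iff)
  ultimately obtain a where a: "a \<in> Hom \<A> K M" "m \<cdot> a = i \<cdot> k" using confl_factor[OF m(1)] by metis
  have "f \<cdot> (e \<cdot> m) = Zero_Arr \<A> M B" using confl_Zero[OF m(1)] by simp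
  moreover have "e \<cdot> m \<in> Hom \<A> M A" by (simp add: Hom_iff)
  ultimately obtain n where n: "n \<in> Hom \<A> M K" "k \<cdot> n = e \<cdot> m" using confl_factor[OF k] by metis
  note [simp] = a(1)[unfolded Hom_iff] n(1)[unfolded Hom_iff]
  have "n \<cdot> a = Ident \<A> K"
    by (rule confl_mono[OF k, of _ K]) (simp_all add: Hom_iff Comp_Comp_eq[OF n(2)] a(2) Comp_Comp_eq[OF ei])
  then have "K \<in> \<Y>" by (rule Y_retract[OF m(2) a(1) n(1)])
  then show ?thesis by (rule TFibI[OF k])
qed

lemma TFib_\<omega>_eq: "Fib_\<omega> \<A> \<X> \<Y> \<inter> Weq_\<omega> \<A> \<X> \<Y> = TFib_\<omega> \<A> \<Y>"
  using Fib_Weq_TFib TFib_sub by blast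

text \<open>Lifting the identity of B against (f, t) extends i over B; the first component of the
  lift retracts f. The complement C is then a retract of W: in the decomposition of h t the A-part
  dies, because c kills f.\<close>

lemma TCoFib_split:
  assumes f: "f \<in> CoFib_\<omega> \<A> \<X>" "f \<in> Weq_\<omega> \<A> \<X> \<Y>" "f \<in> Hom \<A> A B"
  obtains C t r c where "is_biproduct \<A> A C B f t r c" "C \<in> \<X> \<inter> \<Y>"
proof -
  obtain W t0 P i j r c0 where W: "W \<in> \<X> \<inter> \<Y>" and b: "is_biproduct \<A> A W P i j r c0"
    and ph: "(f \<cdot> r) \<oplus> (t0 \<cdot> c0) \<in> TFib_\<omega> \<A> \<Y>" "(f \<cdot> r) \<oplus> (t0 \<cdot> c0) \<in> Hom \<A> P B" "((f \<cdot> r) \<oplus> (t0 \<cdot> c0)) \<cdot> i = f"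
    by (rule Weq_\<omega>E[OF f(2,3)])
  define \<phi> where "\<phi> = (f \<cdot> r) \<oplus> (t0 \<cdot> c0)"
  note p = ph[folded \<phi>_def]
  note b' = biproductD[OF b]
  obtain c C where c: "confl f c A B C" "C \<in> \<X>" by (rule CoFibE[OF f(1,3)])
  note [simp] = b'(1-4)[unfolded Hom_iff] f(3)[unfolded Hom_iff] p(2)[unfolded Hom_iff] confl_Hom(2)[OF c(1), unfolded Hom_iff]
  have idB: "Ident \<A> B \<in> Hom \<A> B B" by (simp add: Hom_iff)
  have "has_lifting \<A> f \<phi>" by (rule CoFib_TFib_lifting[OF ext f(1) p(1)])
  then obtain h where h: "h \<in> Hom \<A> B P" "h \<cdot> f = i" "\<phi> \<cdot> h = Ident \<A> B"
    by (rule lift[OF _ b'(1) idB _ f(3) p(2)]) (simp add: p(3))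
  note [simp] = h(1)[unfolded Hom_iff]
  have "r \<cdot> h \<in> Hom \<A> B A" "(r \<cdot> h) \<cdot> f = Ident \<A> A" by (simp_all add: Hom_iff h(2) b'(5))
  then obtain t where t: "is_biproduct \<A> A C B f t (r \<cdot> h) c" by (rule retraction_biproduct[OF c(1)])
  note t' = biproductD[OF t]
  note [simp] = t'(2)[unfolded Hom_iff]
  have "c \<cdot> (\<phi> \<cdot> (h \<cdot> t)) = Ident \<A> C" by (simp add: Comp_Comp_eq[OF h(3)] t'(6))
  moreover have "h \<cdot> t = i \<cdot> (r \<cdot> (h \<cdot> t)) \<oplus> j \<cdot> (c0 \<cdot> (h \<cdot> t))"
    by (rule biproduct_decomp[OF b, of _ C]) (simp add: Hom_iff)
  ultimately have "c \<cdot> (\<phi> \<cdot> (i \<cdot> (r \<cdot> (h \<cdot> t)) \<oplus> j \<cdot> (c0 \<cdot> (h \<cdot> t)))) = Ident \<A> C" by (simp only:)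
  then have "(c \<cdot> (\<phi> \<cdot> j)) \<cdot> (c0 \<cdot> (h \<cdot> t)) = Ident \<A> C"
    by (simp add: Comp_Comp_eq[OF p(3)] Comp_Comp_eq[OF confl_Zero[OF c(1)]])
  moreover have "c0 \<cdot> (h \<cdot> t) \<in> Hom \<A> C W" "c \<cdot> (\<phi> \<cdot> j) \<in> Hom \<A> W C" by (simp_all add: Hom_iff)
  ultimately have "C \<in> \<Y>" using Y_retract W by blast
  then show ?thesis using that[OF t] c(2) by blast
qed

text \<open>The split monomorphism s is an inflation, so \<open>g \<cdot> s\<close>, which is
  \<open>s' \<cdot> f\<close>, is an inflation and f is one by cancellation. The cokernel is then
  handled by lifting properties.\<close>

lemma CoFib_\<omega>_retract: "retract_closed \<A> (CoFib_\<omega> \<A> \<X>)"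
  unfolding retract_closed_def
proof (intro allI impI, elim conjE)
  fix f g assume g: "g \<in> CoFib_\<omega> \<A> \<X>" and fg: "is_retract_of \<A> f g"
  have "f \<in> Arr \<A>" "g \<in> Arr \<A>" using fg by (auto simp: is_retract_of_def)
  then obtain A B A' B' where fH: "f \<in> Hom \<A> A B" and gH: "g \<in> Hom \<A> A' B'" using Arr_Hom by metis
  obtain s r s' r' where
    h: "s \<in> Hom \<A> A A'" "r \<in> Hom \<A> A' A" "s' \<in> Hom \<A> B B'" "r' \<in> Hom \<A> B' B"
    and e: "r \<cdot> s = Ident \<A> A" "r' \<cdot> s' = Ident \<A> B" "g \<cdot> s = s' \<cdot> f" "f \<cdot> r = r' \<cdot> g"
    by (rule retract_ofE[OF fg fH gH])
  note [simp] = h[unfolded Hom_iff] gH[unfolded Hom_iff]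
  obtain t c C where s: "confl s c A A' C" by (rule split_mono_confl[OF h(1,2) e(1)])
  obtain d D where d: "confl g d A' B' D" by (rule CoFibE[OF g gH])
  have "g \<cdot> s \<in> inflations \<A>" by (rule inflation_Comp[OF confl_inflation[OF s] confl_inflation[OF d]]) simp
  then have "f \<in> inflations \<A>" unfolding e(3) by (rule inflation_Comp_cancel[OF fH h(3)])
  then show "f \<in> CoFib_\<omega> \<A> \<X>"
    by (rule CoFib_of_lifting) (rule retract_lifting[OF fg CoFib_TFib_lifting[OF ext g] TFib_Arr])
qed

lemma Fib_\<omega>_retract: "retract_closed \<A> (Fib_\<omega> \<A> \<X> \<Y>)"
  unfolding retract_closed_def
proof (intro allI impI, elim conjE)
  fix f g assume g: "g \<in> Fib_\<omega> \<A> \<X> \<Y>" and fg: "is_retract_of \<A> f g"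
  have f: "f \<in> Arr \<A>" "g \<in> Arr \<A>" using fg by (auto simp: is_retract_of_def)
  then obtain A B A' B' where fH: "f \<in> Hom \<A> A B" and gH: "g \<in> Hom \<A> A' B'" using Arr_Hom by metis
  obtain s r s' r' where
    h: "s \<in> Hom \<A> A A'" "r \<in> Hom \<A> A' A" "s' \<in> Hom \<A> B B'" "r' \<in> Hom \<A> B' B"
    and e: "r \<cdot> s = Ident \<A> A" "r' \<cdot> s' = Ident \<A> B" "g \<cdot> s = s' \<cdot> f" "f \<cdot> r = r' \<cdot> g"
    by (rule retract_ofE[OF fg fH gH])
  note [simp] = h[unfolded Hom_iff] fH[unfolded Hom_iff] gH[unfolded Hom_iff]
  have "\<exists>l \<in> Hom \<A> W A. f \<cdot> l = w" if W: "W \<in> \<X> \<inter> \<Y>" and w: "w \<in> Hom \<A> W B" for W w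
  proof -
    note [simp] = w[unfolded Hom_iff]
    have sw: "s' \<cdot> w \<in> Hom \<A> W B'" by (simp add: Hom_iff)
    obtain l where l: "l \<in> Hom \<A> W A'" "g \<cdot> l = s' \<cdot> w" by (rule Fib_\<omega>_lift[OF g gH W sw])
    note [simp] = l(1)[unfolded Hom_iff]
    have "f \<cdot> (r \<cdot> l) = w" by (simp add: Comp_Comp_eq[OF e(4)] l(2) Comp_Comp_eq[OF e(2)])
    then show ?thesis by (rule bexI) (simp add: Hom_iff)
  qed
  then show "f \<in> Fib_\<omega> \<A> \<X> \<Y>" unfolding Fib_\<omega>_def by simp
qed

text \<open>Adding to A the domain W of an \<omega>-approximation t of B makes (f, t) surjective on
  morphisms from \<omega>; the inclusion of A is split with complement W. This is the place of
  contravariant finiteness in the factorization axiom.\<close>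

lemma factorization_TCoFib_Fib:
  "has_factorizations \<A> (CoFib_\<omega> \<A> \<X> \<inter> Weq_\<omega> \<A> \<X> \<Y>) (Fib_\<omega> \<A> \<X> \<Y>)"
  unfolding has_factorizations_def
proof
  fix f assume "f \<in> Arr \<A>"
  then obtain A B where fH: "f \<in> Hom \<A> A B" using Arr_Hom by blast
  note [simp] = fH[unfolded Hom_iff]
  have B: "B \<in> Obj \<A>" by simp
  obtain W t where W: "W \<in> \<X> \<inter> \<Y>" and t: "t \<in> Hom \<A> W B"
    and ta: "\<And>W' g. W' \<in> \<X> \<inter> \<Y> \<Longrightarrow> g \<in> Hom \<A> W' B \<Longrightarrow> \<exists>h \<in> Hom \<A> W' W. t \<cdot> h = g"
    using omega_approx[OF B] by metis
  note [simp] = t[unfolded Hom_iff]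
  obtain P i j r c where b: "is_biproduct \<A> A W P i j r c" using biproduct_exists[of A W] by auto
  note b' = biproductD[OF b]
  note [simp] = b'(1-4)[unfolded Hom_iff]
  define \<phi> where "\<phi> = (f \<cdot> r) \<oplus> (t \<cdot> c)"
  have p: "\<phi> \<in> Hom \<A> P B" and pi: "\<phi> \<cdot> i = f" and pj: "\<phi> \<cdot> j = t" unfolding \<phi>_def by (simp_all add: Hom_iff b'(5-8))
  note [simp] = p[unfolded Hom_iff]
  have "\<exists>l \<in> Hom \<A> W' P. \<phi> \<cdot> l = w" if W': "W' \<in> \<X> \<inter> \<Y>" and w: "w \<in> Hom \<A> W' B" for W' w
  proof -
    obtain h where h: "h \<in> Hom \<A> W' W" "t \<cdot> h = w" using ta[OF W' w] by blast
    note [simp] = h(1)[unfolded Hom_iff]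
    have "\<phi> \<cdot> (j \<cdot> h) = w" by (simp add: Comp_Comp_eq[OF pj] h(2))
    then show ?thesis by (rule bexI) (simp add: Hom_iff)
  qed
  then have "\<phi> \<in> Fib_\<omega> \<A> \<X> \<Y>" unfolding Fib_\<omega>_def by simp
  moreover have "Dom \<A> \<phi> = Cod \<A> i" by simp
  ultimately show "\<exists>i \<in> CoFib_\<omega> \<A> \<X> \<inter> Weq_\<omega> \<A> \<X> \<Y>. \<exists>p \<in> Fib_\<omega> \<A> \<X> \<Y>. Dom \<A> p = Cod \<A> i \<and> f = p \<cdot> i"
    by (intro bexI[OF _ split_TCoFib[OF b W]] bexI[of _ \<phi>] conjI) (simp_all add: pi)
qed

text \<open>Two corrections are made. Adding a special precover of B turns f into a deflation, whose
  kernel K need not lie in \<open>\<Y>\<close>. Pushing out along a special preenvelope of K then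
  replaces K by V in \<open>\<Y>\<close> while keeping B. Each correction is an inflation with
  cokernel in \<open>\<X>\<close>.\<close>

lemma factorization_CoFib_TFib: "has_factorizations \<A> (CoFib_\<omega> \<A> \<X>) (TFib_\<omega> \<A> \<Y>)"
  unfolding has_factorizations_def
proof
  fix f assume "f \<in> Arr \<A>"
  then obtain A B where fH: "f \<in> Hom \<A> A B" using Arr_Hom by blast
  note [simp] = fH[unfolded Hom_iff]
  have B: "B \<in> Obj \<A>" by simp
  obtain k0 p0 F0 C0 where p0: "confl k0 p0 F0 C0 B" "C0 \<in> \<X>" by (rule X_precover[OF B])
  note [simp] = confl_Hom(2)[OF p0(1), unfolded Hom_iff]
  obtain P i j r c where b: "is_biproduct \<A> A C0 P i j r c" using biproduct_exists[of A C0] by auto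
  note b' = biproductD[OF b]
  note [simp] = b'(1-4)[unfolded Hom_iff]
  define \<phi> where "\<phi> = (f \<cdot> r) \<oplus> (p0 \<cdot> c)"
  have p: "\<phi> \<in> Hom \<A> P B" and pi: "\<phi> \<cdot> i = f" and pj: "\<phi> \<cdot> j = p0" unfolding \<phi>_def by (simp_all add: Hom_iff b'(5-8))
  note [simp] = p[unfolded Hom_iff]
  have "\<phi> \<in> deflations \<A>" by (rule deflation_Comp_cancel[OF b'(2) p]) (simp add: pj confl_deflation[OF p0(1)])
  then obtain k K where k: "confl k \<phi> K P B" using p by (rule deflationE)
  note kH = confl_Hom(1)[OF k]
  note [simp] = kH[unfolded Hom_iff]
  have K: "K \<in> Obj \<A>" by simp
  obtain w d V X2 where w: "confl w d K V X2" "X2 \<in> \<X>" "V \<in> \<Y>" by (rule Y_preenvelope[OF K])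
  obtain k' \<psi> m E where po: "confl k' \<psi> V E B" "m \<in> Hom \<A> P E" "\<psi> \<cdot> m = \<phi>" "m \<cdot> k = k' \<cdot> w" "is_pushout \<A> k w k' m"
    by (rule inflation_pushoutE[OF k confl_Hom(1)[OF w(1)]])
  \<comment> \<open>The same square read in the other direction: m is the pushout of w, so its
    cokernel is that of w.\<close>
  have po': "is_pushout \<A> w k m k'"
  proof (rule pushoutI[OF confl_Hom(1)[OF w(1)] kH po(2) confl_Hom(1)[OF po(1)] po(4)[symmetric]])
    fix S u v assume uv: "u \<in> Hom \<A> E S" "v \<in> Hom \<A> E S" "u \<cdot> k' = v \<cdot> k'" "u \<cdot> m = v \<cdot> m"
    show "u = v" by (rule pushout_unique[OF po(5) kH confl_Hom(1)[OF w(1)] confl_Hom(1)[OF po(1)] uv(1,2,4,3)])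
  next
    fix S u v assume uv: "u \<in> Hom \<A> V S" "v \<in> Hom \<A> P S" "u \<cdot> w = v \<cdot> k"
    obtain h where "h \<in> Hom \<A> E S" "h \<cdot> m = v" "h \<cdot> k' = u"
      by (rule pushout_factor[OF po(5) kH confl_Hom(1)[OF w(1)] confl_Hom(1)[OF po(1)] uv(2,1) uv(3)[symmetric]])
    then show "\<exists>h \<in> Hom \<A> E S. h \<cdot> k' = u \<and> h \<cdot> m = v" by blast
  qed
  obtain d' where m: "confl m d' P E X2" by (rule pushout_inflation[OF w(1) kH po' po(2)])
  note [simp] = po(2)[unfolded Hom_iff] confl_Hom(2)[OF po(1), unfolded Hom_iff]
  have im: "i \<in> CoFib_\<omega> \<A> \<X>" "m \<in> CoFib_\<omega> \<A> \<X>"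
    by (rule CoFibI[OF biproduct_confl[OF b] p0(2)], rule CoFibI[OF m w(2)])
  have "m \<cdot> i \<in> CoFib_\<omega> \<A> \<X>"
  proof (rule CoFib_of_lifting)
    show "m \<cdot> i \<in> inflations \<A>"
      by (rule inflation_Comp[OF confl_inflation[OF biproduct_confl[OF b]] confl_inflation[OF m]]) simp
    fix p assume p: "p \<in> TFib_\<omega> \<A> \<Y>"
    show "has_lifting \<A> (m \<cdot> i) p"
      by (rule lifting_Comp[OF b'(1) po(2) TFib_Arr[OF p]
        CoFib_TFib_lifting[OF ext im(1) p] CoFib_TFib_lifting[OF ext im(2) p]])
  qed
  moreover have "\<psi> \<in> TFib_\<omega> \<A> \<Y>" by (rule TFibI[OF po(1) w(3)])
  moreover have "Dom \<A> \<psi> = Cod \<A> (m \<cdot> i)" by simp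
  moreover have "f = \<psi> \<cdot> (m \<cdot> i)" by (simp add: Comp_Comp_eq[OF po(3)] pi)
  ultimately show "\<exists>i \<in> CoFib_\<omega> \<A> \<X>. \<exists>p \<in> TFib_\<omega> \<A> \<Y>. Dom \<A> p = Cod \<A> i \<and> f = p \<cdot> i" by blast
qed

lemma Weq_\<omega>_two_out_of_three: "two_out_of_three \<A> (Weq_\<omega> \<A> \<X> \<Y>)"
  unfolding two_out_of_three_def Weq_\<omega>_iff
proof (intro ballI impI)
  fix f g assume fg: "f \<in> Arr \<A>" "g \<in> Arr \<A>" "Dom \<A> g = Cod \<A> f"
  have H: "f \<in> Hom \<A> (Dom \<A> f) (Cod \<A> f)" "g \<in> Hom \<A> (Cod \<A> f) (Cod \<A> g)"
    using fg by (simp_all add: Hom_def)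
  show "(stable_equiv f \<and> stable_equiv g \<longrightarrow> stable_equiv (g \<cdot> f)) \<and>
    (stable_equiv f \<and> stable_equiv (g \<cdot> f) \<longrightarrow> stable_equiv g) \<and>
    (stable_equiv g \<and> stable_equiv (g \<cdot> f) \<longrightarrow> stable_equiv f)"
    using stable_equiv_Comp[OF _ H(1) _ H(2)] stable_equiv_cancel_right[OF _ H]
      stable_equiv_cancel_left[OF H(1) _ H(2)] by blast
qed

lemma model_structure_\<omega>: "model_structure \<A> (CoFib_\<omega> \<A> \<X>) (Fib_\<omega> \<A> \<X> \<Y>) (Weq_\<omega> \<A> \<X> \<Y>)"
proof (intro model_structure.intro model_structure_axioms.intro)
  show "category \<A>" by unfold_locales
  show "CoFib_\<omega> \<A> \<X> \<subseteq> Arr \<A>" using CoFib_\<omega>_Arr by blast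
  show "Fib_\<omega> \<A> \<X> \<Y> \<subseteq> Arr \<A>" "Weq_\<omega> \<A> \<X> \<Y> \<subseteq> Arr \<A>" unfolding Fib_\<omega>_def Weq_\<omega>_def by blast+
  show "two_out_of_three \<A> (Weq_\<omega> \<A> \<X> \<Y>)" by (rule Weq_\<omega>_two_out_of_three)
  show "retract_closed \<A> (CoFib_\<omega> \<A> \<X>)" by (rule CoFib_\<omega>_retract)
  show "retract_closed \<A> (Fib_\<omega> \<A> \<X> \<Y>)" by (rule Fib_\<omega>_retract)
  show "retract_closed \<A> (Weq_\<omega> \<A> \<X> \<Y>)"
    unfolding retract_closed_def Weq_\<omega>_iff using stable_equiv_retract by blast
  show "has_lifting \<A> i p" if "i \<in> CoFib_\<omega> \<A> \<X>" "p \<in> Fib_\<omega> \<A> \<X> \<Y> \<inter> Weq_\<omega> \<A> \<X> \<Y>" for i p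
    using that CoFib_TFib_lifting[OF ext] unfolding TFib_\<omega>_eq by blast
  show "has_lifting \<A> i p" if i: "i \<in> CoFib_\<omega> \<A> \<X> \<inter> Weq_\<omega> \<A> \<X> \<Y>" and p: "p \<in> Fib_\<omega> \<A> \<X> \<Y>" for i p
  proof -
    obtain A B where iH: "i \<in> Hom \<A> A B" using i Arr_Hom[OF CoFib_\<omega>_Arr[of i \<X>]] by blast
    obtain C t r c where "is_biproduct \<A> A C B i t r c" "C \<in> \<X> \<inter> \<Y>"
      using TCoFib_split[OF _ _ iH] i by blast
    then show ?thesis using p by (rule split_lifting)
  qed
  show "has_factorizations \<A> (CoFib_\<omega> \<A> \<X> \<inter> Weq_\<omega> \<A> \<X> \<Y>) (Fib_\<omega> \<A> \<X> \<Y>)" by (rule factorization_TCoFib_Fib)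
  show "has_factorizations \<A> (CoFib_\<omega> \<A> \<X>) (Fib_\<omega> \<A> \<X> \<Y> \<inter> Weq_\<omega> \<A> \<X> \<Y>)"
    unfolding TFib_\<omega>_eq by (rule factorization_CoFib_TFib)
qed

section \<open>Recovering the cotorsion pair from its model structure\<close>

lemma cofibrant_objects_\<omega>: "cofibrant_objects \<A> (CoFib_\<omega> \<A> \<X>) = \<X>"
proof (intro equalityI subsetI)
  fix X assume "X \<in> cofibrant_objects \<A> (CoFib_\<omega> \<A> \<X>)"
  then obtain Z where X [simp]: "X \<in> Obj \<A>" and Z: "is_zero_object \<A> Z" and z: "Zero_Arr \<A> Z X \<in> CoFib_\<omega> \<A> \<X>"
    unfolding cofibrant_objects_def by blast
  have [simp]: "Z \<in> Obj \<A>" by (rule zero_object_Obj[OF Z])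
  have H: "Zero_Arr \<A> Z X \<in> Hom \<A> Z X" "Ident \<A> X \<in> Hom \<A> X X" "Ident \<A> X \<cdot> Zero_Arr \<A> Z X = Zero_Arr \<A> Z X" by (simp_all add: Hom_iff)
  obtain c C where c: "confl (Zero_Arr \<A> Z X) c Z X C" "C \<in> \<X>" by (rule CoFibE[OF z H(1)])
  obtain h where "h \<in> Hom \<A> C X" "h \<cdot> c = Ident \<A> X" by (rule confl_cofactor[OF c(1) H(2,3)])
  then show "X \<in> \<X>" by (rule X_retract[OF c(2) confl_Hom(2)[OF c(1)]])
next
  fix X assume X: "X \<in> \<X>"
  obtain Z where Z: "is_zero_object \<A> Z" using zero_object_exists by blast
  have "Zero_Arr \<A> Z X \<in> CoFib_\<omega> \<A> \<X>" by (rule CoFibI[OF zero_object_confl[OF Z X_Obj[OF X]] X])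
  then show "X \<in> cofibrant_objects \<A> (CoFib_\<omega> \<A> \<X>)"
    unfolding cofibrant_objects_def using Z X_Obj[OF X] by blast
qed

lemma fibrant_objects_\<omega>: "fibrant_objects \<A> (Fib_\<omega> \<A> \<X> \<Y>) = Obj \<A>"
proof -
  obtain Z where Z: "is_zero_object \<A> Z" using zero_object_exists by blast
  have [simp]: "Z \<in> Obj \<A>" by (rule zero_object_Obj[OF Z])
  have "Zero_Arr \<A> X Z \<in> Fib_\<omega> \<A> \<X> \<Y>" if X [simp]: "X \<in> Obj \<A>" for X
  proof -
    have "\<exists>h \<in> Hom \<A> W X. Zero_Arr \<A> X Z \<cdot> h = g" if g: "g \<in> Hom \<A> W Z" for W g
    proof -
      note [simp] = g[unfolded Hom_iff]
      have "Zero_Arr \<A> X Z \<cdot> Zero_Arr \<A> W X = g" using to_zero_object[OF Z g] by simp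
      then show ?thesis by (rule bexI) (simp add: Hom_iff)
    qed
    then show ?thesis unfolding Fib_\<omega>_def by simp
  qed
  then show ?thesis unfolding fibrant_objects_def using Z by blast
qed

text \<open>For a trivial object B the defining deflation goes from the biproduct of Z and W, which
  lies in \<open>\<Y>\<close>, to B with kernel in \<open>\<Y>\<close>, so heredity applies.
  Conversely, the special precover of an object of \<open>\<Y>\<close> lies in \<omega> by extension
  closure and can play the role of W.\<close>

lemma trivial_objects_\<omega>: "trivial_objects \<A> (Weq_\<omega> \<A> \<X> \<Y>) = \<Y>"
proof (intro equalityI subsetI)
  fix B assume "B \<in> trivial_objects \<A> (Weq_\<omega> \<A> \<X> \<Y>)"
  then obtain Z where B [simp]: "B \<in> Obj \<A>" and Z: "is_zero_object \<A> Z" and z: "Zero_Arr \<A> Z B \<in> Weq_\<omega> \<A> \<X> \<Y>"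
    unfolding trivial_objects_def by blast
  have [simp]: "Z \<in> Obj \<A>" by (rule zero_object_Obj[OF Z])
  have H: "Zero_Arr \<A> Z B \<in> Hom \<A> Z B" by (simp_all add: Hom_iff)
  obtain W t P i j r c where W: "W \<in> \<X> \<inter> \<Y>" and b: "is_biproduct \<A> Z W P i j r c"
    and ph: "(Zero_Arr \<A> Z B \<cdot> r) \<oplus> (t \<cdot> c) \<in> TFib_\<omega> \<A> \<Y>" "(Zero_Arr \<A> Z B \<cdot> r) \<oplus> (t \<cdot> c) \<in> Hom \<A> P B"
    by (rule Weq_\<omega>E[OF z H])
  obtain k K where k: "confl k ((Zero_Arr \<A> Z B \<cdot> r) \<oplus> (t \<cdot> c)) K P B" "K \<in> \<Y>" by (rule TFibE[OF ph])
  have "P \<in> \<Y>" using Y_biproduct[OF b Y_zero[OF Z]] W by blast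
  then show "B \<in> \<Y>" by (rule Y_cokernel[OF k])
next
  fix B assume B: "B \<in> \<Y>"
  have [simp]: "B \<in> Obj \<A>" by (rule Y_Obj[OF B])
  obtain Z where Z: "is_zero_object \<A> Z" using zero_object_exists by blast
  have [simp]: "Z \<in> Obj \<A>" by (rule zero_object_Obj[OF Z])
  obtain k p F C where p: "confl k p F C B" "C \<in> \<X>" "F \<in> \<Y>" by (rule X_precover[OF Y_Obj[OF B]])
  note [simp] = confl_Hom(2)[OF p(1), unfolded Hom_iff]
  have C: "C \<in> \<X> \<inter> \<Y>" using Y_extension[OF p(1,3) B] p(2) by blast
  have "p \<cdot> Zero_Arr \<A> Z C \<in> Weq_\<omega> \<A> \<X> \<Y>"
    by (rule Weq_\<omega>I[OF biproduct_swap[OF zero_object_biproduct[OF Z]] C TFibI[OF p(1,3)] confl_Hom(2)[OF p(1)]]) simp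
  then show "B \<in> trivial_objects \<A> (Weq_\<omega> \<A> \<X> \<Y>)" unfolding trivial_objects_def using Z by auto
qed

lemma \<Phi>_in_S_M: "\<Phi> \<A> (\<X>, \<Y>) \<in> S_M \<A>"
proof -
  have "TFib_\<omega> \<A> \<Y> \<subseteq> deflations \<A>" unfolding TFib_\<omega>_def by blast
  then have "weakly_projective \<A> (CoFib_\<omega> \<A> \<X>) (Fib_\<omega> \<A> \<X> \<Y>) (Weq_\<omega> \<A> \<X> \<Y>)"
    unfolding weakly_projective_def cofibrant_objects_\<omega> fibrant_objects_\<omega> TFib_\<omega>_eq
    by (simp add: CoFib_\<omega>_def)
  then show ?thesis using model_structure_\<omega> unfolding S_M_def \<Phi>_def by simp
qed

lemma \<Psi>_\<Phi>: "\<Psi> \<A> (\<Phi> \<A> (\<X>, \<Y>)) = (\<X>, \<Y>)"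
  unfolding \<Psi>_def \<Phi>_def using Y_Obj by (auto simp: cofibrant_objects_\<omega> fibrant_objects_\<omega> trivial_objects_\<omega>)

end

section \<open>Weakly projective model structures\<close>

context category
begin

text \<open>The retract argument, by which lifting properties determine the classes of a model
  structure: the filler of the square with top edge i and bottom edge an identity is a section of p
  and supplies the retract data.\<close>

lemma retract_of_left_factor:
  assumes p: "p \<in> Hom \<A> C B" and i: "i \<in> Hom \<A> A C" and l: "has_lifting \<A> (p \<cdot> i) p"
  shows "is_retract_of \<A> (p \<cdot> i) i"
proof -
  note [simp] = p[unfolded Hom_iff] i[unfolded Hom_iff]
  have f: "p \<cdot> i \<in> Hom \<A> A B" and idH: "Ident \<A> B \<in> Hom \<A> B B" "Ident \<A> A \<in> Hom \<A> A A" by (simp_all add: Hom_iff)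
  obtain h where h: "h \<in> Hom \<A> B C" "h \<cdot> p \<cdot> i = i" "p \<cdot> h = Ident \<A> B"
    by (rule lift[OF l i idH(1) _ f p]) simp
  show ?thesis by (rule retract_ofI[OF f i idH(2,2) h(1) p _ h(3)]) (simp_all add: h(2))
qed

lemma retract_of_right_factor:
  assumes p: "p \<in> Hom \<A> C B" and i: "i \<in> Hom \<A> A C" and l: "has_lifting \<A> i (p \<cdot> i)"
  shows "is_retract_of \<A> (p \<cdot> i) p"
proof -
  note [simp] = p[unfolded Hom_iff] i[unfolded Hom_iff]
  have f: "p \<cdot> i \<in> Hom \<A> A B" and idH: "Ident \<A> B \<in> Hom \<A> B B" "Ident \<A> A \<in> Hom \<A> A A" by (simp_all add: Hom_iff)
  obtain h where h: "h \<in> Hom \<A> C A" "h \<cdot> i = Ident \<A> A" "(p \<cdot> i) \<cdot> h = p"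
    by (rule lift[OF l idH(2) p _ i f]) simp
  show ?thesis by (rule retract_ofI[OF f p i h(1) idH(1,1) h(2)]) (use h(1,3) in \<open>simp_all add: Hom_iff\<close>)
qed

end

section \<open>Lifting characterizations of the classes of a model structure\<close>

context model_structure
begin

lemma factorE:
  assumes "has_factorizations \<A> L R" "f \<in> Hom \<A> A B" "L \<subseteq> Arr \<A>" "R \<subseteq> Arr \<A>"
  obtains i p C where "i \<in> L" "p \<in> R" "i \<in> Hom \<A> A C" "p \<in> Hom \<A> C B" "f = p \<cdot> i"
proof -
  have "f \<in> Arr \<A>" using assms(2) by (simp add: Hom_iff)
  then obtain i p where ip: "i \<in> L" "p \<in> R" "Dom \<A> p = Cod \<A> i" "f = p \<cdot> i"
    using assms(1) unfolding has_factorizations_def by blast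
  have [simp]: "i \<in> Arr \<A>" "p \<in> Arr \<A>" using ip assms(3,4) by blast+
  have "Dom \<A> i = A" "Cod \<A> p = B" using assms(2) ip(3) unfolding ip(4) by (simp_all add: Hom_iff)
  then have "i \<in> Hom \<A> A (Cod \<A> i)" "p \<in> Hom \<A> (Cod \<A> i) B" using ip(3) by (simp_all add: Hom_def)
  then show ?thesis using that ip by blast
qed

lemma CoFib_of_lifting:
  assumes f: "f \<in> Arr \<A>" and l: "\<And>p. p \<in> Fib \<inter> Weq \<Longrightarrow> has_lifting \<A> f p"
  shows "f \<in> CoFib"
proof -
  obtain i p C where ip: "i \<in> CoFib" "p \<in> Fib \<inter> Weq" "i \<in> Hom \<A> (Dom \<A> f) C" "p \<in> Hom \<A> C (Cod \<A> f)" "f = p \<cdot> i"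
    using Fib_Arr by (rule_tac factorE[OF factorization_triv_Fib Arr_Hom[OF f] CoFib_Arr]) blast
  have "is_retract_of \<A> f i" using retract_of_left_factor[OF ip(4,3)] l[OF ip(2)] unfolding ip(5)[symmetric] by blast
  then show ?thesis using CoFib_retract ip(1) unfolding retract_closed_def by blast
qed

lemma TCoFib_of_lifting:
  assumes f: "f \<in> Arr \<A>" and l: "\<And>p. p \<in> Fib \<Longrightarrow> has_lifting \<A> f p"
  shows "f \<in> CoFib \<inter> Weq"
proof -
  obtain i p C where ip: "i \<in> CoFib \<inter> Weq" "p \<in> Fib" "i \<in> Hom \<A> (Dom \<A> f) C" "p \<in> Hom \<A> C (Cod \<A> f)" "f = p \<cdot> i"
    using CoFib_Arr by (rule_tac factorE[OF factorization_triv_CoFib Arr_Hom[OF f] _ Fib_Arr]) blast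
  have "is_retract_of \<A> f i" using retract_of_left_factor[OF ip(4,3)] l[OF ip(2)] unfolding ip(5)[symmetric] by blast
  then show ?thesis using CoFib_retract Weq_retract ip(1) unfolding retract_closed_def by blast
qed

lemma TFib_of_lifting:
  assumes f: "f \<in> Arr \<A>" and l: "\<And>i. i \<in> CoFib \<Longrightarrow> has_lifting \<A> i f"
  shows "f \<in> Fib \<inter> Weq"
proof -
  obtain i p C where ip: "i \<in> CoFib" "p \<in> Fib \<inter> Weq" "i \<in> Hom \<A> (Dom \<A> f) C" "p \<in> Hom \<A> C (Cod \<A> f)" "f = p \<cdot> i"
    using Fib_Arr by (rule_tac factorE[OF factorization_triv_Fib Arr_Hom[OF f] CoFib_Arr]) blast
  have "is_retract_of \<A> f p" using retract_of_right_factor[OF ip(4,3)] l[OF ip(1)] unfolding ip(5)[symmetric] by blast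
  then show ?thesis using Fib_retract Weq_retract ip(2) unfolding retract_closed_def by blast
qed

lemma Fib_of_lifting:
  assumes f: "f \<in> Arr \<A>" and l: "\<And>i. i \<in> CoFib \<inter> Weq \<Longrightarrow> has_lifting \<A> i f"
  shows "f \<in> Fib"
proof -
  obtain i p C where ip: "i \<in> CoFib \<inter> Weq" "p \<in> Fib" "i \<in> Hom \<A> (Dom \<A> f) C" "p \<in> Hom \<A> C (Cod \<A> f)" "f = p \<cdot> i"
    using CoFib_Arr by (rule_tac factorE[OF factorization_triv_CoFib Arr_Hom[OF f] _ Fib_Arr]) blast
  have "is_retract_of \<A> f p" using retract_of_right_factor[OF ip(4,3)] l[OF ip(1)] unfolding ip(5)[symmetric] by blast
  then show ?thesis using Fib_retract ip(2) unfolding retract_closed_def by blast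
qed

lemma two_out_of_threeD:
  assumes "f \<in> Hom \<A> A B" "g \<in> Hom \<A> B C"
  shows "f \<in> Weq \<Longrightarrow> g \<in> Weq \<Longrightarrow> g \<cdot> f \<in> Weq"
    "f \<in> Weq \<Longrightarrow> g \<cdot> f \<in> Weq \<Longrightarrow> g \<in> Weq"
    "g \<in> Weq \<Longrightarrow> g \<cdot> f \<in> Weq \<Longrightarrow> f \<in> Weq"
proof -
  have "f \<in> Arr \<A>" "g \<in> Arr \<A>" "Dom \<A> g = Cod \<A> f" using assms by (simp_all add: Hom_iff)
  then have "(f \<in> Weq \<and> g \<in> Weq \<longrightarrow> g \<cdot> f \<in> Weq) \<and> (f \<in> Weq \<and> g \<cdot> f \<in> Weq \<longrightarrow> g \<in> Weq) \<and>
      (g \<in> Weq \<and> g \<cdot> f \<in> Weq \<longrightarrow> f \<in> Weq)"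
    using Weq_two_out_of_three unfolding two_out_of_three_def by blast
  then show "f \<in> Weq \<Longrightarrow> g \<in> Weq \<Longrightarrow> g \<cdot> f \<in> Weq"
    "f \<in> Weq \<Longrightarrow> g \<cdot> f \<in> Weq \<Longrightarrow> g \<in> Weq"
    "g \<in> Weq \<Longrightarrow> g \<cdot> f \<in> Weq \<Longrightarrow> f \<in> Weq" by blast+
qed

text \<open>Factor f into a trivial cofibration and a fibration; two out of three makes the
  fibration trivial. Both factors are then characterized by lifting properties that mention only
  cofibrations and fibrations, so they are weak equivalences of the second structure too.\<close>

lemma Weq_subset:
  assumes "model_structure \<A> CoFib Fib Weq'"
  shows "Weq \<subseteq> Weq'"
proof
  interpret M: model_structure \<A> CoFib Fib Weq' by (rule assms)
  fix f assume f: "f \<in> Weq"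
  then obtain A B where fH: "f \<in> Hom \<A> A B" using Weq_Arr Arr_Hom by blast
  obtain i p C where ip: "i \<in> CoFib \<inter> Weq" "p \<in> Fib" "i \<in> Hom \<A> A C" "p \<in> Hom \<A> C B" "f = p \<cdot> i"
    using CoFib_Arr by (rule_tac factorE[OF factorization_triv_CoFib fH _ Fib_Arr]) blast
  have p: "p \<in> Weq" using two_out_of_threeD(2)[OF ip(3,4)] ip(1) f unfolding ip(5) by blast
  have "i \<in> CoFib \<inter> Weq'"
    by (rule M.TCoFib_of_lifting) (use ip(1) CoFib_Arr Fib_lifting in blast)+
  moreover have "p \<in> Fib \<inter> Weq'"
    by (rule M.TFib_of_lifting) (use ip(2) p Fib_Arr CoFib_lifting in blast)+
  ultimately show "f \<in> Weq'" unfolding ip(5) using M.two_out_of_threeD(1)[OF ip(3,4)] by blast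
qed

text \<open>The axioms do not list identities as weak equivalences; an identity has every right
  lifting property, so it is a trivial fibration.\<close>

lemma Ident_Weq: "X \<in> Obj \<A> \<Longrightarrow> Ident \<A> X \<in> Weq"
proof -
  assume X [simp]: "X \<in> Obj \<A>"
  have idH: "Ident \<A> X \<in> Hom \<A> X X" by (simp add: Hom_iff)
  have "has_lifting \<A> i (Ident \<A> X)" if "i \<in> CoFib" for i
  proof (rule liftingI[OF Arr_Hom idH])
    show i: "i \<in> Arr \<A>" using that CoFib_Arr by blast
    fix u v assume uv: "u \<in> Hom \<A> (Dom \<A> i) X" "v \<in> Hom \<A> (Cod \<A> i) X" "v \<cdot> i = Ident \<A> X \<cdot> u"
    note [simp] = uv(1,2)[unfolded Hom_iff]
    have "v \<cdot> i = u" "Ident \<A> X \<cdot> v = v" using uv(3) by simp_all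
    then show "\<exists>h \<in> Hom \<A> (Cod \<A> i) X. h \<cdot> i = u \<and> Ident \<A> X \<cdot> h = v" using uv(2) by blast
  qed
  then show ?thesis using TFib_of_lifting[of "Ident \<A> X"] by simp
qed

end

locale weakly_projective_setting = wic_exact_category \<A> + model_structure \<A> CoFib Fib Weq
  for \<A> :: "('o, 'm, 'z) exact_cat_data_scheme" (structure)
    and CoFib Fib Weq :: "'m set" +
  assumes weakly_projective: "weakly_projective \<A> CoFib Fib Weq"
begin

abbreviation (input) \<C> :: "'o set" where "\<C> \<equiv> cofibrant_objects \<A> CoFib"
abbreviation (input) \<T> :: "'o set" where "\<T> \<equiv> trivial_objects \<A> Weq \<inter> fibrant_objects \<A> Fib"

lemma CoFib_eq: "CoFib = CoFib_\<omega> \<A> \<C>"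
  using weakly_projective unfolding weakly_projective_def CoFib_\<omega>_def by (elim conjE)

lemma CoFib_D: "i \<in> CoFib \<Longrightarrow> i \<in> CoFib_\<omega> \<A> \<C>"
  by (rule equalityD1[OF CoFib_eq, THEN subsetD])

lemma CoFib_I: "confl i c A B C \<Longrightarrow> C \<in> \<C> \<Longrightarrow> i \<in> CoFib"
  by (rule equalityD2[OF CoFib_eq, THEN subsetD]) (rule CoFibI)

lemma TFib_deflation: "p \<in> Fib \<Longrightarrow> p \<in> Weq \<Longrightarrow> p \<in> deflations \<A>"
  using weakly_projective unfolding weakly_projective_def by blast

lemma all_fibrant: "fibrant_objects \<A> Fib = Obj \<A>"
  using weakly_projective unfolding weakly_projective_def by (elim conjE)

lemma C_lift:
  assumes X: "X \<in> \<C>" and p: "p \<in> Fib" "p \<in> Weq" "p \<in> Hom \<A> D E" and g: "g \<in> Hom \<A> X E"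
  obtains h where "h \<in> Hom \<A> X D" "p \<cdot> h = g"
proof -
  obtain Z where Z: "is_zero_object \<A> Z" and z: "Zero_Arr \<A> Z X \<in> CoFib"
    using X unfolding cofibrant_objects_def by blast
  note [simp] = p(3)[unfolded Hom_iff] g[unfolded Hom_iff] zero_object_Obj[OF Z]
  have H: "Zero_Arr \<A> Z D \<in> Hom \<A> Z D" "g \<cdot> Zero_Arr \<A> Z X = p \<cdot> Zero_Arr \<A> Z D" "Zero_Arr \<A> Z X \<in> Hom \<A> Z X"
    by (simp_all add: Hom_iff)
  have "has_lifting \<A> (Zero_Arr \<A> Z X) p" by (rule CoFib_lifting[OF z]) (use p in simp)
  then show ?thesis by (rule lift[OF _ H(1) g H(2) H(3) p(3)]) (rule that)
qed

lemma C_I: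
  assumes X: "X \<in> Obj \<A>" and Z: "is_zero_object \<A> Z"
    and l: "\<And>p D E g. p \<in> Fib \<inter> Weq \<Longrightarrow> p \<in> Hom \<A> D E \<Longrightarrow> g \<in> Hom \<A> X E \<Longrightarrow> \<exists>h \<in> Hom \<A> X D. p \<cdot> h = g"
  shows "Zero_Arr \<A> Z X \<in> CoFib"
proof (rule CoFib_of_lifting)
  note [simp] = X zero_object_Obj[OF Z]
  show "Zero_Arr \<A> Z X \<in> Arr \<A>" by simp
  fix p assume p: "p \<in> Fib \<inter> Weq"
  then obtain D E where pH: "p \<in> Hom \<A> D E" using Fib_Arr Arr_Hom by blast
  have "Zero_Arr \<A> Z X \<in> Hom \<A> Z X" by (simp add: Hom_iff)
  then show "has_lifting \<A> (Zero_Arr \<A> Z X) p"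
  proof (rule liftingI[OF _ pH])
    fix u v assume uv: "u \<in> Hom \<A> Z D" "v \<in> Hom \<A> X E"
    obtain h where h: "h \<in> Hom \<A> X D" "p \<cdot> h = v" using l[OF p pH uv(2)] by blast
    have "h \<cdot> Zero_Arr \<A> Z X = u" using from_zero_object[OF Z uv(1)] h(1) by (simp add: Hom_iff)
    then show "\<exists>h \<in> Hom \<A> X D. h \<cdot> Zero_Arr \<A> Z X = u \<and> p \<cdot> h = v" using h by blast
  qed
qed

text \<open>Since Y is fibrant, i lifts against the morphism from Y to a zero object. With u an
  identity this splits trivial cofibrations.\<close>

lemma TCoFib_extend:
  assumes i: "i \<in> CoFib" "i \<in> Weq" "i \<in> Hom \<A> A B" and u: "u \<in> Hom \<A> A Y"
  obtains h where "h \<in> Hom \<A> B Y" "h \<cdot> i = u"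
proof -
  note [simp] = i(3)[unfolded Hom_iff] u[unfolded Hom_iff]
  have "Y \<in> fibrant_objects \<A> Fib" unfolding all_fibrant by simp
  then obtain Z where Z: "is_zero_object \<A> Z" and z: "Zero_Arr \<A> Y Z \<in> Fib"
    unfolding fibrant_objects_def by blast
  have [simp]: "Z \<in> Obj \<A>" by (rule zero_object_Obj[OF Z])
  have H: "Zero_Arr \<A> B Z \<in> Hom \<A> B Z" "Zero_Arr \<A> B Z \<cdot> i = Zero_Arr \<A> Y Z \<cdot> u" "Zero_Arr \<A> Y Z \<in> Hom \<A> Y Z"
    by (simp_all add: Hom_iff)
  have "has_lifting \<A> i (Zero_Arr \<A> Y Z)" by (rule Fib_lifting[OF _ z]) (use i in simp)
  then show ?thesis by (rule lift[OF _ u H(1,2) i(3) H(3)]) (rule that)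
qed

lemma lifting_to_zero:
  assumes Z: "is_zero_object \<A> Z" and i: "i \<in> Arr \<A>" and Y: "Y \<in> Obj \<A>"
    and l: "\<And>A B u. i \<in> Hom \<A> A B \<Longrightarrow> u \<in> Hom \<A> A Y \<Longrightarrow> \<exists>h \<in> Hom \<A> B Y. h \<cdot> i = u"
  shows "has_lifting \<A> i (Zero_Arr \<A> Y Z)"
proof -
  note [simp] = Y zero_object_Obj[OF Z]
  obtain A B where iH: "i \<in> Hom \<A> A B" using i Arr_Hom by blast
  have "Zero_Arr \<A> Y Z \<in> Hom \<A> Y Z" by (simp add: Hom_iff)
  then show ?thesis
  proof (rule liftingI[OF iH])
    fix u v assume uv: "u \<in> Hom \<A> A Y" "v \<in> Hom \<A> B Z"
    obtain h where h: "h \<in> Hom \<A> B Y" "h \<cdot> i = u" using l[OF iH uv(1)] by blast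
    have "Zero_Arr \<A> Y Z \<cdot> h = v" using to_zero_object[OF Z uv(2)] h(1) by (simp add: Hom_iff)
    then show "\<exists>h \<in> Hom \<A> B Y. h \<cdot> i = u \<and> Zero_Arr \<A> Y Z \<cdot> h = v" using h by blast
  qed
qed

lemma T_Obj: "Y \<in> \<T> \<Longrightarrow> Y \<in> Obj \<A>" and C_Obj: "X \<in> \<C> \<Longrightarrow> X \<in> Obj \<A>"
  unfolding trivial_objects_def cofibrant_objects_def by auto

lemma T_extend:
  assumes Y: "Y \<in> \<T>" and i: "i \<in> CoFib" "i \<in> Hom \<A> A B" and u: "u \<in> Hom \<A> A Y"
  obtains h where "h \<in> Hom \<A> B Y" "h \<cdot> i = u"
proof -
  note [simp] = i(2)[unfolded Hom_iff] u[unfolded Hom_iff]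
  obtain Z where Z: "is_zero_object \<A> Z" and z: "Zero_Arr \<A> Z Y \<in> Weq"
    using Y unfolding trivial_objects_def by blast
  have [simp]: "Z \<in> Obj \<A>" by (rule zero_object_Obj[OF Z])
  have H: "Zero_Arr \<A> B Z \<in> Hom \<A> B Z" "Zero_Arr \<A> B Z \<cdot> i = Zero_Arr \<A> Y Z \<cdot> u" "Zero_Arr \<A> Y Z \<in> Hom \<A> Y Z"
    "Zero_Arr \<A> Z Y \<in> Hom \<A> Z Y" "Zero_Arr \<A> Y Z \<cdot> Zero_Arr \<A> Z Y = Ident \<A> Z"
    by (simp_all add: Hom_iff zero_object_Ident[OF Z])
  \<comment> \<open>The composite through Y is the identity of Z. The rules for composites with zero
    morphisms are switched off so that it is rewritten to that identity and not to a zero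
    morphism.\<close>
  have "Zero_Arr \<A> Y Z \<in> Weq"
    by (rule two_out_of_threeD(2)[OF H(4,3) z]) (simp add: H(5) Ident_Weq del: Comp_Zero Zero_Comp)
  \<comment> \<open>Fibrancy and triviality may be witnessed by different zero objects, so the
    fibration property for this Z is derived from lifting.\<close>
  moreover have "Zero_Arr \<A> Y Z \<in> Fib"
  proof (rule Fib_of_lifting)
    fix j assume j: "j \<in> CoFib \<inter> Weq"
    have "\<exists>h \<in> Hom \<A> B Y. h \<cdot> j = u" if "j \<in> Hom \<A> A B" "u \<in> Hom \<A> A Y" for A B u
      using TCoFib_extend[OF _ _ that] j by blast
    then show "has_lifting \<A> j (Zero_Arr \<A> Y Z)"
      using j CoFib_Arr by (intro lifting_to_zero[OF Z]) auto
  qed simp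
  ultimately have "has_lifting \<A> i (Zero_Arr \<A> Y Z)" using CoFib_lifting[OF i(1)] by blast
  then show ?thesis by (rule lift[OF _ u H(1,2) i(2) H(3)]) (rule that)
qed

lemma T_zero:
  assumes Y: "Y \<in> Obj \<A>" and Z: "is_zero_object \<A> Z"
    and l: "\<And>i A B u. i \<in> CoFib \<Longrightarrow> i \<in> Hom \<A> A B \<Longrightarrow> u \<in> Hom \<A> A Y \<Longrightarrow> \<exists>h \<in> Hom \<A> B Y. h \<cdot> i = u"
  shows "Zero_Arr \<A> Z Y \<in> Weq"
proof -
  note [simp] = Y zero_object_Obj[OF Z]
  have H: "Zero_Arr \<A> Y Z \<in> Hom \<A> Y Z"
    "Zero_Arr \<A> Z Y \<in> Hom \<A> Z Y" "Zero_Arr \<A> Y Z \<cdot> Zero_Arr \<A> Z Y = Ident \<A> Z"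
    by (simp_all add: Hom_iff zero_object_Ident[OF Z])
  have "Zero_Arr \<A> Y Z \<in> Fib \<inter> Weq"
  proof (rule TFib_of_lifting)
    fix i assume i: "i \<in> CoFib"
    show "has_lifting \<A> i (Zero_Arr \<A> Y Z)"
      using i CoFib_Arr by (intro lifting_to_zero[OF Z] l) auto
  qed simp
  then show ?thesis
    by (intro two_out_of_threeD(3)[OF H(2,1)]) (simp_all add: H(3) Ident_Weq del: Comp_Zero Zero_Comp)
qed

lemma T_I:
  assumes Y: "Y \<in> Obj \<A>"
    and l: "\<And>i A B u. i \<in> CoFib \<Longrightarrow> i \<in> Hom \<A> A B \<Longrightarrow> u \<in> Hom \<A> A Y \<Longrightarrow> \<exists>h \<in> Hom \<A> B Y. h \<cdot> i = u"
  shows "Y \<in> \<T>"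
proof -
  obtain Z where Z: "is_zero_object \<A> Z" using zero_object_exists by blast
  have "Zero_Arr \<A> Z Y \<in> Weq" by (rule T_zero[OF Y Z l])
  then show ?thesis using Y Z unfolding all_fibrant trivial_objects_def by blast
qed

text \<open>Cofibrancy is defined by some zero object; the lifting characterization, which does not
  mention it, transfers the property to every zero object.\<close>

lemma C_zero: "X \<in> \<C> \<Longrightarrow> is_zero_object \<A> Z \<Longrightarrow> Zero_Arr \<A> Z X \<in> CoFib"
  by (rule C_I[OF C_Obj]) (use C_lift in blast)+

lemma T_zero': "Y \<in> \<T> \<Longrightarrow> is_zero_object \<A> Z \<Longrightarrow> Zero_Arr \<A> Z Y \<in> Weq"
  by (rule T_zero[OF T_Obj]) (use T_extend in blast)+

text \<open>The inflation of such an extension is a cofibration because its cokernel is cofibrant,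
  and the identity of Y extends along cofibrations as Y is trivially fibrant.\<close>

lemma C_T_ext:
  assumes X: "X \<in> \<C>" and Y: "Y \<in> \<T>"
  shows "ext_splits X Y"
proof (rule ext_splitsI)
  fix i d E assume c: "confl i d Y E X"
  have i: "i \<in> CoFib" by (rule CoFib_I[OF c X])
  obtain r where "r \<in> Hom \<A> E Y" "r \<cdot> i = Ident \<A> Y" by (rule T_extend[OF Y i confl_Hom(1)[OF c] Ident_in_Hom[OF T_Obj[OF Y]]])
  then show "\<exists>r \<in> Hom \<A> E Y. r \<cdot> i = Ident \<A> Y" by blast
qed

text \<open>The kernel of a trivial fibration inherits extension along cofibrations: fill the square
  with zero bottom edge, and the filler lands in the kernel. The converse is the lifting supplied by
  vanishing extensions.\<close>

lemma TFib_eq: "Fib \<inter> Weq = TFib_\<omega> \<A> \<T>"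
proof (intro equalityI subsetI)
  fix p assume p: "p \<in> Fib \<inter> Weq"
  then have pd: "p \<in> deflations \<A>" using TFib_deflation by blast
  obtain D E where pH: "p \<in> Hom \<A> D E" using p Fib_Arr Arr_Hom by blast
  obtain k F where k: "confl k p F D E" by (rule deflationE[OF pd pH])
  note [simp] = confl_Hom(1,2)[OF k, unfolded Hom_iff]
  have "F \<in> \<T>"
  proof (rule T_I)
    fix i A B u assume i: "i \<in> CoFib" "i \<in> Hom \<A> A B" and u: "u \<in> Hom \<A> A F"
    note [simp] = i(2)[unfolded Hom_iff] u[unfolded Hom_iff]
    have H: "k \<cdot> u \<in> Hom \<A> A D" "Zero_Arr \<A> B E \<in> Hom \<A> B E" "Zero_Arr \<A> B E \<cdot> i = p \<cdot> (k \<cdot> u)"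
      by (simp_all add: Hom_iff Comp_Comp_eq[OF confl_Zero[OF k]])
    obtain h where h: "h \<in> Hom \<A> B D" "h \<cdot> i = k \<cdot> u" "p \<cdot> h = Zero_Arr \<A> B E"
      by (rule lift[OF CoFib_lifting[OF i(1) p] H i(2) pH])
    obtain h' where h': "h' \<in> Hom \<A> B F" "k \<cdot> h' = h" by (rule confl_factor[OF k h(1,3)])
    note [simp] = h'(1)[unfolded Hom_iff]
    have "h' \<cdot> i = u" by (rule confl_mono[OF k _ u]) (simp_all add: Hom_iff Comp_Comp_eq[OF h'(2)] h(2))
    then show "\<exists>h \<in> Hom \<A> B F. h \<cdot> i = u" using h'(1) by blast
  qed simp
  then show "p \<in> TFib_\<omega> \<A> \<T>" by (rule TFibI[OF k])
next
  fix p assume p: "p \<in> TFib_\<omega> \<A> \<T>"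
  show "p \<in> Fib \<inter> Weq"
  proof (rule TFib_of_lifting[OF TFib_Arr[OF p]])
    fix i assume i: "i \<in> CoFib"
    show "has_lifting \<A> i p" by (rule CoFib_TFib_lifting[OF C_T_ext CoFib_D[OF i] p])
  qed
qed

lemma CoFib_E:
  assumes "i \<in> CoFib" "i \<in> Hom \<A> A B"
  obtains c C where "confl i c A B C" "C \<in> \<C>"
  by (rule CoFibE[OF CoFib_D[OF assms(1)] assms(2)]) (rule that)

section \<open>The cotorsion pair of a weakly projective model structure\<close>

lemma C_of_ext:
  assumes X: "X \<in> Obj \<A>" and s: "\<And>F. F \<in> \<T> \<Longrightarrow> ext_splits X F"
  shows "X \<in> \<C>"
proof -
  obtain Z where Z: "is_zero_object \<A> Z" using zero_object_exists by blast
  have "Zero_Arr \<A> Z X \<in> CoFib"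
  proof (rule C_I[OF X Z])
    fix p D E g assume p: "p \<in> Fib \<inter> Weq" "p \<in> Hom \<A> D E" and g: "g \<in> Hom \<A> X E"
    obtain k F where k: "confl k p F D E" "F \<in> \<T>" by (rule TFibE[OF p[unfolded TFib_eq]])
    obtain h where "h \<in> Hom \<A> X D" "p \<cdot> h = g" by (rule ext_splits_lift[OF s[OF k(2)] k(1) g])
    then show "\<exists>h \<in> Hom \<A> X D. p \<cdot> h = g" by blast
  qed
  then show ?thesis using X Z unfolding cofibrant_objects_def by blast
qed

lemma T_of_ext:
  assumes Y: "Y \<in> Obj \<A>" and s: "\<And>C. C \<in> \<C> \<Longrightarrow> ext_splits C Y"
  shows "Y \<in> \<T>"
proof (rule T_I[OF Y])
  fix i A B u assume i: "i \<in> CoFib" "i \<in> Hom \<A> A B" and u: "u \<in> Hom \<A> A Y"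
  obtain c C where c: "confl i c A B C" "C \<in> \<C>" by (rule CoFib_E[OF i])
  obtain h where "h \<in> Hom \<A> B Y" "h \<cdot> i = u" by (rule ext_splits_extend[OF s[OF c(2)] c(1) u])
  then show "\<exists>h \<in> Hom \<A> B Y. h \<cdot> i = u" by blast
qed

text \<open>The deflation d has its kernel in \<open>\<T>\<close>, so it is a weak equivalence, and
  two out of three carries triviality from G to Z.\<close>

lemma T_cokernel:
  assumes c: "confl i d F G Z" and F: "F \<in> \<T>" and G: "G \<in> \<T>"
  shows "Z \<in> \<T>"
proof -
  obtain N where N: "is_zero_object \<A> N" using zero_object_exists by blast
  note [simp] = confl_Hom(2)[OF c, unfolded Hom_iff] zero_object_Obj[OF N]
  have "d \<in> Weq" using TFibI[OF c F] unfolding TFib_eq[symmetric] by blast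
  moreover have "Zero_Arr \<A> N G \<in> Weq" by (rule T_zero'[OF G N])
  ultimately have "d \<cdot> Zero_Arr \<A> N G \<in> Weq"
    by (intro two_out_of_threeD(1)[of _ N G _ Z]) (simp_all add: Hom_iff del: Comp_Zero)
  then have "Zero_Arr \<A> N Z \<in> Weq" by simp
  then show ?thesis using N unfolding all_fibrant trivial_objects_def by auto
qed

text \<open>Factor the morphism from B to a zero object into a cofibration and a trivial fibration:
  the middle object is trivially fibrant and the cokernel of the cofibration is cofibrant.\<close>

lemma T_preenvelope:
  assumes "B \<in> Obj \<A>"
  obtains i d F C where "confl i d B F C" "F \<in> \<T>" "C \<in> \<C>"
proof -
  obtain Z where Z: "is_zero_object \<A> Z" using zero_object_exists by blast
  note [simp] = assms zero_object_Obj[OF Z]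
  have "Zero_Arr \<A> B Z \<in> Hom \<A> B Z" by (simp add: Hom_iff)
  then obtain i p F where i: "i \<in> CoFib" "p \<in> Fib \<inter> Weq" "i \<in> Hom \<A> B F" "p \<in> Hom \<A> F Z"
    using Fib_Arr by (rule_tac factorE[OF factorization_triv_Fib _ CoFib_Arr]) blast+
  note [simp] = i(3,4)[unfolded Hom_iff]
  have pz: "p = Zero_Arr \<A> F Z" by (rule to_zero_object[OF Z i(4)])
  have "F \<in> \<T>"
  proof (rule T_I)
    fix j A B u assume j: "j \<in> CoFib" "j \<in> Hom \<A> A B" and u: "u \<in> Hom \<A> A F"
    note [simp] = j(2)[unfolded Hom_iff] u[unfolded Hom_iff]
    have H: "Zero_Arr \<A> B Z \<in> Hom \<A> B Z" "Zero_Arr \<A> B Z \<cdot> j = p \<cdot> u" by (simp_all add: Hom_iff pz)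
    obtain h where "h \<in> Hom \<A> B F" "h \<cdot> j = u" by (rule lift[OF CoFib_lifting[OF j(1) i(2)] u H j(2) i(4)])
    then show "\<exists>h \<in> Hom \<A> B F. h \<cdot> j = u" by blast
  qed simp
  moreover obtain c C where "confl i c B F C" "C \<in> \<C>" by (rule CoFib_E[OF i(1,3)])
  ultimately show ?thesis using that by blast
qed

text \<open>Closure of \<open>\<T>\<close> under cokernels gives closure of \<open>\<C>\<close> under kernels: embed an extension \<open>F \<rightarrow> E \<rightarrow> K\<close> into
  \<open>F \<rightarrow> F' \<rightarrow> G\<close> with \<open>F'\<close> and hence \<open>G\<close> in \<open>\<T>\<close>; then \<open>K \<rightarrow> G\<close> extends over \<open>C\<^sub>1\<close> and lifts to \<open>F'\<close>.\<close>

lemma C_kernel: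
  assumes c: "confl a b K C1 C2" and C1: "C1 \<in> \<C>" and C2: "C2 \<in> \<C>"
  shows "K \<in> \<C>"
proof (rule C_of_ext)
  note [simp] = confl_Hom(1)[OF c, unfolded Hom_iff]
  show "K \<in> Obj \<A>" by simp
  fix F assume F: "F \<in> \<T>"
  show "ext_splits K F"
  proof (rule ext_splitsI)
    fix i p E assume ip: "confl i p F E K"
    note [simp] = confl_Hom(1,2)[OF ip, unfolded Hom_iff]
    have E: "E \<in> Obj \<A>" by simp
    obtain e e' F' C' where e: "confl e e' E F' C'" "F' \<in> \<T>" "C' \<in> \<C>" by (rule T_preenvelope[OF E])
    note [simp] = confl_Hom(1)[OF e(1), unfolded Hom_iff]
    have "e \<cdot> i \<in> inflations \<A>" by (rule inflation_Comp[OF confl_inflation[OF ip] confl_inflation[OF e(1)]]) simp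
    moreover have "e \<cdot> i \<in> Hom \<A> F F'" by (simp add: Hom_iff)
    ultimately obtain q G where q: "confl (e \<cdot> i) q F F' G" by (rule inflationE)
    have G: "G \<in> \<T>" by (rule T_cokernel[OF q F e(2)])
    note [simp] = confl_Hom(2)[OF q, unfolded Hom_iff]
    have qei: "q \<cdot> (e \<cdot> i) = Zero_Arr \<A> F G" by (rule confl_Zero[OF q])
    then have "(q \<cdot> e) \<cdot> i = Zero_Arr \<A> F G" by simp
    moreover have "q \<cdot> e \<in> Hom \<A> E G" by (simp add: Hom_iff)
    ultimately obtain z where z: "z \<in> Hom \<A> K G" "z \<cdot> p = q \<cdot> e" using confl_cofactor[OF ip] by metis
    obtain z1 where z1: "z1 \<in> Hom \<A> C1 G" "z1 \<cdot> a = z" by (rule ext_splits_extend[OF C_T_ext[OF C2 G] c z(1)])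
    obtain z2 where z2: "z2 \<in> Hom \<A> C1 F'" "q \<cdot> z2 = z1" by (rule ext_splits_lift[OF C_T_ext[OF C1 F] q z1(1)])
    note [simp] = z(1)[unfolded Hom_iff] z1(1)[unfolded Hom_iff] z2(1)[unfolded Hom_iff]
    have d: "q \<cdot> (e \<oplus> neg (z2 \<cdot> (a \<cdot> p))) = Zero_Arr \<A> E G"
      by (simp add: Comp_Comp_eq[OF z2(2)] Comp_Comp_eq[OF z1(2)] z(2))
    have dH: "e \<oplus> neg (z2 \<cdot> (a \<cdot> p)) \<in> Hom \<A> E F'" by (simp add: Hom_iff)
    obtain r where r: "r \<in> Hom \<A> E F" "(e \<cdot> i) \<cdot> r = e \<oplus> neg (z2 \<cdot> (a \<cdot> p))" by (rule confl_factor[OF q dH d])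
    note [simp] = r(1)[unfolded Hom_iff]
    have "((e \<cdot> i) \<cdot> r) \<cdot> i = e \<cdot> i" unfolding r(2) by (simp add: confl_Zero[OF ip])
    then have eq: "(e \<cdot> i) \<cdot> (r \<cdot> i) = (e \<cdot> i) \<cdot> Ident \<A> F" by simp
    have "r \<cdot> i = Ident \<A> F" by (rule confl_mono[OF q, where T = F, OF _ _ eq]) (simp_all add: Hom_iff)
    then show "\<exists>r \<in> Hom \<A> E F. r \<cdot> i = Ident \<A> F" using r(1) by blast
  qed
qed

lemma \<Psi>_cotorsion_pair: "cotorsion_pair \<A> \<C> \<T>"
proof -
  have "\<C> = {X \<in> Obj \<A>. \<forall>F \<in> \<T>. Ext1_vanishes \<A> X F}"
  proof (intro equalityI subsetI CollectI conjI ballI)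
    fix X F assume "X \<in> \<C>" "F \<in> \<T>"
    then show "Ext1_vanishes \<A> X F" using C_T_ext Ext1_vanishes_iff C_Obj T_Obj by blast
  next
    fix X assume "X \<in> {X \<in> Obj \<A>. \<forall>F \<in> \<T>. Ext1_vanishes \<A> X F}"
    then show "X \<in> \<C>" using C_of_ext Ext1_vanishes_iff T_Obj by blast
  qed (rule C_Obj)
  moreover have "\<T> = {Y \<in> Obj \<A>. \<forall>C \<in> \<C>. Ext1_vanishes \<A> C Y}"
  proof (intro equalityI subsetI CollectI conjI ballI)
    fix X F assume "F \<in> \<C>" "X \<in> \<T>"
    then show "Ext1_vanishes \<A> F X" using C_T_ext Ext1_vanishes_iff C_Obj T_Obj by blast
  next
    fix X assume "X \<in> {Y \<in> Obj \<A>. \<forall>C \<in> \<C>. Ext1_vanishes \<A> C Y}"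
    then show "X \<in> \<T>" using T_of_ext Ext1_vanishes_iff C_Obj by blast
  qed (rule T_Obj)
  moreover have "\<C> \<subseteq> Obj \<A>" "\<T> \<subseteq> Obj \<A>" using C_Obj T_Obj by blast+
  ultimately show ?thesis unfolding cotorsion_pair_def by (intro conjI)
qed

lemma adm_exactI: "confl i d X Y Z \<Longrightarrow> adm_exact \<A> X Y Z"
  unfolding adm_exact_def confl_def by blast

lemma \<Psi>_complete_pair: "complete_pair \<A> \<C> \<T>"
  unfolding complete_pair_def
proof (intro ballI conjI)
  fix B assume B [simp]: "B \<in> Obj \<A>"
  obtain i d F C where "confl i d B F C" "F \<in> \<T>" "C \<in> \<C>" by (rule T_preenvelope[OF B])
  then show "\<exists>F' \<in> \<T>. \<exists>C' \<in> \<C>. adm_exact \<A> B F' C'" using adm_exactI by blast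
  obtain Z where Z: "is_zero_object \<A> Z" using zero_object_exists by blast
  have [simp]: "Z \<in> Obj \<A>" by (rule zero_object_Obj[OF Z])
  \<comment> \<open>The other sequence is a cofibrant replacement: factoring the morphism from Z to
    B gives a cofibrant C and a trivial fibration onto B, whose kernel lies in
    \<open>\<T>\<close>.\<close>
  have "Zero_Arr \<A> Z B \<in> Hom \<A> Z B" by (simp add: Hom_iff)
  then obtain i p C where i: "i \<in> CoFib" "p \<in> Fib \<inter> Weq" "i \<in> Hom \<A> Z C" "p \<in> Hom \<A> C B"
    using Fib_Arr by (rule_tac factorE[OF factorization_triv_Fib _ CoFib_Arr]) blast+
  have "Zero_Arr \<A> Z C \<in> CoFib" using from_zero_object[OF Z i(3)] i(1) by simp
  moreover have "C \<in> Obj \<A>" using i(3) by (simp add: Hom_iff)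
  ultimately have C: "C \<in> \<C>" using Z unfolding cofibrant_objects_def by blast
  obtain k F where "confl k p F C B" "F \<in> \<T>" by (rule TFibE[OF i(2,4)[unfolded TFib_eq]])
  then show "\<exists>F \<in> \<T>. \<exists>C \<in> \<C>. adm_exact \<A> F C B" using C adm_exactI by blast
qed

lemma \<Psi>_hereditary_pair: "hereditary_pair \<A> \<C> \<T>"
  unfolding hereditary_pair_def
proof (intro conjI allI impI; elim conjE)
  fix X Y Z assume "adm_exact \<A> X Y Z" and XY: "Y \<in> \<C>" "Z \<in> \<C>"
  then obtain i d where "confl i d X Y Z" unfolding adm_exact_def confl_def by blast
  then show "X \<in> \<C>" using C_kernel XY by blast
next
  fix X Y Z assume "adm_exact \<A> X Y Z" and XY: "X \<in> \<T>" "Y \<in> \<T>"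
  then obtain i d where "confl i d X Y Z" unfolding adm_exact_def confl_def by blast
  then show "Z \<in> \<T>" using T_cokernel XY by blast
qed

text \<open>For W both cofibrant and trivial, the morphism from a zero object to W is a trivial
  cofibration, hence lifts against every fibration.\<close>

lemma Fib_lift:
  assumes p: "p \<in> Fib" "p \<in> Hom \<A> D E" and W: "W \<in> \<C> \<inter> \<T>" and g: "g \<in> Hom \<A> W E"
  obtains h where "h \<in> Hom \<A> W D" "p \<cdot> h = g"
proof -
  obtain Z where Z: "is_zero_object \<A> Z" using zero_object_exists by blast
  note [simp] = p(2)[unfolded Hom_iff] g[unfolded Hom_iff] zero_object_Obj[OF Z]
  have H: "Zero_Arr \<A> Z D \<in> Hom \<A> Z D" "g \<cdot> Zero_Arr \<A> Z W = p \<cdot> Zero_Arr \<A> Z D" "Zero_Arr \<A> Z W \<in> Hom \<A> Z W"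
    by (simp_all add: Hom_iff)
  have "Zero_Arr \<A> Z W \<in> CoFib \<inter> Weq" using C_zero[OF _ Z] T_zero'[OF _ Z] W by blast
  from Fib_lifting[OF this p(1)] show ?thesis by (rule lift[OF _ H(1) g H(2) H(3) p(2)]) (rule that)
qed

text \<open>The approximation is the fibration t obtained by factoring the morphism from a zero
  object to B: its domain is cofibrant and trivial, and \<open>Fib_lift\<close> lifts morphisms from
  such objects along t.\<close>

lemma \<Psi>_contravariantly_finite: "contravariantly_finite \<A> (\<C> \<inter> \<T>)"
  unfolding contravariantly_finite_def
proof
  fix B assume B [simp]: "B \<in> Obj \<A>"
  obtain Z where Z: "is_zero_object \<A> Z" using zero_object_exists by blast
  have [simp]: "Z \<in> Obj \<A>" by (rule zero_object_Obj[OF Z])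
  have "Zero_Arr \<A> Z B \<in> Hom \<A> Z B" by (simp add: Hom_iff)
  then obtain i t W where i: "i \<in> CoFib \<inter> Weq" "t \<in> Fib" "i \<in> Hom \<A> Z W" "t \<in> Hom \<A> W B"
    using CoFib_Arr by (rule_tac factorE[OF factorization_triv_CoFib _ _ Fib_Arr]) blast+
  have z: "Zero_Arr \<A> Z W \<in> CoFib \<inter> Weq" using from_zero_object[OF Z i(3)] i(1) by simp
  have WO: "W \<in> Obj \<A>" using i(3) by (simp add: Hom_iff)
  have "W \<in> \<C>" using z WO Z unfolding cofibrant_objects_def by blast
  moreover have "W \<in> \<T>" using z WO Z unfolding trivial_objects_def all_fibrant by blast
  moreover have "\<exists>h \<in> Hom \<A> W' W. t \<cdot> h = g" if "W' \<in> \<C> \<inter> \<T>" "g \<in> Hom \<A> W' B" for W' g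
    using Fib_lift[OF i(2,4) that] by blast
  ultimately show "\<exists>W \<in> \<C> \<inter> \<T>. \<exists>t \<in> Hom \<A> W B. \<forall>W' \<in> \<C> \<inter> \<T>. \<forall>g \<in> Hom \<A> W' B. \<exists>h \<in> Hom \<A> W' W. t \<cdot> h = g"
    using i(4) by blast
qed

lemma \<Psi>_in_S_C: "\<Psi> \<A> (CoFib, Fib, Weq) \<in> S_C \<A>"
  unfolding \<Psi>_def S_C_def
  using \<Psi>_cotorsion_pair \<Psi>_complete_pair \<Psi>_hereditary_pair \<Psi>_contravariantly_finite by simp

text \<open>Extending the identity of A along i splits i. The morphism from Z to the complement W is
  then a retract of i, hence a weak equivalence, which makes W trivial.\<close>

lemma TCoFib_biproduct:
  assumes i: "i \<in> CoFib \<inter> Weq" "i \<in> Hom \<A> A B"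
  obtains W t r c where "is_biproduct \<A> A W B i t r c" "W \<in> \<C> \<inter> \<T>"
proof -
  note [simp] = i(2)[unfolded Hom_iff]
  have idA: "Ident \<A> A \<in> Hom \<A> A A" by (simp add: Hom_iff)
  obtain r where r: "r \<in> Hom \<A> B A" "r \<cdot> i = Ident \<A> A" using TCoFib_extend[OF _ _ i(2) idA] i(1) by blast
  obtain c W where c: "confl i c A B W" "W \<in> \<C>" using CoFib_E[OF _ i(2)] i(1) by blast
  obtain t where b: "is_biproduct \<A> A W B i t r c" by (rule retraction_biproduct[OF c(1) r])
  note b' = biproductD[OF b]
  obtain Z where Z: "is_zero_object \<A> Z" using zero_object_exists by blast
  note [simp] = b'(1-4)[unfolded Hom_iff] zero_object_Obj[OF Z]
  have "is_retract_of \<A> (Zero_Arr \<A> Z W) i"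
    by (rule retract_ofI[of _ Z W _ A B "Zero_Arr \<A> Z A" "Zero_Arr \<A> A Z" t c])
      (simp_all add: Hom_iff zero_object_Ident[OF Z] b'(6,8))
  then have "Zero_Arr \<A> Z W \<in> Weq" using Weq_retract i(1) unfolding retract_closed_def by blast
  then have "W \<in> \<T>" using Z unfolding trivial_objects_def all_fibrant by auto
  then show ?thesis using that[OF b] c(2) by blast
qed

lemma Fib_eq: "Fib = Fib_\<omega> \<A> \<C> \<T>"
proof (intro equalityI subsetI)
  fix f assume f: "f \<in> Fib"
  then have "f \<in> Arr \<A>" using Fib_Arr by blast
  moreover from this have "\<exists>h \<in> Hom \<A> W (Dom \<A> f). f \<cdot> h = g" if "W \<in> \<C> \<inter> \<T>" "g \<in> Hom \<A> W (Cod \<A> f)" for W g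
    using Fib_lift[OF f Arr_Hom that] by blast
  ultimately show "f \<in> Fib_\<omega> \<A> \<C> \<T>" unfolding Fib_\<omega>_def by blast
next
  fix f assume f: "f \<in> Fib_\<omega> \<A> \<C> \<T>"
  show "f \<in> Fib"
  proof (rule Fib_of_lifting)
    show "f \<in> Arr \<A>" using f unfolding Fib_\<omega>_def by blast
    fix i assume i: "i \<in> CoFib \<inter> Weq"
    then obtain A B where iH: "i \<in> Hom \<A> A B" using CoFib_Arr Arr_Hom by blast
    obtain W t r c where "is_biproduct \<A> A W B i t r c" "W \<in> \<C> \<inter> \<T>" by (rule TCoFib_biproduct[OF i iH])
    then show "has_lifting \<A> i f" using f by (rule split_lifting)
  qed
qed

lemma \<Phi>_\<Psi>: "\<Phi> \<A> (\<Psi> \<A> (CoFib, Fib, Weq)) = (CoFib, Fib, Weq)"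
proof -
  interpret S: cotorsion_setting \<A> \<C> \<T>
    by unfold_locales (use \<Psi>_in_S_C in \<open>simp add: \<Psi>_def\<close>)
  have M: "model_structure \<A> CoFib Fib (Weq_\<omega> \<A> \<C> \<T>)"
    using S.model_structure_\<omega> by (simp only: CoFib_eq[symmetric] Fib_eq[symmetric])
  have "Weq \<subseteq> Weq_\<omega> \<A> \<C> \<T>" by (rule Weq_subset[OF M])
  moreover have "Weq_\<omega> \<A> \<C> \<T> \<subseteq> Weq"
    by (rule model_structure.Weq_subset[OF M]) unfold_locales
  ultimately have "Weq_\<omega> \<A> \<C> \<T> = Weq" by (rule equalityI[rotated])
  then show ?thesis unfolding \<Phi>_def \<Psi>_def by (simp add: CoFib_eq[symmetric] Fib_eq[symmetric])
qed

end

theorem theorem1p3: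
  fixes \<A> :: "('o, 'm, 'z) exact_cat_data_scheme"
  assumes "wic_exact_category \<A>"
  shows "bij_betw (\<Phi> \<A>) (S_C \<A>) (S_M \<A>) \<and>
         bij_betw (\<Psi> \<A>) (S_M \<A>) (S_C \<A>) \<and>
         (\<forall>P \<in> S_C \<A>. \<Psi> \<A> (\<Phi> \<A> P) = P) \<and>
         (\<forall>M \<in> S_M \<A>. \<Phi> \<A> (\<Psi> \<A> M) = M)"
proof -
  have C: "\<Phi> \<A> P \<in> S_M \<A> \<and> \<Psi> \<A> (\<Phi> \<A> P) = P" if "P \<in> S_C \<A>" for P
  proof -
    obtain X Y where P: "P = (X, Y)" by (rule prod.exhaust)
    interpret cotorsion_setting \<A> X Y
      using assms that P by (intro cotorsion_setting.intro cotorsion_setting_axioms.intro) simp_all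
    show ?thesis unfolding P using \<Phi>_in_S_M \<Psi>_\<Phi> by blast
  qed
  have M: "\<Psi> \<A> M \<in> S_C \<A> \<and> \<Phi> \<A> (\<Psi> \<A> M) = M" if "M \<in> S_M \<A>" for M
  proof -
    obtain F G H where M: "M = (F, G, H)" by (rule prod_cases3)
    interpret weakly_projective_setting \<A> F G H
      using assms that M
      by (intro weakly_projective_setting.intro weakly_projective_setting_axioms.intro) (simp_all add: S_M_def)
    show ?thesis unfolding M using \<Psi>_in_S_C \<Phi>_\<Psi> by blast
  qed
  have "bij_betw (\<Phi> \<A>) (S_C \<A>) (S_M \<A>)"
    by (rule bij_betw_byWitness[of _ "\<Psi> \<A>"]) (use C M in blast)+
  moreover have "bij_betw (\<Psi> \<A>) (S_M \<A>) (S_C \<A>)"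
    by (rule bij_betw_byWitness[of _ "\<Phi> \<A>"]) (use C M in blast)+
  ultimately show ?thesis using C M by blast
qed

end
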